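(* Let $d\ge 2$ and let $\nu$ be a nearly gamma probability measure on $\mathbb{R}_+$ with an exponential moment, i.e. such that there exists $\delta>0$ with $\int e^{\delta x}\,d\nu(x)<\infty$. Let $E$ be the set of edges of $\mathbb{Z}^d$ and let $\mu=\nu^{\otimes E}$ on $\mathbb{R}_+^E$. Then there exist two positive constants $C_1$ and $C_2$ such that, for any vertex $v\in\mathbb{Z}^d$ with $|v|\ge 2$ and any positive real number $t\le |v|$, $$\mu\left(\left|d_x(0,v)-\int d_x(0,v)\,d\mu(x)\right|> t\sqrt{\frac{|v|}{\log |v|}}\right)\le C_1e^{-C_2t}.$$
   Context: $\mathbb{Z}^d$ is the nearest-neighbour lattice and $|\cdot|$ denotes the $L^1$-norm of vertices. For $x=(x_e)_{e\in E}\in\mathbb{R}_+^E$ and vertices $u,v$, the first passage time is $d_x(u,v)=\inf_{\alpha}\sum_{e\in\alpha}x_e$, the infimum being over all paths $\alpha$ with end points $u$ and $v$. Let $g(x)=\frac{1}{\sqrt{2\pi}}e^{-x^2/2}$ and $G(x)=\int_{-\infty}^x g(u)\,du$, with the convention $g\circ G^{-1}(0)=g\circ G^{-1}(1)=0$. Nearly gamma: let $\nu$ be a probability measure on $\mathbb{R}_+$, absolutely continuous with respect to Lebesgue measure, with density $h$ and distribution function $H(t)=\int_0^t h(u)\,du$. Let $I=\{t\ge 0 : h(t)>0\}$ and define $\psi:I\to\mathbb{R}$ by $\psi(y)=\frac{g\circ G^{-1}(H(y))}{h(y)}$. Then $\nu$ is nearly gamma if (i) $I$ is an interval; (ii) $h$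 restricted to $I$ is continuous; (iii) there exists a positive real number $A$ such that $\psi(y)\le A\sqrt{y}$ for all $y\in I$. *)

theory Defs
  imports "HOL-Probability.Probability"
begin

definition l1_norm :: "int ^ 'd \<Rightarrow> int" where
  "l1_norm v = (\<Sum>i\<in>UNIV. \<bar>v $ i\<bar>)"

definition lattice_adj :: "int ^ 'd \<Rightarrow> int ^ 'd \<Rightarrow> bool" where
  "lattice_adj u w \<longleftrightarrow> l1_norm (u - w) = 1"

definition lattice_edges :: "(int ^ 'd) set set" where
  "lattice_edges = {{u, w} | u w. lattice_adj u w}"

text \<open>A path is given by its nonempty list of successive vertices; a single vertex is the empty
  path. Vertices may repeat. For nonnegative edge times, neither this nor counting a
  repeated edge only once changes the infimum defining the passage time, because loops can be
  erased.\<close>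

definition lattice_path :: "int ^ 'd \<Rightarrow> (int ^ 'd) list \<Rightarrow> int ^ 'd \<Rightarrow> bool" where
  "lattice_path u p v \<longleftrightarrow> p \<noteq> [] \<and> hd p = u \<and> last p = v \<and> successively lattice_adj p"

definition path_edges :: "(int ^ 'd) list \<Rightarrow> (int ^ 'd) set set" where
  "path_edges p = {{p ! i, p ! Suc i} | i. Suc i < length p}"

definition passage_time :: "((int ^ 'd) set \<Rightarrow> real) \<Rightarrow> int ^ 'd \<Rightarrow> int ^ 'd \<Rightarrow> real" where
  "passage_time x u v = (INF p\<in>{p. lattice_path u p v}. \<Sum>e\<in>path_edges p. x e)"

definition gauss_cdf :: "real \<Rightarrow> real" where
  "gauss_cdf x = (LINT u:{..x}|lborel. std_normal_density u)"

text \<open>The function \<open>g \<circ> G\<inverse>\<close>, with value 0 at the points 0 and 1, which are not in the range of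
  \<open>G\<close>.\<close>

definition gauss_isoperimetric :: "real \<Rightarrow> real" where
  "gauss_isoperimetric p =
     (if p = 0 \<or> p = 1 then 0 else std_normal_density (inv gauss_cdf p))"

text \<open>A measure on the nonnegative reals has \<open>{0..}\<close> as its space, so that a product of copies of it
  lives on families of nonnegative edge times. Only the values of \<open>h\<close> on \<open>{0..}\<close> matter. As a density
  is determined only almost everywhere, the conditions are required of some version \<open>h\<close>.\<close>

definition nearly_gamma_density :: "(real \<Rightarrow> real) \<Rightarrow> bool" where
  "nearly_gamma_density h \<longleftrightarrow>
     (let I = {t. 0 \<le> t \<and> h t > 0};
          H = (\<lambda>t. LINT u:{0..t}|lborel. h u);
          \<psi> = (\<lambda>y. gauss_isoperimetric (H y) / h y)
      in is_interval I \<and> continuous_on I h \<and> (\<exists>A>0. \<forall>y\<in>I. \<psi> y \<le> A * sqrt y))"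

definition nearly_gamma :: "real measure \<Rightarrow> bool" where
  "nearly_gamma \<nu> \<longleftrightarrow>
     prob_space \<nu> \<and>
     (\<exists>h. h \<in> borel_measurable (restrict_space lborel {0..}) \<and> (\<forall>t\<ge>0. 0 \<le> h t) \<and>
          \<nu> = density (restrict_space lborel {0..}) (\<lambda>t. ennreal (h t)) \<and>
          nearly_gamma_density h)"

end

theory Submission
  imports Defs "HOL-Real_Asymp.Real_Asymp"
begin

text \<open>
  Why the fluctuations are of order at most \<open>sqrt (\<bar>v\<bar> / ln \<bar>v\<bar>)\<close>. Let \<open>f\<close> be the passage time from \<open>0\<close>
  to \<open>v\<close>. If the edge times are functions of independent Gaussian variables, the Poincare inequality
  bounds the variance of \<open>f\<close> by the sum of the squared influences of the edges, which is of order
  \<open>\<bar>v\<bar>\<close>. An inequality of Falik and Samorodnitsky, which rests on the logarithmic Sobolev inequality,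
  gains a factor \<open>ln \<bar>v\<bar>\<close> as soon as every single edge has an influence in mean that is smaller
  than a negative power of \<open>\<bar>v\<bar>\<close>. Applied to \<open>exp (\<theta> f / 2)\<close> for all small \<open>\<theta>\<close> instead of to \<open>f\<close>, it
  gives exponential tails.

  The nearly gamma condition enters through the Gaussian representation. It implies that
  \<open>\<nu>\<close> is the law of \<open>(R s)\<^sup>2\<close> for a Gaussian variable \<open>s\<close> and a Lipschitz function \<open>R\<close>
  (\<open>nearly_gamma_gaussian_image\<close>). Hence the derivative of an edge time
  \<open>x\<close> is of order \<open>sqrt x\<close>, and the squared influences add up to a multiple of the total weight of the
  minimal path, that is, of \<open>f\<close> itself, which may be truncated at a level \<open>M\<close> of order \<open>\<bar>v\<bar>\<close>.

  The Gaussian variables are replaced by normalised sums of independent signs, so that the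
  analytic part takes place on a finite cube: the logarithmic Sobolev inequality
  (\<open>cube_log_sobolev\<close>), the inequality of Falik and Samorodnitsky (\<open>cube_falik_samorodnitsky\<close>)
  and the resulting variance bound for exponentials (\<open>cube_exp_variance\<close>) are statements about finite
  sums. The central limit theorem, in the form \<open>PiM_sign_law_tendsto\<close>, brings the bound back to the
  Gaussian setting.

  An edge next to \<open>0\<close> has a large influence on \<open>f\<close>. Following Benjamini, Kalai and Schramm, \<open>f\<close> is
  therefore replaced by the average \<open>F\<close> of the passage times from \<open>z\<close> to \<open>z + v\<close>, over all \<open>z\<close> in a box
  of side \<open>m\<close> of order \<open>\<bar>v\<bar> powr (1 / 4)\<close>. By translation invariance, the influence of an edge on \<open>F\<close> is governed
  by the expected proportion of the box that one minimal path visits. This is small because a minimal path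
  makes of order \<open>m\<close> steps in a box of side \<open>m\<close>, which has \<open>m ^ d\<close> points (\<open>expected_pivotal_freq_le\<close>). The
  linear bound on the number of steps is a union bound over simple paths, which uses that \<open>\<nu>\<close> has
  no atom at \<open>0\<close>.

  The variance bound for \<open>exp (\<theta> F / 2)\<close> is a recursion for the moment generating function of \<open>F\<close>, whose
  iteration yields the tail bound for \<open>F\<close> (\<open>tail_of_exp_variance\<close>). Finally \<open>F\<close> differs from \<open>f\<close> by detours
  of length of order \<open>m\<close> at both ends, and these are negligible against \<open>sqrt (\<bar>v\<bar> / ln \<bar>v\<bar>)\<close>. The
  restriction \<open>t \<le> \<bar>v\<bar>\<close> is used for the truncation, which fails with a probability of at most
  \<open>exp (- \<bar>v\<bar>)\<close>.
\<close>

section \<open>Nearly gamma measures as images of the Gaussian measure\<close>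

lemma lower_integral_deriv:
  fixes f :: "real \<Rightarrow> real"
  assumes f: "integrable lborel f" and c: "continuous_on {x..y} f" and t: "x < t" "t < y"
  shows "((\<lambda>u. LINT w:{..u}|lborel. f w) has_real_derivative f t) (at t)"
proof -
  have si: "set_integrable lborel A f" if "A \<in> sets lborel" for A
    using f that unfolding set_integrable_def by (intro integrable_mult_indicator)
  have eq: "(LINT w:{..u}|lborel. f w) = (LINT w:{..x}|lborel. f w) + integral {x..u} f" if "u \<in> {x..y}" for u
  proof -
    have "(LINT w:{..u}|lborel. f w) = (LINT w:{..x} \<union> {x<..u}|lborel. f w)"
    proof -
      have "{..u} = {..x} \<union> {x<..u}" using that by auto
      then show ?thesis by simp
    qed
    also have "\<dots> = (LINT w:{..x}|lborel. f w) + (LINT w:{x<..u}|lborel. f w)"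
      by (rule set_integral_Un) (auto intro!: si)
    also have "(LINT w:{x<..u}|lborel. f w) = (LINT w:{x..u}|lborel. f w)"
      unfolding set_lebesgue_integral_def
    proof (rule integral_cong_AE)
      have [measurable]: "f \<in> borel_measurable borel" using f by simp
      show "(\<lambda>w. indicat_real {x<..u} w *\<^sub>R f w) \<in> borel_measurable lborel"
        "(\<lambda>w. indicat_real {x..u} w *\<^sub>R f w) \<in> borel_measurable lborel" by measurable
      show "AE w in lborel. indicat_real {x<..u} w *\<^sub>R f w = indicat_real {x..u} w *\<^sub>R f w"
        using AE_lborel_singleton[of x] by eventually_elim (auto simp: indicator_def)
    qed
    also have "\<dots> = integral {x..u} f"
      by (rule set_borel_integral_eq_integral(2)) (auto intro: si)
    finally show ?thesis .
  qed
  have "((\<lambda>u. (LINT w:{..x}|lborel. f w) + integral {x..u} f) has_real_derivative f t) (at t within {x..y})"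
    by (auto intro!: derivative_eq_intros integral_has_real_derivative c) (use t in auto)
  then have "((\<lambda>u. LINT w:{..u}|lborel. f w) has_real_derivative f t) (at t within {x..y})"
    by (rule has_field_derivative_transform_within[where d = 1]) (use t eq[symmetric] in auto)
  then show ?thesis using t by (simp add: at_within_Icc_at)
qed

lemma gauss_cdf_deriv: "(gauss_cdf has_real_derivative std_normal_density t) (at t)"
proof -
  have "continuous_on {t - 1..t + 1} std_normal_density"
    unfolding normal_density_def by (intro continuous_intros) auto
  then show ?thesis
    using lower_integral_deriv[of std_normal_density "t - 1" "t + 1" t]
    unfolding gauss_cdf_def by (simp add: gauss_cdf_def[abs_def])
qed

lemma std_normal_density_pos: "std_normal_density t > 0"
  by (simp add: normal_density_pos)

lemma gauss_cdf_strict_mono: "s < t \<Longrightarrow> gauss_cdf s < gauss_cdf t"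
  by (rule DERIV_pos_imp_increasing) (use gauss_cdf_deriv std_normal_density_pos in blast)+

lemma gauss_cdf_eq_cdf: "gauss_cdf t = cdf std_normal_distribution t"
proof -
  have "cdf std_normal_distribution t = (\<integral>u. indicator {..t} u \<partial>std_normal_distribution)"
    by (simp add: cdf_def)
  also have "\<dots> = (\<integral>u. std_normal_density u * indicator {..t} u \<partial>lborel)"
    by (subst integral_density) auto
  also have "\<dots> = gauss_cdf t"
    unfolding gauss_cdf_def set_lebesgue_integral_def by (simp add: mult.commute)
  finally show ?thesis by simp
qed

lemma gauss_cdf_less_1: "gauss_cdf t < 1"
proof -
  have "gauss_cdf t < gauss_cdf (t + 1)" by (rule gauss_cdf_strict_mono) simp
  also have "\<dots> \<le> 1"
  proof -
    interpret real_distribution std_normal_distribution by (rule real_dist_normal_dist)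
    show ?thesis unfolding gauss_cdf_eq_cdf by (rule cdf_bounded_prob)
  qed
  finally show ?thesis .
qed

lemma gauss_cdf_pos: "gauss_cdf t > 0"
proof -
  have "0 \<le> gauss_cdf (t - 1)" unfolding gauss_cdf_eq_cdf cdf_def by simp
  also have "\<dots> < gauss_cdf t" by (rule gauss_cdf_strict_mono) simp
  finally show ?thesis .
qed

lemma gauss_cdf_onto:
  assumes "0 < p" "p < 1"
  obtains s where "gauss_cdf s = p"
proof -
  interpret real_distribution std_normal_distribution by (rule real_dist_normal_dist)
  have "eventually (\<lambda>s. gauss_cdf s < p) at_bot"
    using cdf_lim_at_bot assms(1) unfolding gauss_cdf_eq_cdf[abs_def] by (rule order_tendstoD)
  then obtain a where a: "gauss_cdf a < p" by (auto simp: eventually_at_bot_linorder)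
  have "eventually (\<lambda>s. p < gauss_cdf s) at_top"
    using cdf_lim_at_top_prob assms(2) unfolding gauss_cdf_eq_cdf[abs_def] by (rule order_tendstoD)
  then obtain b where b: "p < gauss_cdf b" by (auto simp: eventually_at_top_linorder)
  have "a \<le> b" using a b gauss_cdf_strict_mono[of b a] by (cases "a \<le> b") auto
  then have "\<exists>x\<ge>a. x \<le> b \<and> gauss_cdf x = p"
    using a b gauss_cdf_deriv by (intro IVT) (auto intro: DERIV_isCont)
  then show ?thesis using that by blast
qed

lemma inj_gauss_cdf: "inj gauss_cdf"
  by (rule injI) (metis gauss_cdf_strict_mono less_irrefl linorder_cases)

lemma inv_gauss_cdf_deriv:
  "(inv gauss_cdf has_real_derivative inverse (std_normal_density s)) (at (gauss_cdf s))"
proof (rule DERIV_inverse_function[where a = 0 and b = 1])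
  show "(gauss_cdf has_real_derivative std_normal_density s) (at (inv gauss_cdf (gauss_cdf s)))"
    by (simp add: inj_gauss_cdf gauss_cdf_deriv)
  show "isCont (inv gauss_cdf) (gauss_cdf s)"
    by (rule isCont_inverse_function[where d = 1])
      (auto simp: inj_gauss_cdf intro: DERIV_isCont gauss_cdf_deriv)
  show "gauss_cdf (inv gauss_cdf y) = y" if "0 < y" "y < 1" for y
    using that by (metis gauss_cdf_onto f_inv_into_f rangeI)
qed (use std_normal_density_pos[of s] gauss_cdf_pos gauss_cdf_less_1 in auto)

text \<open>Let \<open>H\<close> be the distribution function of \<open>\<nu>\<close>. The transport \<open>T = G\<inverse> \<circ> H\<close> of \<open>\<nu>\<close> to the Gaussian
  measure has derivative \<open>1 / \<psi> \<ge> 1 / (A sqrt y)\<close>, so \<open>T - (2 / A) sqrt\<close> is increasing. For the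
  inverse \<open>Q\<close> of \<open>T\<close> this says that \<open>sqrt Q\<close> is \<open>A / 2\<close>-Lipschitz.\<close>

lemma nearly_gamma_gaussian_image:
  assumes "nearly_gamma \<nu>"
  obtains R L where "mono R" "\<And>s. 0 \<le> R s" "L > 0" "\<And>s t. s \<le> t \<Longrightarrow> R t - R s \<le> L * (t - s)"
    "\<nu> = distr std_normal_distribution (restrict_space borel {0..}) (\<lambda>s. (R s)\<^sup>2)"
proof -
  obtain h where hm: "h \<in> borel_measurable (restrict_space lborel {0..})"
    and h0: "\<And>t. t \<ge> 0 \<Longrightarrow> 0 \<le> h t"
    and nu: "\<nu> = density (restrict_space lborel {0..}) (\<lambda>t. ennreal (h t))"
    and ng: "nearly_gamma_density h" and P: "prob_space \<nu>"
    using assms unfolding nearly_gamma_def by blast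
  define I where "I = {t. 0 \<le> t \<and> h t > 0}"
  define H where "H = (\<lambda>t. LINT u:{0..t}|lborel. h u)"
  obtain A where A: "A > 0" "\<And>y. y \<in> I \<Longrightarrow> gauss_isoperimetric (H y) / h y \<le> A * sqrt y"
    and I: "is_interval I" "continuous_on I h"
    using ng unfolding nearly_gamma_density_def Let_def I_def H_def by blast
  define f where "f t = indicator {0..} t * h t" for t :: real
  have fm [measurable]: "f \<in> borel_measurable borel"
    using hm unfolding f_def
    by (subst (asm) borel_measurable_restrict_space_iff) (auto simp: mult.commute)
  have f0: "0 \<le> f t" for t using h0 by (auto simp: f_def indicator_def)
  define N where "N = density lborel (\<lambda>t. ennreal (f t))"
  have em: "emeasure \<nu> B = emeasure N B" if "B \<in> sets borel" "B \<subseteq> {0..}" for B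
  proof -
    have [measurable]: "h \<in> borel_measurable (restrict_space lborel {0..})" by (fact hm)
    have B: "B \<in> sets (restrict_space lborel {0..})"
      using that by (subst sets_restrict_space_iff) auto
    have "emeasure \<nu> B = (\<integral>\<^sup>+t. ennreal (h t) * indicator B t \<partial>restrict_space lborel {0..})"
      unfolding nu using B by (intro emeasure_density) auto
    also have "\<dots> = (\<integral>\<^sup>+t. ennreal (h t) * indicator B t * indicator {0..} t \<partial>lborel)"
      by (rule nn_integral_restrict_space) auto
    also have "\<dots> = (\<integral>\<^sup>+t. ennreal (f t) * indicator B t \<partial>lborel)"
      by (intro nn_integral_cong) (auto simp: f_def indicator_def)
    also have "\<dots> = emeasure N B" unfolding N_def using that by (subst emeasure_density) auto
    finally show ?thesis .
  qed
  have spnu: "space \<nu> = {0..}" by (simp add: nu)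
  have N0: "emeasure N {..<0} = 0"
  proof -
    have "emeasure N {..<0} = (\<integral>\<^sup>+t. ennreal (f t) * indicator {..<0} t \<partial>lborel)"
      unfolding N_def by (subst emeasure_density) auto
    also have "\<dots> = (\<integral>\<^sup>+t. 0 \<partial>(lborel :: real measure))"
      by (intro nn_integral_cong) (auto simp: f_def indicator_def)
    finally show ?thesis by simp
  qed
  have PN: "prob_space N"
  proof
    have "emeasure N ({0..} \<union> {..<0}) = emeasure N {0..} + emeasure N {..<0}"
      by (intro plus_emeasure[symmetric]) (auto simp: N_def)
    moreover have "emeasure N {0..} = 1"
      using em[of "{0..}"] prob_space.emeasure_space_1[OF P] by (simp add: spnu)
    moreover have "{0..} \<union> {..<0} = (UNIV :: real set)" by auto
    ultimately show "emeasure N (space N) = 1" using N0 by (simp add: N_def)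
  qed
  interpret N: real_distribution N
    by (intro real_distribution.intro real_distribution_axioms.intro PN) (auto simp: N_def)
  have intf: "integrable lborel f"
  proof -
    have "(\<integral>\<^sup>+t. ennreal (f t) \<partial>lborel) = 1"
      using N.emeasure_space_1 unfolding N_def by (subst (asm) emeasure_density) (auto simp: f0)
    then show ?thesis by (intro integrableI_nonneg) (auto simp: f0)
  qed
  have Hcdf: "H t = cdf N t" and Hlow: "H t = (LINT u:{..t}|lborel. f u)" for t
  proof -
    show 1: "H t = (LINT u:{..t}|lborel. f u)"
      unfolding H_def set_lebesgue_integral_def f_def
      by (intro Bochner_Integration.integral_cong) (auto simp: indicator_def)
    have "cdf N t = (\<integral>u. indicator {..t} u \<partial>N)" by (simp add: cdf_def)
    also have "\<dots> = (\<integral>u. f u * indicator {..t} u \<partial>lborel)"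
      unfolding N_def by (subst integral_density) (auto simp: f0)
    also have "\<dots> = (LINT u:{..t}|lborel. f u)"
      unfolding set_lebesgue_integral_def by (simp add: mult.commute)
    finally show "H t = cdf N t" using 1 by simp
  qed
  have Hmono: "x \<le> y \<Longrightarrow> H x \<le> H y" for x y unfolding Hcdf by (rule N.cdf_nondecreasing)
  define J where "J = {t. \<exists>x\<in>I. \<exists>y\<in>I. x < t \<and> t < y}"
  have JI: "J \<subseteq> I" 
  proof
    fix t assume "t \<in> J"
    then obtain x y where "x \<in> I" "y \<in> I" "x \<le> t" "t \<le> y" unfolding J_def by force
    then show "t \<in> I" using I(1) unfolding is_interval_1 by blast
  qed
  have Jpos: "t \<in> J \<Longrightarrow> 0 < t" for t unfolding J_def I_def by auto
  have Jcv: "t \<in> J" if "s \<in> J" "u \<in> J" "s \<le> t" "t \<le> u" for s t u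
    using that unfolding J_def by (auto intro: order.strict_trans2 order.strict_trans1)
  have Hder: "(H has_real_derivative h t) (at t)" if tJ: "t \<in> J" for t
  proof -
    obtain x y where xy: "x \<in> I" "y \<in> I" "x < t" "t < y" using tJ unfolding J_def by blast
    have sub: "{x..y} \<subseteq> I" using I(1) xy unfolding is_interval_1 by fastforce
    have "continuous_on {x..y} h" using I(2) sub by (rule continuous_on_subset)
    then have "continuous_on {x..y} f"
      by (rule continuous_on_eq) (use sub in \<open>auto simp: f_def I_def\<close>)
    then have "((\<lambda>u. LINT w:{..u}|lborel. f w) has_real_derivative f t) (at t)"
      using xy by (intro lower_integral_deriv[OF intf]) auto
    moreover have "f t = h t" using Jpos[OF that] by (simp add: f_def)
    ultimately show ?thesis by (simp add: Hlow[abs_def])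
  qed
  have hpos: "t \<in> J \<Longrightarrow> h t > 0" for t using JI by (auto simp: I_def)
  have Hstrict: "H s < H t" if "s \<in> J" "t \<in> J" "s < t" for s t
    by (rule DERIV_pos_imp_increasing[OF that(3)]) (use Hder hpos Jcv that in blast)
  have inJ: "t \<in> J" if "0 < H t" "H t < 1" for t
  proof (rule ccontr)
    assume "t \<notin> J"
    then consider "\<And>x. x \<in> I \<Longrightarrow> t \<le> x" | "\<And>x. x \<in> I \<Longrightarrow> x \<le> t" unfolding J_def by force
    then show False
    proof cases
      case 1
      have fz: "f x = 0" if "x < t" for x
        proof (cases "x \<ge> 0")
        case True
        then have "\<not> h x > 0" using 1[of x] that by (auto simp: I_def)
        then show ?thesis using h0[OF True] by (simp add: f_def)
      qed (simp add: f_def)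
      have "H t = (\<integral>u. 0 \<partial>(lborel :: real measure))"
        unfolding Hlow set_lebesgue_integral_def
      proof (rule integral_cong_AE)
        show "AE x in lborel. indicat_real {..t} x *\<^sub>R f x = 0"
          using AE_lborel_singleton[of t] by eventually_elim (auto simp: indicator_def fz)
      qed auto
      then show False using that by simp
    next
      case 2
      have fz: "f x = 0" if "x > t" for x
        proof (cases "x \<ge> 0")
        case True
        then have "\<not> h x > 0" using 2[of x] that by (auto simp: I_def)
        then show ?thesis using h0[OF True] by (simp add: f_def)
      qed (simp add: f_def)
      have "H t = (\<integral>u. f u \<partial>lborel)"
        unfolding Hlow set_lebesgue_integral_def
        by (intro Bochner_Integration.integral_cong) (auto simp: indicator_def fz)
      also have "\<dots> = 1"
      proof -
        have "(\<integral>\<^sup>+t. ennreal (f t) \<partial>lborel) = 1"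
          using N.emeasure_space_1 unfolding N_def by (subst (asm) emeasure_density) (auto simp: f0)
        then show ?thesis using f0 by (subst integral_eq_nn_integral) auto
      qed
      finally show False using that by simp
    qed
  qed
  have onto: "\<exists>t\<in>J. H t = p" if "0 < p" "p < 1" for p
  proof -
    have "eventually (\<lambda>s. H s < p) at_bot"
      using N.cdf_lim_at_bot that(1) unfolding Hcdf[abs_def] by (rule order_tendstoD)
    then obtain a where a: "H a < p" by (auto simp: eventually_at_bot_linorder)
    have "eventually (\<lambda>s. p < H s) at_top"
      using N.cdf_lim_at_top_prob that(2) unfolding Hcdf[abs_def] by (rule order_tendstoD)
    then obtain b where b: "p < H b" by (auto simp: eventually_at_top_linorder)
    have "a \<le> b" using a b Hmono[of b a] by (cases "a \<le> b") auto
    have cont: "isCont H x" for x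
    proof -
      have "emeasure N {x} = (\<integral>\<^sup>+t. ennreal (f t) * indicator {x} t \<partial>lborel)"
        unfolding N_def by (subst emeasure_density) auto
      also have "\<dots> = (\<integral>\<^sup>+t. 0 \<partial>(lborel :: real measure))"
        by (rule nn_integral_cong_AE)
          (use AE_lborel_singleton[of x] in eventually_elim, auto simp: indicator_def)
      finally show ?thesis unfolding Hcdf[abs_def] N.isCont_cdf by (simp add: measure_def)
    qed
    then obtain x where "H x = p" using IVT[of H a p b] a b \<open>a \<le> b\<close> by auto
    then show ?thesis using inJ[of x] that by auto
  qed
  define Q where "Q s = (SOME t. t \<in> J \<and> H t = gauss_cdf s)" for s
  have Q: "Q s \<in> J" "H (Q s) = gauss_cdf s" for s
    using someI_ex[of "\<lambda>t. t \<in> J \<and> H t = gauss_cdf s"] onto[OF gauss_cdf_pos gauss_cdf_less_1, of s]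
    unfolding Q_def by blast+
  have Qmono: "Q s \<le> Q t" if "s \<le> t" for s t
  proof (rule ccontr)
    assume "\<not> Q s \<le> Q t"
    then have "H (Q t) < H (Q s)" using Q(1) by (intro Hstrict) auto
    then have "gauss_cdf t < gauss_cdf s" using Q(2) by simp
    then show False using that gauss_cdf_strict_mono[of s t] by (cases "s = t") auto
  qed
  define T where "T y = inv gauss_cdf (H y)" for y
  have TQ: "T (Q s) = s" for s by (simp add: T_def Q(2) inj_gauss_cdf)
  have HJ: "\<exists>s. H y = gauss_cdf s" if yJ: "y \<in> J" for y
  proof -
    obtain a b where ab: "a \<in> I" "b \<in> I" "a < y" "y < b" using yJ unfolding J_def by blast
    define a' b' where "a' = (a + y) / 2" and "b' = (y + b) / 2"
    have "a' \<in> J" "b' \<in> J" "a' < y" "y < b'" unfolding J_def a'_def b'_def using ab by auto force+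
    then have "H a' < H y" "H y < H b'" using that by (auto intro: Hstrict)
    moreover have "0 \<le> H a'" "H b' \<le> 1" unfolding Hcdf by (auto simp: cdf_def)
    ultimately have "0 < H y" "H y < 1" by auto
    then obtain s where "gauss_cdf s = H y" by (rule gauss_cdf_onto)
    then show ?thesis by metis
  qed
  have Tder: "(T has_real_derivative h y / std_normal_density (T y)) (at y)" if yJ: "y \<in> J" for y
  proof -
    obtain s where s: "H y = gauss_cdf s" using HJ[OF yJ] by blast
    have Ty: "T y = s" by (simp add: T_def s inj_gauss_cdf)
    have "((\<lambda>y. inv gauss_cdf (H y)) has_real_derivative inverse (std_normal_density s) * h y) (at y)"
      by (rule DERIV_chain2[OF _ Hder[OF yJ]]) (simp add: s inv_gauss_cdf_deriv)
    then show ?thesis unfolding Ty by (simp add: T_def[abs_def] field_simps)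
  qed
  have Tlow: "2 / A * (sqrt y - sqrt x) \<le> T y - T x" if "x \<in> J" "y \<in> J" "x \<le> y" for x y
  proof -
    have "(T x - 2 / A * sqrt x) \<le> (T y - 2 / A * sqrt y)"
    proof (rule DERIV_nonneg_imp_nondecreasing[OF that(3)])
      fix u assume "x \<le> u" "u \<le> y"
      then have u: "u \<in> J" using Jcv that by blast
      have u0: "u > 0" using Jpos[OF u] .
      have d: "((\<lambda>u. T u - 2 / A * sqrt u) has_real_derivative
          h u / std_normal_density (T u) - 2 / A * (inverse (sqrt u) / 2)) (at u)"
        using u0 by (intro DERIV_diff Tder[OF u] DERIV_cmult DERIV_real_sqrt)
      obtain s where s: "H u = gauss_cdf s" using HJ[OF u] by blast
      have Tu: "T u = s" by (simp add: T_def s inj_gauss_cdf)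
      have "gauss_isoperimetric (H u) = std_normal_density s"
        unfolding gauss_isoperimetric_def s
        using gauss_cdf_pos[of s] gauss_cdf_less_1[of s] by (simp add: inj_gauss_cdf)
      then have "std_normal_density s / h u \<le> A * sqrt u" using A(2)[of u] u JI by auto
      then have "1 / (A * sqrt u) \<le> h u / std_normal_density s"
        using hpos[OF u] std_normal_density_pos[of s] A(1) u0 by (simp add: field_simps)
      then have "0 \<le> h u / std_normal_density (T u) - 2 / A * (inverse (sqrt u) / 2)"
        unfolding Tu by (simp add: field_simps)
      then show "\<exists>z. ((\<lambda>u. T u - 2 / A * sqrt u) has_real_derivative z) (at u) \<and> 0 \<le> z"
        using d by blast
    qed
    then show ?thesis by (simp add: right_diff_distrib)
  qed
  define R where "R s = sqrt (Q s)" for s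
  have Rsq: "(R s)\<^sup>2 = Q s" for s using Jpos[OF Q(1)[of s]] by (simp add: R_def)
  have Qm [measurable]: "Q \<in> borel_measurable borel"
    by (rule borel_measurable_mono) (simp add: mono_def Qmono)
  interpret G: real_distribution std_normal_distribution by (rule real_dist_normal_dist)
  have NQ: "N = distr std_normal_distribution borel Q"
  proof (rule cdf_unique)
    show "real_distribution (distr std_normal_distribution borel Q)"
      by (rule G.real_distribution_distr) measurable
    show "cdf N = cdf (distr std_normal_distribution borel Q)"
    proof
      fix y
      have c: "cdf (distr std_normal_distribution borel Q) y = measure std_normal_distribution {s. Q s \<le> y}"
        unfolding cdf_def by (subst measure_distr) (auto intro!: arg_cong[where f = "measure _"])
      have "H y \<ge> 0" "H y \<le> 1" unfolding Hcdf by (auto simp: cdf_def)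
      then consider "H y = 0" | "H y = 1" | "0 < H y" "H y < 1" by linarith
      then show "cdf N y = cdf (distr std_normal_distribution borel Q) y"
      proof cases
        case 1
        have "\<not> Q s \<le> y" for s
          using Hmono[of "Q s" y] 1 gauss_cdf_pos[of s] by (auto simp: Q(2))
        then show ?thesis using 1 c by (simp add: Hcdf)
      next
        case 2
        have "Q s \<le> y" for s
          using Hmono[of y "Q s"] 2 gauss_cdf_less_1[of s] by (cases "Q s \<le> y") (auto simp: Q(2))
        moreover have "measure std_normal_distribution UNIV = 1" using G.prob_space by simp
        ultimately show ?thesis using 2 c by (simp add: Hcdf)
      next
        case 3
        then obtain s0 where s0: "gauss_cdf s0 = H y" using gauss_cdf_onto by blast
        have "Q s \<le> y \<longleftrightarrow> s \<le> s0" for s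
        proof
          assume "Q s \<le> y"
          then have "gauss_cdf s \<le> gauss_cdf s0" using Hmono[of "Q s" y] by (simp add: s0 Q(2))
          then show "s \<le> s0" using gauss_cdf_strict_mono[of s0 s] by (cases "s \<le> s0") auto
        next
          assume "s \<le> s0"
          then have "Q s \<le> Q s0" by (rule Qmono)
          moreover have "Q s0 = y"
          proof (rule ccontr)
            assume "Q s0 \<noteq> y"
            then have "H (Q s0) \<noteq> H y"
              using Hstrict[of "Q s0" y] Hstrict[of y "Q s0"] Q(1)[of s0] inJ[OF 3] by fastforce
            then show False by (simp add: s0 Q(2))
          qed
          ultimately show "Q s \<le> y" by simp
        qed
        then have "measure std_normal_distribution {s. Q s \<le> y} = gauss_cdf s0"
          by (simp add: gauss_cdf_eq_cdf cdf_def atMost_def)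
        then show ?thesis using c s0 by (simp add: Hcdf)
      qed
    qed
  qed (rule N.real_distribution_axioms)
  show ?thesis
  proof (rule that[of R "A / 2"])
    show "mono R" by (simp add: mono_def R_def Qmono)
    show "0 \<le> R s" for s using Jpos[OF Q(1)[of s]] by (simp add: R_def)
    show "A / 2 > 0" using A by simp
    show "R t - R s \<le> A / 2 * (t - s)" if "s \<le> t" for s t
      using Tlow[OF Q(1) Q(1) Qmono[OF that]] A(1) by (simp add: TQ R_def field_simps)
    have Qm2: "Q \<in> measurable std_normal_distribution (restrict_space borel {0..})"
      by (rule measurable_restrict_space2) (use Jpos[OF Q(1)] in \<open>auto intro: less_imp_le\<close>)
    show "\<nu> = distr std_normal_distribution (restrict_space borel {0..}) (\<lambda>s. (R s)\<^sup>2)"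
      unfolding Rsq
    proof (rule measure_eqI)
      show s: "sets \<nu> = sets (distr std_normal_distribution (restrict_space borel {0..}) Q)"
        by (simp add: nu sets_restrict_space)
      fix B assume "B \<in> sets \<nu>"
      then have B: "B \<in> sets (restrict_space borel {0..})" using s by simp
      then have B': "B \<in> sets borel" "B \<subseteq> {0..}" by (auto simp: sets_restrict_space_iff)
      have "emeasure \<nu> B = emeasure (distr std_normal_distribution borel Q) B"
        using em[OF B'] NQ by simp
      also have "\<dots> = emeasure (distr std_normal_distribution (restrict_space borel {0..}) Q) B"
        using B B' Qm2 by (simp add: emeasure_distr)
      finally show "emeasure \<nu> B = emeasure (distr std_normal_distribution (restrict_space borel {0..}) Q) B" .
    qed
  qed
qed

lemma nearly_gamma_no_atom:
  assumes "nearly_gamma \<nu>"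
  shows "emeasure \<nu> {0} = 0"
proof -
  obtain h where hm [measurable]: "h \<in> borel_measurable (restrict_space lborel {0..})"
    and nu: "\<nu> = density (restrict_space lborel {0..}) (\<lambda>t. ennreal (h t))"
    using assms unfolding nearly_gamma_def by blast
  have [simp]: "{0} \<in> sets (restrict_space lborel {0::real..})" by (subst sets_restrict_space_iff) auto
  have "emeasure (restrict_space lborel {0::real..}) {0} = 0" by (subst emeasure_restrict_space) auto
  then have "{0} \<in> null_sets (restrict_space lborel {0::real..})" by auto
  then have "AE x in restrict_space lborel {0::real..}. x \<in> {0} \<longrightarrow> ennreal (h x) = 0"
    by (rule AE_I') auto
  then have "{0} \<in> null_sets \<nu>"
    unfolding nu by (subst null_sets_density_iff) auto
  then show ?thesis by auto
qed

section \<open>Functional inequalities on the discrete cube\<close>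

definition cube_avg :: "'i set \<Rightarrow> ('i set \<Rightarrow> real) \<Rightarrow> real" where
  "cube_avg I f = (\<Sum>A\<in>Pow I. f A) / 2 ^ card I"

definition cube_diff :: "'i \<Rightarrow> ('i set \<Rightarrow> real) \<Rightarrow> 'i set \<Rightarrow> real" where
  "cube_diff i f A = f (insert i A) - f (A - {i})"

definition flip_avg :: "'i \<Rightarrow> ('i set \<Rightarrow> real) \<Rightarrow> 'i set \<Rightarrow> real" where
  "flip_avg i f A = (f (insert i A) + f (A - {i})) / 2"

definition cube_ent :: "'i set \<Rightarrow> ('i set \<Rightarrow> real) \<Rightarrow> real" where
  "cube_ent I g = cube_avg I (\<lambda>A. g A * ln (g A)) - cube_avg I g * ln (cube_avg I g)"

lemma cube_avg_empty [simp]: "cube_avg {} f = f {}"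
  by (simp add: cube_avg_def)

lemma cube_avg_insert:
  assumes "finite I" "c \<notin> I"
  shows "cube_avg (insert c I) f = cube_avg I (flip_avg c f)"
proof -
  have 1: "Pow I \<inter> insert c ` Pow I = {}" using assms by auto
  have 2: "inj_on (insert c) (Pow I)" using assms by (auto simp: inj_on_def)
  have "(\<Sum>A\<in>Pow (insert c I). f A) = (\<Sum>A\<in>Pow I. f A) + (\<Sum>A\<in>Pow I. f (insert c A))"
    using assms 1 by (simp add: Pow_insert sum.union_disjoint sum.reindex[OF 2])
  also have "\<dots> = (\<Sum>A\<in>Pow I. 2 * flip_avg c f A)"
    unfolding sum.distrib[symmetric]
  proof (rule sum.cong)
    fix A assume "A \<in> Pow I"
    then have "A - {c} = A" using assms by auto
    then show "f A + f (insert c A) = 2 * flip_avg c f A" by (simp add: flip_avg_def)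
  qed simp
  finally show ?thesis using assms
    by (simp add: cube_avg_def sum_distrib_left[symmetric])
qed

lemma cube_avg_cong: "(\<And>A. A \<subseteq> I \<Longrightarrow> f A = g A) \<Longrightarrow> cube_avg I f = cube_avg I g"
  by (simp add: cube_avg_def)

lemma cube_avg_mono: "(\<And>A. A \<subseteq> I \<Longrightarrow> f A \<le> g A) \<Longrightarrow> cube_avg I f \<le> cube_avg I g"
  by (auto simp: cube_avg_def intro!: divide_right_mono sum_mono)

lemma cube_avg_nonneg: "(\<And>A. A \<subseteq> I \<Longrightarrow> 0 \<le> f A) \<Longrightarrow> 0 \<le> cube_avg I f"
  by (auto simp: cube_avg_def intro!: divide_nonneg_nonneg sum_nonneg)

lemma cube_avg_add: "cube_avg I (\<lambda>A. f A + g A) = cube_avg I f + cube_avg I g"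
  by (simp add: cube_avg_def sum.distrib add_divide_distrib)

lemma cube_avg_diff: "cube_avg I (\<lambda>A. f A - g A) = cube_avg I f - cube_avg I g"
  by (simp add: cube_avg_def sum_subtractf diff_divide_distrib)

lemma cube_avg_cmult: "cube_avg I (\<lambda>A. c * f A) = c * cube_avg I f"
  by (simp add: cube_avg_def sum_distrib_left[symmetric])

lemma cube_avg_sum: "cube_avg I (\<lambda>A. \<Sum>k\<in>K. f k A) = (\<Sum>k\<in>K. cube_avg I (f k))"
  unfolding cube_avg_def by (subst sum.swap) (simp add: sum_divide_distrib)

lemma cube_avg_const [simp]: "finite I \<Longrightarrow> cube_avg I (\<lambda>_. c) = c"
  by (simp add: cube_avg_def card_Pow)

lemma cube_avg_abs: "\<bar>cube_avg I f\<bar> \<le> cube_avg I (\<lambda>A. \<bar>f A\<bar>)"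
  by (simp add: cube_avg_def divide_right_mono sum_abs)

lemma cube_avg_flip_avg:
  assumes "finite I" "i \<in> I"
  shows "cube_avg I (flip_avg i f) = cube_avg I f"
proof -
  obtain J where J: "I = insert i J" "i \<notin> J" using assms by (meson Set.set_insert)
  have "finite J" using assms J by auto
  have *: "flip_avg i (flip_avg i f) = flip_avg i f" by (auto simp: flip_avg_def)
  show ?thesis
    unfolding J(1) cube_avg_insert[OF \<open>finite J\<close> J(2)] * ..
qed

text \<open>\<open>A - {i}\<close> is one of the two configurations that \<open>flip_avg\<close> averages.\<close>

lemma cube_avg_remove_le:
  assumes "finite I" "i \<in> I" "\<And>A. A \<subseteq> I \<Longrightarrow> 0 \<le> f A"
  shows "cube_avg I (\<lambda>A. f (A - {i})) \<le> 2 * cube_avg I f"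
proof -
  have "cube_avg I (\<lambda>A. f (A - {i})) \<le> cube_avg I (\<lambda>A. 2 * flip_avg i f A)"
    by (rule cube_avg_mono) (use assms in \<open>auto simp: flip_avg_def\<close>)
  then show ?thesis using assms by (simp add: cube_avg_cmult cube_avg_flip_avg)
qed

lemma cube_avg_Cauchy_Schwarz:
  assumes "finite I"
  shows "(cube_avg I (\<lambda>A. f A * g A))\<^sup>2 \<le> cube_avg I (\<lambda>A. (f A)\<^sup>2) * cube_avg I (\<lambda>A. (g A)\<^sup>2)"
proof -
  have "(\<Sum>A\<in>Pow I. f A * g A)\<^sup>2 \<le> (\<Sum>A\<in>Pow I. (f A)\<^sup>2) * (\<Sum>A\<in>Pow I. (g A)\<^sup>2)"
    by (rule Cauchy_Schwarz_ineq_sum)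
  then show ?thesis
    by (simp add: cube_avg_def power_divide divide_right_mono power2_eq_square)
qed

lemma cube_avg_square_le:
  assumes "finite I"
  shows "(cube_avg I f)\<^sup>2 \<le> cube_avg I (\<lambda>A. (f A)\<^sup>2)"
  using cube_avg_Cauchy_Schwarz[OF assms, of f "\<lambda>_. 1"] assms by simp

text \<open>By \<open>ln t \<le> t - 1\<close>, the entropy of a density \<open>g\<close> is at most
  \<open>Var g / E g\<close>, and for \<open>g = f\<^sup>2\<close> the identity \<open>a\<^sup>2 - b\<^sup>2 = (a - b) (a + b)\<close> bounds this by
  \<open>(a - b)\<^sup>2\<close>.\<close>

lemma two_point_log_sobolev:
  fixes a b :: real
  shows "(a\<^sup>2 * ln (a\<^sup>2) + b\<^sup>2 * ln (b\<^sup>2)) / 2 - (a\<^sup>2 + b\<^sup>2) / 2 * ln ((a\<^sup>2 + b\<^sup>2) / 2) \<le> (a - b)\<^sup>2"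
proof (cases "a = 0 \<and> b = 0")
  case False
  define s where "s = (a\<^sup>2 + b\<^sup>2) / 2"
  have s: "s > 0" using False by (auto simp: s_def sum_power2_gt_zero_iff)
  have key: "x\<^sup>2 * ln (x\<^sup>2) \<le> x\<^sup>2 * ln s + x\<^sup>2 * (x\<^sup>2 / s - 1)" for x :: real
  proof (cases "x = 0")
    case False
    then have "ln (x\<^sup>2 / s) \<le> x\<^sup>2 / s - 1" using s by (intro ln_le_minus_one) simp
    moreover have "ln (x\<^sup>2 / s) = ln (x\<^sup>2) - ln s" using s False by (simp add: ln_div)
    ultimately have "ln (x\<^sup>2) \<le> ln s + (x\<^sup>2 / s - 1)" by simp
    then have "x\<^sup>2 * ln (x\<^sup>2) \<le> x\<^sup>2 * (ln s + (x\<^sup>2 / s - 1))" by (intro mult_left_mono) auto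
    then show ?thesis by (simp add: algebra_simps)
  qed simp
  have "(a\<^sup>2 * ln (a\<^sup>2) + b\<^sup>2 * ln (b\<^sup>2)) / 2 - s * ln s
      \<le> (a\<^sup>2 * ln s + a\<^sup>2 * (a\<^sup>2 / s - 1) + (b\<^sup>2 * ln s + b\<^sup>2 * (b\<^sup>2 / s - 1))) / 2 - s * ln s"
    by (intro diff_right_mono divide_right_mono add_mono key) simp
  also have "\<dots> = (a\<^sup>2 * (a\<^sup>2 / s - 1) + b\<^sup>2 * (b\<^sup>2 / s - 1)) / 2"
    by (simp add: s_def field_simps)
  also have "\<dots> = (a\<^sup>2 - b\<^sup>2)\<^sup>2 / (4 * s)"
  proof -
    have "(a\<^sup>2 * (a\<^sup>2 / s - 1) + b\<^sup>2 * (b\<^sup>2 / s - 1)) * (2 * s) = 2 * (a\<^sup>2 * (a\<^sup>2 - s) + b\<^sup>2 * (b\<^sup>2 - s))"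
      using s by (simp add: field_simps)
    also have "\<dots> = (a\<^sup>2 - b\<^sup>2)\<^sup>2"
      unfolding s_def by (simp add: field_simps power2_eq_square)
    finally show ?thesis using s by (simp add: field_simps)
  qed
  also have "\<dots> \<le> (a - b)\<^sup>2"
  proof -
    have "(a + b)\<^sup>2 \<le> 4 * s" unfolding s_def
      using sum_squares_bound[of a b] by (simp add: power2_sum)
    then have "(a - b)\<^sup>2 * (a + b)\<^sup>2 \<le> (a - b)\<^sup>2 * (4 * s)" by (intro mult_left_mono) auto
    moreover have "(a\<^sup>2 - b\<^sup>2)\<^sup>2 = (a - b)\<^sup>2 * (a + b)\<^sup>2"
      by (simp add: power2_eq_square algebra_simps)
    ultimately show ?thesis using s by (simp add: divide_le_eq)
  qed
  finally show ?thesis by (simp add: s_def)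
qed simp

text \<open>The triangle inequality in the Euclidean plane, for the vectors \<open>(a, b)\<close> and
  \<open>(a', b')\<close>.\<close>

lemma sqrt_mean_square_diff:
  fixes a b a' b' :: real
  shows "(sqrt ((a\<^sup>2 + b\<^sup>2) / 2) - sqrt ((a'\<^sup>2 + b'\<^sup>2) / 2))\<^sup>2 \<le> ((a - a')\<^sup>2 + (b - b')\<^sup>2) / 2"
proof -
  have "(a * a' + b * b')\<^sup>2 \<le> (a\<^sup>2 + b\<^sup>2) * (a'\<^sup>2 + b'\<^sup>2)"
    using zero_le_power2[of "a * b' - b * a'"]
    by (simp add: power2_eq_square algebra_simps)
  then have "a * a' + b * b' \<le> sqrt ((a\<^sup>2 + b\<^sup>2) * (a'\<^sup>2 + b'\<^sup>2))"
    by (rule real_le_rsqrt)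
  also have "\<dots> = 2 * (sqrt ((a\<^sup>2 + b\<^sup>2) / 2) * sqrt ((a'\<^sup>2 + b'\<^sup>2) / 2))"
    by (simp add: real_sqrt_mult real_sqrt_divide)
  finally have "a * a' + b * b' \<le> 2 * (sqrt ((a\<^sup>2 + b\<^sup>2) / 2) * sqrt ((a'\<^sup>2 + b'\<^sup>2) / 2))" .
  then show ?thesis by (simp add: power2_diff field_simps)
qed

lemma mean_abs_diff:
  fixes a b a' b' :: real
  shows "\<bar>(a + b) / 2 - (a' + b') / 2\<bar> \<le> (\<bar>a - a'\<bar> + \<bar>b - b'\<bar>) / 2"
proof -
  have "(a + b) / 2 - (a' + b') / 2 = ((a - a') + (b - b')) / 2" by (simp add: field_simps)
  then have "\<bar>(a + b) / 2 - (a' + b') / 2\<bar> = \<bar>(a - a') + (b - b')\<bar> / 2"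
    by (simp only: abs_divide abs_numeral)
  then show ?thesis using abs_triangle_ineq[of "a - a'" "b - b'"] by (simp only: divide_right_mono)
qed

text \<open>Induction on the number of coordinates:
  entropy splits into the entropy in the new coordinate and the entropy of its conditional
  expectation, which is the square of the function \<open>sqrt (flip_avg c f\<^sup>2)\<close>.\<close>

lemma cube_log_sobolev:
  assumes "finite I"
  shows "cube_ent I (\<lambda>A. (f A)\<^sup>2) \<le> (\<Sum>i\<in>I. cube_avg I (\<lambda>A. (cube_diff i f A)\<^sup>2))"
  using assms
proof (induction I arbitrary: f)
  case empty
  then show ?case by (simp add: cube_ent_def)
next
  case (insert c I)
  define g where "g = (\<lambda>A. sqrt (flip_avg c (\<lambda>A. (f A)\<^sup>2) A))"
  have g2: "(g A)\<^sup>2 = flip_avg c (\<lambda>A. (f A)\<^sup>2) A" for A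
    by (simp add: g_def flip_avg_def)
  have IH: "cube_ent I (\<lambda>A. (g A)\<^sup>2) \<le> (\<Sum>i\<in>I. cube_avg I (\<lambda>A. (cube_diff i g A)\<^sup>2))"
    by (rule insert.IH)
  have "cube_ent (insert c I) (\<lambda>A. (f A)\<^sup>2)
     = cube_avg I (\<lambda>A. flip_avg c (\<lambda>A. (f A)\<^sup>2 * ln ((f A)\<^sup>2)) A - (g A)\<^sup>2 * ln ((g A)\<^sup>2))
       + cube_ent I (\<lambda>A. (g A)\<^sup>2)"
    unfolding cube_ent_def cube_avg_insert[OF insert.hyps] cube_avg_diff g2 by simp
  also have "cube_avg I (\<lambda>A. flip_avg c (\<lambda>A. (f A)\<^sup>2 * ln ((f A)\<^sup>2)) A - (g A)\<^sup>2 * ln ((g A)\<^sup>2))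
     \<le> cube_avg I (\<lambda>A. (cube_diff c f A)\<^sup>2)"
    by (rule cube_avg_mono) (use two_point_log_sobolev in \<open>simp add: g2 flip_avg_def cube_diff_def\<close>)
  also have "cube_avg I (\<lambda>A. (cube_diff c f A)\<^sup>2) = cube_avg (insert c I) (\<lambda>A. (cube_diff c f A)\<^sup>2)"
    unfolding cube_avg_insert[OF insert.hyps]
    by (rule cube_avg_cong) (simp add: flip_avg_def cube_diff_def)
  also have "cube_ent I (\<lambda>A. (g A)\<^sup>2) \<le> (\<Sum>i\<in>I. cube_avg (insert c I) (\<lambda>A. (cube_diff i f A)\<^sup>2))"
  proof (rule order_trans[OF IH], rule sum_mono)
    fix i assume i: "i \<in> I"
    then have ic: "i \<noteq> c" using insert.hyps by auto
    show "cube_avg I (\<lambda>A. (cube_diff i g A)\<^sup>2) \<le> cube_avg (insert c I) (\<lambda>A. (cube_diff i f A)\<^sup>2)"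
      unfolding cube_avg_insert[OF insert.hyps]
    proof (rule cube_avg_mono)
      fix A assume A: "A \<subseteq> I"
      then have cA: "c \<notin> A" using insert.hyps by auto
      show "(cube_diff i g A)\<^sup>2 \<le> flip_avg c (\<lambda>A. (cube_diff i f A)\<^sup>2) A"
        using sqrt_mean_square_diff[of "f (insert c (insert i A))" "f (insert i A)"
          "f (insert c (A - {i}))" "f (A - {i})"] cA ic
        by (simp add: g_def cube_diff_def flip_avg_def insert_Diff_if insert_commute)
    qed
  qed
  finally show ?case using insert.hyps by (simp add: add.commute)
qed

text \<open>Entropy compares the second and the first moment: \<open>ln t \<le> t - 1\<close> at \<open>t = c / \<bar>f\<bar>\<close> with
  \<open>c = E f\<^sup>2 / E \<bar>f\<bar>\<close>.\<close>

lemma cube_ent_ge_log_ratio: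
  assumes "finite I"
  shows "cube_avg I (\<lambda>A. (f A)\<^sup>2) * ln (cube_avg I (\<lambda>A. (f A)\<^sup>2) / (cube_avg I (\<lambda>A. \<bar>f A\<bar>))\<^sup>2)
     \<le> cube_ent I (\<lambda>A. (f A)\<^sup>2)"
proof -
  define a where "a = cube_avg I (\<lambda>A. (f A)\<^sup>2)"
  define b where "b = cube_avg I (\<lambda>A. \<bar>f A\<bar>)"
  have "b\<^sup>2 \<le> a" using cube_avg_square_le[OF assms, of "\<lambda>A. \<bar>f A\<bar>"] by (simp add: a_def b_def)
  have "a \<ge> 0" "b \<ge> 0" unfolding a_def b_def by (auto intro: cube_avg_nonneg)
  show ?thesis
  proof (cases "a = 0")
    case True
    then have "\<forall>A\<in>Pow I. f A = 0"
      using assms by (auto simp: a_def cube_avg_def sum_nonneg_eq_0_iff)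
    then have "cube_avg I (\<lambda>A. (f A)\<^sup>2 * ln ((f A)\<^sup>2)) = 0" by (simp add: cube_avg_def)
    then show ?thesis using True by (simp add: cube_ent_def a_def)
  next
    case False
    have "b > 0"
    proof (rule ccontr)
      assume "\<not> b > 0"
      then have "b = 0" using \<open>b \<ge> 0\<close> by simp
      then have "\<forall>A\<in>Pow I. f A = 0"
        using assms by (auto simp: b_def cube_avg_def sum_nonneg_eq_0_iff)
      then have "a = 0" by (simp add: a_def cube_avg_def)
      then show False using False by simp
    qed
    have "a > 0" using False \<open>a \<ge> 0\<close> by simp
    define c where "c = a / b"
    have "c > 0" using \<open>a > 0\<close> \<open>b > 0\<close> by (simp add: c_def)
    have key: "(f A)\<^sup>2 * (2 * ln c) + 2 * ((f A)\<^sup>2 - c * \<bar>f A\<bar>) \<le> (f A)\<^sup>2 * ln ((f A)\<^sup>2)" for A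
    proof (cases "f A = 0")
      case False
      have "ln (c / \<bar>f A\<bar>) \<le> c / \<bar>f A\<bar> - 1" using False \<open>c > 0\<close> by (intro ln_le_minus_one) auto
      then have "ln c - ln \<bar>f A\<bar> \<le> c / \<bar>f A\<bar> - 1" using False \<open>c > 0\<close> by (simp add: ln_div)
      then have "(f A)\<^sup>2 * (ln c - ln \<bar>f A\<bar>) \<le> (f A)\<^sup>2 * (c / \<bar>f A\<bar> - 1)"
        by (intro mult_left_mono) auto
      also have "\<dots> = c * \<bar>f A\<bar> - (f A)\<^sup>2"
        using False by (cases "f A > 0") (auto simp: field_simps power2_eq_square)
      finally have "(f A)\<^sup>2 * (ln c - ln \<bar>f A\<bar>) \<le> c * \<bar>f A\<bar> - (f A)\<^sup>2" .
      moreover have "ln ((f A)\<^sup>2) = 2 * ln \<bar>f A\<bar>"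
        using False ln_realpow[of "\<bar>f A\<bar>" 2] by simp
      ultimately show ?thesis by (simp add: algebra_simps)
    qed simp
    have "a * (2 * ln c) + 2 * (a - c * b)
       = cube_avg I (\<lambda>A. (f A)\<^sup>2 * (2 * ln c) + 2 * ((f A)\<^sup>2 - c * \<bar>f A\<bar>))"
      unfolding cube_avg_add cube_avg_cmult cube_avg_diff a_def b_def
      by (subst mult.commute) (simp add: cube_avg_cmult[symmetric] mult.commute)
    also have "\<dots> \<le> cube_avg I (\<lambda>A. (f A)\<^sup>2 * ln ((f A)\<^sup>2))"
      by (rule cube_avg_mono) (rule key)
    finally have 1: "a * (2 * ln c) \<le> cube_avg I (\<lambda>A. (f A)\<^sup>2 * ln ((f A)\<^sup>2))"
      using \<open>b > 0\<close> by (simp add: c_def)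
    have "a * ln (a / b\<^sup>2) = a * (2 * ln c) - a * ln a"
    proof -
      have 1: "ln (a / b\<^sup>2) = ln a - 2 * ln b" using \<open>a > 0\<close> \<open>b > 0\<close> by (simp add: ln_div ln_realpow)
      have 2: "ln c = ln a - ln b" using \<open>a > 0\<close> \<open>b > 0\<close> by (simp add: ln_div c_def)
      show ?thesis unfolding 1 2 by (simp add: algebra_simps)
    qed
    then show ?thesis using 1 by (simp add: cube_ent_def a_def b_def)
  qed
qed

definition depends_on :: "'i set \<Rightarrow> ('i set \<Rightarrow> real) \<Rightarrow> bool" where
  "depends_on I f \<longleftrightarrow> (\<forall>A. f A = f (A \<inter> I))"

lemma depends_onD: "depends_on I f \<Longrightarrow> A \<inter> I = B \<inter> I \<Longrightarrow> f A = f B"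
  unfolding depends_on_def by metis

lemma depends_onI: "(\<And>A. f A = f (A \<inter> I)) \<Longrightarrow> depends_on I f"
  unfolding depends_on_def by blast

text \<open>Martingale decomposition of \<open>f\<close>, built by adding one coordinate \<open>c\<close> at a time: the new
  increment is \<open>f - flip_avg c f\<close>, and the others are those of \<open>flip_avg c f\<close>. The squared
  differences in a coordinate add up because differences commute with averages.\<close>

lemma cube_martingale_decomposition:
  assumes "finite I" "depends_on I f"
  shows "\<exists>V. (\<Sum>i\<in>I. cube_avg I (\<lambda>A. (V i A)\<^sup>2)) = cube_avg I (\<lambda>A. (f A)\<^sup>2) - (cube_avg I f)\<^sup>2
    \<and> (\<Sum>i\<in>I. \<Sum>j\<in>I. cube_avg I (\<lambda>A. (cube_diff j (V i) A)\<^sup>2))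
        \<le> (\<Sum>j\<in>I. cube_avg I (\<lambda>A. (cube_diff j f A)\<^sup>2))
    \<and> (\<forall>i\<in>I. depends_on I (V i)
         \<and> cube_avg I (\<lambda>A. \<bar>V i A\<bar>) \<le> cube_avg I (\<lambda>A. \<bar>cube_diff i f A\<bar>) / 2)"
  using assms
proof (induction I arbitrary: f)
  case empty
  then show ?case by simp
next
  case (insert c I)
  define g where "g = flip_avg c f"
  have "depends_on I g"
  proof (rule depends_onI)
    fix A
    have "f (insert c A) = f (insert c (A \<inter> I))" "f (A - {c}) = f (A \<inter> I - {c})"
      by (rule depends_onD[OF insert.prems], blast)+
    then show "g A = g (A \<inter> I)" unfolding g_def flip_avg_def by simp
  qed
  then obtain V where
      V1: "(\<Sum>i\<in>I. cube_avg I (\<lambda>A. (V i A)\<^sup>2)) = cube_avg I (\<lambda>A. (g A)\<^sup>2) - (cube_avg I g)\<^sup>2"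
    and V2: "(\<Sum>i\<in>I. \<Sum>j\<in>I. cube_avg I (\<lambda>A. (cube_diff j (V i) A)\<^sup>2))
        \<le> (\<Sum>j\<in>I. cube_avg I (\<lambda>A. (cube_diff j g A)\<^sup>2))"
    and V3: "\<And>i. i \<in> I \<Longrightarrow> depends_on I (V i)"
    and V4: "\<And>i. i \<in> I \<Longrightarrow> cube_avg I (\<lambda>A. \<bar>V i A\<bar>) \<le> cube_avg I (\<lambda>A. \<bar>cube_diff i g A\<bar>) / 2"
    using insert.IH[of g] by blast
  define U where "U = V(c := \<lambda>A. f A - g A)"
  have Uc: "U c = (\<lambda>A. f A - g A)" by (simp add: U_def)
  have UV: "i \<in> I \<Longrightarrow> U i = V i" for i using insert.hyps by (auto simp: U_def)
  note av = cube_avg_insert[OF insert.hyps]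
  have fl: "cube_avg I (flip_avg c h) = cube_avg I h" if "depends_on I h" for h
  proof (rule cube_avg_cong)
    fix A
    have "h (insert c A) = h A" "h (A - {c}) = h A"
      by (rule depends_onD[OF that], use insert.hyps in blast)+
    then show "flip_avg c h A = h A" by (simp add: flip_avg_def)
  qed
  have gi: "g (insert c A) = g A" "g (A - {c}) = g A" for A
    by (auto simp: g_def flip_avg_def)
  have dcV: "cube_diff c (V i) A = 0" if "i \<in> I" for i A
  proof -
    have "V i (insert c A) = V i (A - {c})"
      by (rule depends_onD[OF V3[OF that]], use insert.hyps in blast)
    then show ?thesis by (simp add: cube_diff_def)
  qed
  have dep_diff: "depends_on I (cube_diff j h)" if "depends_on I h" "j \<in> I" for j h
  proof (rule depends_onI)
    fix A
    have "h (insert j A) = h (insert j (A \<inter> I))" "h (A - {j}) = h (A \<inter> I - {j})"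
      by (rule depends_onD[OF that(1)], use that(2) in blast)+
    then show "cube_diff j h A = cube_diff j h (A \<inter> I)" unfolding cube_diff_def by simp
  qed
  have dep_comp: "depends_on I (\<lambda>A. F (h A))" if "depends_on I h" for h and F :: "real \<Rightarrow> real"
    using depends_onD[OF that] by (intro depends_onI) (metis Int_assoc Int_absorb)
  have 1: "(\<Sum>i\<in>insert c I. cube_avg (insert c I) (\<lambda>A. (U i A)\<^sup>2))
      = cube_avg (insert c I) (\<lambda>A. (f A)\<^sup>2) - (cube_avg (insert c I) f)\<^sup>2"
  proof -
    have "(\<Sum>i\<in>I. cube_avg (insert c I) (\<lambda>A. (U i A)\<^sup>2)) = (\<Sum>i\<in>I. cube_avg I (\<lambda>A. (V i A)\<^sup>2))"
      unfolding av
    proof (rule sum.cong[OF refl])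
      fix i assume i: "i \<in> I"
      show "cube_avg I (flip_avg c (\<lambda>A. (U i A)\<^sup>2)) = cube_avg I (\<lambda>A. (V i A)\<^sup>2)"
        unfolding UV[OF i] by (rule fl[OF dep_comp[where F = "\<lambda>x. x\<^sup>2", OF V3[OF i]]])
    qed
    moreover have "cube_avg (insert c I) (\<lambda>A. (U c A)\<^sup>2)
       = cube_avg (insert c I) (\<lambda>A. (f A)\<^sup>2) - cube_avg I (\<lambda>A. (g A)\<^sup>2)"
      unfolding av Uc cube_avg_diff[symmetric]
      by (rule cube_avg_cong) (simp add: flip_avg_def gi, simp add: g_def flip_avg_def field_simps power2_eq_square)
    ultimately show ?thesis using insert.hyps V1
      by (simp add: av g_def)
  qed
  have 2: "(\<Sum>i\<in>insert c I. \<Sum>j\<in>insert c I. cube_avg (insert c I) (\<lambda>A. (cube_diff j (U i) A)\<^sup>2))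
      \<le> (\<Sum>j\<in>insert c I. cube_avg (insert c I) (\<lambda>A. (cube_diff j f A)\<^sup>2))"
  proof -
    have "(\<Sum>i\<in>I. \<Sum>j\<in>insert c I. cube_avg (insert c I) (\<lambda>A. (cube_diff j (U i) A)\<^sup>2))
        = (\<Sum>i\<in>I. \<Sum>j\<in>I. cube_avg I (\<lambda>A. (cube_diff j (V i) A)\<^sup>2))"
    proof (rule sum.cong[OF refl])
      fix i assume i: "i \<in> I"
      have "cube_avg (insert c I) (\<lambda>A. (cube_diff c (V i) A)\<^sup>2) = 0"
        using insert.hyps by (simp add: dcV[OF i])
      moreover have "cube_avg (insert c I) (\<lambda>A. (cube_diff j (V i) A)\<^sup>2)
          = cube_avg I (\<lambda>A. (cube_diff j (V i) A)\<^sup>2)" if "j \<in> I" for j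
        unfolding av by (rule fl[OF dep_comp[where F = "\<lambda>x. x\<^sup>2", OF dep_diff[OF V3[OF i] that]]])
      ultimately show "(\<Sum>j\<in>insert c I. cube_avg (insert c I) (\<lambda>A. (cube_diff j (U i) A)\<^sup>2))
        = (\<Sum>j\<in>I. cube_avg I (\<lambda>A. (cube_diff j (V i) A)\<^sup>2))"
        using insert.hyps by (simp add: UV[OF i])
    qed
    moreover have "cube_avg (insert c I) (\<lambda>A. (cube_diff c (U c) A)\<^sup>2)
        = cube_avg (insert c I) (\<lambda>A. (cube_diff c f A)\<^sup>2)"
      by (rule cube_avg_cong) (simp add: cube_diff_def Uc gi)
    moreover have "cube_avg (insert c I) (\<lambda>A. (cube_diff j (U c) A)\<^sup>2) + cube_avg I (\<lambda>A. (cube_diff j g A)\<^sup>2)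
        = cube_avg (insert c I) (\<lambda>A. (cube_diff j f A)\<^sup>2)" if j: "j \<in> I" for j
      unfolding av cube_avg_add[symmetric]
    proof (rule cube_avg_cong)
      fix A assume "A \<subseteq> I"
      then have "c \<notin> A" "j \<noteq> c" using insert.hyps j by auto
      then have e: "insert j (insert c A) = insert c (insert j A)" "insert c A - {j} = insert c (A - {j})"
        "A - {c} = A" "insert j A - {c} = insert j A" "A - {j} - {c} = A - {j}" by auto
      show "flip_avg c (\<lambda>A. (cube_diff j (U c) A)\<^sup>2) A + (cube_diff j g A)\<^sup>2
          = flip_avg c (\<lambda>A. (cube_diff j f A)\<^sup>2) A"
        unfolding flip_avg_def cube_diff_def Uc e gi
        unfolding g_def flip_avg_def e
        by (simp add: field_simps power2_eq_square)
    qed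
    ultimately have *: "(\<Sum>i\<in>I. \<Sum>j\<in>insert c I. cube_avg (insert c I) (\<lambda>A. (cube_diff j (U i) A)\<^sup>2))
        = (\<Sum>i\<in>I. \<Sum>j\<in>I. cube_avg I (\<lambda>A. (cube_diff j (V i) A)\<^sup>2))"
      "cube_avg (insert c I) (\<lambda>A. (cube_diff c (U c) A)\<^sup>2)
        = cube_avg (insert c I) (\<lambda>A. (cube_diff c f A)\<^sup>2)"
      "(\<Sum>j\<in>I. cube_avg (insert c I) (\<lambda>A. (cube_diff j (U c) A)\<^sup>2)) + (\<Sum>j\<in>I. cube_avg I (\<lambda>A. (cube_diff j g A)\<^sup>2))
        = (\<Sum>j\<in>I. cube_avg (insert c I) (\<lambda>A. (cube_diff j f A)\<^sup>2))"
      by (simp_all add: sum.distrib[symmetric])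
    show ?thesis
      unfolding sum.insert[OF insert.hyps, of "\<lambda>i. \<Sum>j\<in>insert c I. cube_avg (insert c I) (\<lambda>A. (cube_diff j (U i) A)\<^sup>2)"] *(1)
      unfolding sum.insert[OF insert.hyps] *(2) using V2 *(3) by linarith
  qed
  have 3: "depends_on (insert c I) (U i) \<and> cube_avg (insert c I) (\<lambda>A. \<bar>U i A\<bar>)
      \<le> cube_avg (insert c I) (\<lambda>A. \<bar>cube_diff i f A\<bar>) / 2" if i: "i \<in> insert c I" for i
  proof (cases "i = c")
    case True
    have "depends_on (insert c I) (\<lambda>A. f A - g A)"
    proof (rule depends_onI)
      fix A
      have "g A = g (A \<inter> insert c I)" by (rule depends_onD[OF \<open>depends_on I g\<close>]) blast
      moreover have "f A = f (A \<inter> insert c I)" by (rule depends_onD[OF insert.prems]) blast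
      ultimately show "f A - g A = f (A \<inter> insert c I) - g (A \<inter> insert c I)" by argo
    qed
    moreover have "cube_avg (insert c I) (\<lambda>A. \<bar>f A - g A\<bar>)
        = cube_avg I (\<lambda>A. \<bar>cube_diff c f A\<bar> / 2)" unfolding av
    proof (rule cube_avg_cong)
      fix A
      have "g A = (f (insert c A) + f (A - {c})) / 2" by (simp add: g_def flip_avg_def)
      then show "flip_avg c (\<lambda>A. \<bar>f A - g A\<bar>) A = \<bar>cube_diff c f A\<bar> / 2"
        unfolding flip_avg_def gi cube_diff_def by (simp add: abs_if field_simps)
    qed
    moreover have "cube_avg (insert c I) (\<lambda>A. \<bar>cube_diff c f A\<bar>) = cube_avg I (\<lambda>A. \<bar>cube_diff c f A\<bar>)"
      unfolding av by (rule cube_avg_cong) (simp add: flip_avg_def cube_diff_def)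
    ultimately show ?thesis using True cube_avg_cmult[of I "1/2" "\<lambda>A. \<bar>cube_diff c f A\<bar>"]
      by (simp add: Uc)
  next
    case False
    then have iI: "i \<in> I" using i by simp
    have "depends_on (insert c I) (V i)"
      by (intro depends_onI depends_onD[OF V3[OF iI]]) blast
    moreover have "cube_avg (insert c I) (\<lambda>A. \<bar>V i A\<bar>) = cube_avg I (\<lambda>A. \<bar>V i A\<bar>)"
      unfolding av by (rule fl[OF dep_comp[where F = abs, OF V3[OF iI]]])
    moreover have "cube_avg I (\<lambda>A. \<bar>cube_diff i g A\<bar>) \<le> cube_avg (insert c I) (\<lambda>A. \<bar>cube_diff i f A\<bar>)"
      unfolding av
    proof (rule cube_avg_mono)
      fix A assume "A \<subseteq> I"
      then have "c \<notin> A" using insert.hyps by auto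
      then have e: "insert i (insert c A) = insert c (insert i A)" "insert c A - {i} = insert c (A - {i})"
        "A - {c} = A" "insert i A - {c} = insert i A" "A - {i} - {c} = A - {i}" using False by auto
      show "\<bar>cube_diff i g A\<bar> \<le> flip_avg c (\<lambda>A. \<bar>cube_diff i f A\<bar>) A"
        unfolding flip_avg_def cube_diff_def e
        unfolding g_def flip_avg_def e by (rule mean_abs_diff)
    qed
    ultimately show ?thesis using V4[OF iI] by (simp add: UV[OF iI])
  qed
  show ?case using 1 2 3 by blast
qed

text \<open>The inequality of Falik and Samorodnitsky. The entropy of the square of a martingale increment
  \<open>V i\<close>, which the logarithmic Sobolev inequality bounds from above, is at least its variance times
  \<open>ln (E V\<^sup>2 / (E \<bar>V\<bar>)\<^sup>2)\<close>, and this factor is large if the first moment is small. The bounds are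
  added with the log-sum inequality.\<close>

theorem cube_falik_samorodnitsky:
  assumes "finite I" "depends_on I f"
    and s: "s > 0" "(\<Sum>i\<in>I. (cube_avg I (\<lambda>A. \<bar>cube_diff i f A\<bar>))\<^sup>2) / 4 \<le> s"
    and v: "v = cube_avg I (\<lambda>A. (f A)\<^sup>2) - (cube_avg I f)\<^sup>2"
  shows "v * ln (v / s) \<le> (\<Sum>i\<in>I. cube_avg I (\<lambda>A. (cube_diff i f A)\<^sup>2))"
proof -
  obtain V where
      V1: "(\<Sum>i\<in>I. cube_avg I (\<lambda>A. (V i A)\<^sup>2)) = v"
    and V2: "(\<Sum>i\<in>I. \<Sum>j\<in>I. cube_avg I (\<lambda>A. (cube_diff j (V i) A)\<^sup>2))
        \<le> (\<Sum>j\<in>I. cube_avg I (\<lambda>A. (cube_diff j f A)\<^sup>2))"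
    and V4: "\<And>i. i \<in> I \<Longrightarrow> cube_avg I (\<lambda>A. \<bar>V i A\<bar>) \<le> cube_avg I (\<lambda>A. \<bar>cube_diff i f A\<bar>) / 2"
    using cube_martingale_decomposition[OF assms(1,2)] v by blast
  define a where "a i = cube_avg I (\<lambda>A. (V i A)\<^sup>2)" for i
  define b where "b i = (cube_avg I (\<lambda>A. \<bar>V i A\<bar>))\<^sup>2" for i
  have a0: "a i \<ge> 0" for i unfolding a_def by (rule cube_avg_nonneg) simp
  have b0: "b i \<ge> 0" for i unfolding b_def by simp
  have v0: "v \<ge> 0" using sum_nonneg[of I a] a0 V1 by (simp add: a_def)
  have bs: "(\<Sum>i\<in>I. b i) \<le> s"
  proof -
    have "(\<Sum>i\<in>I. b i) \<le> (\<Sum>i\<in>I. (cube_avg I (\<lambda>A. \<bar>cube_diff i f A\<bar>) / 2)\<^sup>2)"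
      unfolding b_def by (intro sum_mono power_mono V4 cube_avg_nonneg) auto
    also have "\<dots> = (\<Sum>i\<in>I. (cube_avg I (\<lambda>A. \<bar>cube_diff i f A\<bar>))\<^sup>2) / 4"
      by (simp add: power_divide sum_divide_distrib)
    finally show ?thesis using s by simp
  qed
  show ?thesis
  proof (cases "v = 0")
    case True
    then show ?thesis by (auto intro!: sum_nonneg cube_avg_nonneg)
  next
    case False
    then have vp: "v > 0" using v0 by simp
    have key: "a i - b i * (v / s) \<le> a i * ln (a i / b i) - a i * ln (v / s)" if i: "i \<in> I" for i
    proof (cases "a i = 0")
      case True
      then show ?thesis using b0[of i] vp s by simp
    next
      case ai: False
      then have ap: "a i > 0" using a0[of i] by simp
      have "b i \<noteq> 0"
      proof
        assume "b i = 0"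
        then have "\<forall>A\<in>Pow I. V i A = 0"
          using assms(1) by (auto simp: b_def cube_avg_def sum_nonneg_eq_0_iff)
        then have "a i = 0" by (simp add: a_def cube_avg_def)
        then show False using ai by simp
      qed
      then have bp: "b i > 0" using b0[of i] by simp
      have "ln (b i * (v / s) / a i) \<le> b i * (v / s) / a i - 1"
        using ap bp vp s by (intro ln_le_minus_one) simp
      moreover have "ln (b i * (v / s) / a i) = ln (v / s) - ln (a i / b i)"
        using ap bp vp s by (simp add: ln_div ln_mult)
      ultimately have "a i * (ln (v / s) - ln (a i / b i)) \<le> a i * (b i * (v / s) / a i - 1)"
        using ap by (intro mult_left_mono) auto
      also have "\<dots> = b i * (v / s) - a i" using ap by (simp add: right_diff_distrib)
      finally show ?thesis by (simp add: right_diff_distrib)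
    qed
    have "0 \<le> v - (\<Sum>i\<in>I. b i) * (v / s)"
      using bs vp s by (simp add: pos_divide_le_eq mult.commute)
    also have "\<dots> = (\<Sum>i\<in>I. a i - b i * (v / s))"
      using V1 by (simp add: sum_subtractf sum_distrib_right sum_divide_distrib a_def)
    also have "\<dots> \<le> (\<Sum>i\<in>I. a i * ln (a i / b i) - a i * ln (v / s))"
      by (rule sum_mono) (rule key)
    also have "\<dots> = (\<Sum>i\<in>I. a i * ln (a i / b i)) - v * ln (v / s)"
      using V1 by (simp add: sum_subtractf sum_distrib_right[symmetric] a_def)
    finally have "v * ln (v / s) \<le> (\<Sum>i\<in>I. a i * ln (a i / b i))" by simp
    also have "\<dots> \<le> (\<Sum>i\<in>I. \<Sum>j\<in>I. cube_avg I (\<lambda>A. (cube_diff j (V i) A)\<^sup>2))"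
      unfolding a_def b_def
      by (intro sum_mono order_trans[OF cube_ent_ge_log_ratio cube_log_sobolev] assms(1))
    finally show ?thesis using V2 by simp
  qed
qed

section \<open>Averages of truncated minimal weights on the cube\<close>

definition min_weight :: "'e set set \<Rightarrow> ('e \<Rightarrow> real) \<Rightarrow> real" where
  "min_weight \<S> x = Min ((\<lambda>S. sum x S) ` \<S>)"

definition trunc_min_weight :: "real \<Rightarrow> 'e set set \<Rightarrow> ('e \<Rightarrow> real) \<Rightarrow> real" where
  "trunc_min_weight M \<S> x = min M (min_weight \<S> x)"

text \<open>The elements that lie in every minimizer, unless the minimal weight reaches the truncation
  level: these are the only ones whose weight can be increased with an effect on
  \<open>trunc_min_weight\<close>.\<close>

definition pivotal :: "real \<Rightarrow> 'e set set \<Rightarrow> ('e \<Rightarrow> real) \<Rightarrow> 'e set" where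
  "pivotal M \<S> x = {e. min_weight \<S> x < M \<and> (\<forall>S\<in>\<S>. sum x S = min_weight \<S> x \<longrightarrow> e \<in> S)}"

lemma min_weight_attained:
  assumes "finite \<S>" "\<S> \<noteq> {}"
  obtains S where "S \<in> \<S>" "sum x S = min_weight \<S> x"
proof -
  have "min_weight \<S> x \<in> (\<lambda>S. sum x S) ` \<S>"
    unfolding min_weight_def using assms by (intro Min_in) auto
  then show ?thesis using that by auto
qed

lemma min_weight_le: "finite \<S> \<Longrightarrow> S \<in> \<S> \<Longrightarrow> min_weight \<S> x \<le> sum x S"
  unfolding min_weight_def by (intro Min_le) auto

lemma min_weight_greatest:
  "finite \<S> \<Longrightarrow> \<S> \<noteq> {} \<Longrightarrow> (\<And>S. S \<in> \<S> \<Longrightarrow> c \<le> sum x S) \<Longrightarrow> c \<le> min_weight \<S> x"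
  unfolding min_weight_def by (intro Min.boundedI) auto

lemma min_weight_cong:
  "(\<And>S e. S \<in> \<S> \<Longrightarrow> e \<in> S \<Longrightarrow> x e = y e) \<Longrightarrow> min_weight \<S> x = min_weight \<S> y"
  unfolding min_weight_def by (intro arg_cong[where f = Min] image_cong refl sum.cong) auto

lemma trunc_min_weight_cong:
  "(\<And>S e. S \<in> \<S> \<Longrightarrow> e \<in> S \<Longrightarrow> x e = y e) \<Longrightarrow> trunc_min_weight M \<S> x = trunc_min_weight M \<S> y"
  unfolding trunc_min_weight_def using min_weight_cong[of \<S> x y] by presburger

lemma pivotal_cong:
  assumes "\<And>S e. S \<in> \<S> \<Longrightarrow> e \<in> S \<Longrightarrow> x e = y e"
  shows "pivotal M \<S> x = pivotal M \<S> y"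
proof -
  have "sum x S = sum y S" if "S \<in> \<S>" for S using assms[OF that] by (intro sum.cong) auto
  moreover have "min_weight \<S> x = min_weight \<S> y" by (rule min_weight_cong) (rule assms)
  ultimately show ?thesis unfolding pivotal_def by auto
qed

lemma trunc_min_weight_nonneg:
  assumes "finite \<S>" "\<S> \<noteq> {}" "M \<ge> 0" "\<And>S e. S \<in> \<S> \<Longrightarrow> e \<in> S \<Longrightarrow> 0 \<le> x e"
  shows "0 \<le> trunc_min_weight M \<S> x"
  unfolding trunc_min_weight_def using assms
  by (auto intro!: min_weight_greatest sum_nonneg)

lemma trunc_min_weight_le: "trunc_min_weight M \<S> x \<le> M"
  unfolding trunc_min_weight_def by simp

text \<open>A minimizer that avoids \<open>e\<close> keeps its weight when the weight of \<open>e\<close> grows.\<close>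

lemma trunc_min_weight_increment:
  assumes fin: "finite \<S>" "\<S> \<noteq> {}" "\<And>S. S \<in> \<S> \<Longrightarrow> finite S" and d: "d \<ge> 0"
  shows "trunc_min_weight M \<S> x \<le> trunc_min_weight M \<S> (x(e := x e + d))"
    and "trunc_min_weight M \<S> (x(e := x e + d)) \<le> trunc_min_weight M \<S> x + d * of_bool (e \<in> pivotal M \<S> x)"
proof -
  let ?y = "x(e := x e + d)"
  have s: "sum ?y S = sum x S + (if e \<in> S then d else 0)" if "S \<in> \<S>" for S
  proof -
    have "sum ?y S = (\<Sum>i\<in>S. x i + (if i = e then d else 0))" by (intro sum.cong) auto
    also have "\<dots> = sum x S + (if e \<in> S then d else 0)"
      using fin(3)[OF that] by (simp add: sum.distrib)
    finally show ?thesis .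
  qed
  have "min_weight \<S> x \<le> min_weight \<S> ?y"
  proof (rule min_weight_greatest[OF fin(1,2)])
    fix S assume "S \<in> \<S>"
    then show "min_weight \<S> x \<le> sum ?y S" using min_weight_le[OF fin(1), of S x] s[of S] d by auto
  qed
  then show "trunc_min_weight M \<S> x \<le> trunc_min_weight M \<S> ?y"
    unfolding trunc_min_weight_def by simp
  show "trunc_min_weight M \<S> ?y \<le> trunc_min_weight M \<S> x + d * of_bool (e \<in> pivotal M \<S> x)"
  proof (cases "e \<in> pivotal M \<S> x")
    case True
    obtain S where S: "S \<in> \<S>" "sum x S = min_weight \<S> x" using min_weight_attained[OF fin(1,2)] .
    have "min_weight \<S> ?y \<le> min_weight \<S> x + d"
      using min_weight_le[OF fin(1) S(1), of ?y] s[OF S(1)] S(2) d by (auto split: if_splits)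
    then show ?thesis using True d unfolding trunc_min_weight_def by auto
  next
    case False
    then consider "M \<le> min_weight \<S> x" | S where "S \<in> \<S>" "sum x S = min_weight \<S> x" "e \<notin> S"
      unfolding pivotal_def by fastforce
    then have "min M (min_weight \<S> ?y) \<le> min M (min_weight \<S> x)"
    proof cases
      case 2
      then have "min_weight \<S> ?y \<le> min_weight \<S> x"
        using min_weight_le[OF fin(1) 2(1), of ?y] s[OF 2(1)] by simp
      then show ?thesis by simp
    qed simp
    then show ?thesis using False unfolding trunc_min_weight_def by simp
  qed
qed

text \<open>All pivotal elements lie in one minimizer, whose weight is below \<open>M\<close>.\<close>

lemma sum_pivotal_le:
  assumes fin: "finite \<S>" "\<S> \<noteq> {}" "\<And>S. S \<in> \<S> \<Longrightarrow> finite S"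
    and M: "M \<ge> 0" and J: "finite J" and x: "\<And>e. 0 \<le> x e"
  shows "(\<Sum>e\<in>J. x e * of_bool (e \<in> pivotal M \<S> x)) \<le> M"
proof (cases "min_weight \<S> x < M")
  case True
  obtain S where S: "S \<in> \<S>" "sum x S = min_weight \<S> x" using min_weight_attained[OF fin(1,2)] .
  have "pivotal M \<S> x \<subseteq> S" using S unfolding pivotal_def by auto
  have "(\<Sum>e\<in>J. x e * of_bool (e \<in> pivotal M \<S> x)) = (\<Sum>e\<in>J \<inter> pivotal M \<S> x. x e)"
    using J by (intro sum.mono_neutral_cong_right) auto
  also have "\<dots> \<le> sum x S"
    using \<open>pivotal M \<S> x \<subseteq> S\<close> fin(3)[OF S(1)] x by (intro sum_mono2) auto
  finally show ?thesis using True S(2) by simp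
next
  case False
  then show ?thesis using M by (simp add: pivotal_def)
qed

definition avg_trunc_weight :: "real \<Rightarrow> 'z set \<Rightarrow> ('z \<Rightarrow> 'e set set) \<Rightarrow> ('e \<Rightarrow> real) \<Rightarrow> real" where
  "avg_trunc_weight M Z \<S> x = (\<Sum>z\<in>Z. trunc_min_weight M (\<S> z) x) / card Z"

definition pivotal_freq :: "real \<Rightarrow> 'z set \<Rightarrow> ('z \<Rightarrow> 'e set set) \<Rightarrow> ('e \<Rightarrow> real) \<Rightarrow> 'e \<Rightarrow> real" where
  "pivotal_freq M Z \<S> x e = (\<Sum>z\<in>Z. of_bool (e \<in> pivotal M (\<S> z) x)) / card Z"

text \<open>The pairs \<open>(e, i)\<close> with \<open>i < n\<close> stand for \<open>n\<close> signs attached to \<open>e\<close>, which are \<open>1\<close> on the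
  members of \<open>A\<close> and \<open>- 1\<close> elsewhere; their sum is normalised to variance one.\<close>

definition bit_sum :: "nat \<Rightarrow> 'e \<Rightarrow> ('e \<times> nat) set \<Rightarrow> real" where
  "bit_sum n e A = (2 * real (card {i. i < n \<and> (e, i) \<in> A}) - real n) / sqrt (real n)"

lemma bit_sum_remove_insert:
  assumes "j < n" "n > 0"
  shows "bit_sum n e (insert (e, j) A) = bit_sum n e (A - {(e, j)}) + 2 / sqrt (real n)"
proof -
  have "{i. i < n \<and> (e, i) \<in> insert (e, j) A} = insert j {i. i < n \<and> (e, i) \<in> A - {(e, j)}}"
    using assms by auto
  moreover have "j \<notin> {i. i < n \<and> (e, i) \<in> A - {(e, j)}}" by auto
  moreover have "finite {i. i < n \<and> (e, i) \<in> A - {(e, j)}}" by simp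
  ultimately show ?thesis
    unfolding bit_sum_def by (simp add: add_divide_distrib[symmetric])
qed

lemma bit_sum_other:
  assumes "e' \<noteq> e"
  shows "bit_sum n e' (insert (e, j) A) = bit_sum n e' (A - {(e, j)})"
proof -
  have "{i. i < n \<and> (e', i) \<in> insert (e, j) A} = {i. i < n \<and> (e', i) \<in> A - {(e, j)}}" using assms by auto
  then show ?thesis unfolding bit_sum_def by simp
qed

lemma abs_exp_minus_one_le:
  fixes u :: real
  assumes "\<bar>u\<bar> \<le> 1 / 2"
  shows "\<bar>exp u - 1\<bar> \<le> 2 * \<bar>u\<bar>"
proof (cases "u \<ge> 0")
  case True
  then have "exp u \<le> 1 + u + u\<^sup>2" using assms by (intro exp_bound) auto
  moreover have "u\<^sup>2 \<le> u" using True assms by (simp add: power2_eq_square mult_left_le)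
  ultimately show ?thesis using True by simp
next
  case False
  then have "exp u \<le> 1" by simp
  moreover have "1 + u \<le> exp u" by (rule exp_ge_add_one_self)
  ultimately show ?thesis using False by linarith
qed

text \<open>Either \<open>v \<le> X * sqrt \<rho>\<close>, which is smaller than required, or the logarithm in the hypothesis is
  at least \<open>ln (1 / \<rho>) / 2\<close>.\<close>

lemma le_of_mult_ln_le:
  fixes v X \<rho> :: real
  assumes X: "X > 0" and r: "0 < \<rho>" "\<rho> < 1" and v: "v * ln (v / (X * \<rho>)) \<le> 2 * X"
  shows "v \<le> 4 * X / ln (1 / \<rho>)"
proof -
  define l where "l = ln (1 / \<rho>)"
  have l: "l > 0" using r by (simp add: l_def)
  have ls: "ln (1 / sqrt \<rho>) = l / 2" using r by (simp add: l_def ln_div ln_sqrt)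
  have "v * l \<le> 4 * X"
  proof (cases "v \<le> X * sqrt \<rho>")
    case True
    have "l / 2 \<le> 1 / sqrt \<rho> - 1" unfolding ls[symmetric] using r by (intro ln_le_minus_one) simp
    then have "sqrt \<rho> * (l / 2) \<le> sqrt \<rho> * (1 / sqrt \<rho> - 1)" using r by (intro mult_left_mono) auto
    also have "\<dots> = 1 - sqrt \<rho>" using r by (simp add: right_diff_distrib)
    finally have "sqrt \<rho> * l \<le> 4" using r real_sqrt_gt_zero[of \<rho>] by linarith
    have "v * l \<le> X * sqrt \<rho> * l" using True l by (intro mult_right_mono) auto
    also have "\<dots> \<le> 4 * X" using \<open>sqrt \<rho> * l \<le> 4\<close> X by (simp add: mult.assoc mult.commute)
    finally show ?thesis .
  next
    case False
    then have vp: "v > X * sqrt \<rho>" by simp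
    have v0: "v > 0" using vp X r by (smt (verit) mult_pos_pos real_sqrt_gt_zero)
    have "1 / sqrt \<rho> \<le> v / (X * \<rho>)"
    proof -
      have "1 / sqrt \<rho> = X * sqrt \<rho> / (X * \<rho>)"
        using X r by (simp add: field_simps)
      also have "\<dots> \<le> v / (X * \<rho>)" using vp X r by (intro divide_right_mono) auto
      finally show ?thesis .
    qed
    then have "l / 2 \<le> ln (v / (X * \<rho>))"
      unfolding ls[symmetric] using X r v0 by (subst ln_le_cancel_iff) auto
    then have "v * (l / 2) \<le> v * ln (v / (X * \<rho>))" using v0 by (intro mult_left_mono) auto
    then show ?thesis using v by simp
  qed
  then show ?thesis using l by (simp add: l_def pos_le_divide_eq)
qed

text \<open>Only pivotal edges contribute to a difference, and
  \<open>q = R\<^sup>2\<close> with \<open>R\<close> Lipschitz makes the squared contribution of \<open>e\<close> at most a multiple of \<open>x e\<close>; the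
  weights \<open>x e\<close> of the pivotal edges add up to at most \<open>M\<close>. For the first moments, Cauchy-Schwarz
  separates one factor \<open>pivotal_freq\<close>, whose average is at most \<open>\<rho>\<close>.\<close>

lemma cube_exp_variance:
  fixes R :: "real \<Rightarrow> real" and \<S> :: "'z \<Rightarrow> 'e set set"
  assumes J: "finite J" and Z: "finite Z" "Z \<noteq> {}"
    and \<S>: "\<And>z. z \<in> Z \<Longrightarrow> finite (\<S> z)" "\<And>z. z \<in> Z \<Longrightarrow> \<S> z \<noteq> {}" "\<And>z S. z \<in> Z \<Longrightarrow> S \<in> \<S> z \<Longrightarrow> S \<subseteq> J"
    and R: "\<And>s. 0 \<le> R s" "\<And>s. (R s)\<^sup>2 \<le> M" "\<And>s t. s \<le> t \<Longrightarrow> R s \<le> R t"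
      "\<And>s t. s \<le> t \<Longrightarrow> R t - R s \<le> L * (t - s)"
    and L: "L > 0" and M: "M > 0" and n: "n > 0"
    and \<eta>: "\<eta> = 2 * L / sqrt (real n)" "\<eta> * (2 * sqrt M + \<eta>) \<le> 1" "2 * \<eta>\<^sup>2 * card J \<le> M"
    and \<rho>: "0 < \<rho>" "\<rho> < 1"
    and x: "\<And>A. x A = (\<lambda>e. (R (bit_sum n e A))\<^sup>2)"
    and I: "I = J \<times> {..<n}"
    and freq: "\<And>e. e \<in> J \<Longrightarrow> cube_avg I (\<lambda>A. pivotal_freq M Z \<S> (x A) e) \<le> \<rho>"
    and \<theta>: "\<bar>\<theta>\<bar> \<le> 1"
    and W: "\<And>A. W A = exp (\<theta> / 2 * avg_trunc_weight M Z \<S> (x A))"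
  shows "cube_avg I (\<lambda>A. (W A)\<^sup>2) - (cube_avg I W)\<^sup>2
    \<le> 144 * L\<^sup>2 * M * \<theta>\<^sup>2 * cube_avg I (\<lambda>A. (W A)\<^sup>2) / ln (1 / \<rho>)"
proof (cases "\<theta> = 0")
  case True
  have "finite I" using I J by simp
  moreover have "W = (\<lambda>_. 1)" using True by (simp add: W fun_eq_iff)
  ultimately show ?thesis using True by simp
next
  case th0: False
  have fI: "finite I" using I J by simp
  have cZ: "real (card Z) > 0" using Z by (simp add: card_gt_0_iff)
  have fS: "finite S" if "z \<in> Z" "S \<in> \<S> z" for z S using \<S>(3)[OF that] J by (rule finite_subset)
  have W0: "W A > 0" for A by (simp add: W)
  have \<eta>0: "\<eta> > 0" using \<eta>(1) L n by simp
  define P where "P A e = pivotal_freq M Z \<S> (x A) e" for A e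
  have P0: "0 \<le> P A e" for A e unfolding P_def pivotal_freq_def by (intro divide_nonneg_nonneg sum_nonneg) auto
  have P1: "P A e \<le> 1" for A e
  proof -
    have "(\<Sum>z\<in>Z. of_bool (e \<in> pivotal M (\<S> z) (x A)) :: real) \<le> (\<Sum>z\<in>Z. 1)" by (intro sum_mono) simp
    then show ?thesis using cZ unfolding P_def pivotal_freq_def by (simp add: divide_le_eq)
  qed
  define r where "r A e = R (bit_sum n e A)" for A :: "('e \<times> nat) set" and e
  have rM: "r A e \<le> sqrt M" for A e unfolding r_def using R(2) by (intro real_le_rsqrt) simp
  have r0: "0 \<le> r A e" for A e unfolding r_def by (rule R(1))
  have xr: "x A e = (r A e)\<^sup>2" for A e by (simp add: x r_def)
  define \<phi> where "\<phi> e A = W A * P A e * (2 * r A e + \<eta>)" for e A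
  define \<Psi> where "\<Psi> e A = (W A)\<^sup>2 * P A e * (8 * x A e + 2 * \<eta>\<^sup>2)" for e A
  have \<phi>0: "0 \<le> \<phi> e A" for e A unfolding \<phi>_def using W0[of A] P0 r0 \<eta>0 by (intro mult_nonneg_nonneg) (auto intro: less_imp_le add_nonneg_nonneg)
  have \<Psi>0: "0 \<le> \<Psi> e A" for e A unfolding \<Psi>_def using P0 by (intro mult_nonneg_nonneg) (auto simp: xr)
  have sq: "(2 * r A e + \<eta>)\<^sup>2 \<le> 8 * x A e + 2 * \<eta>\<^sup>2" for A e
  proof -
    have "8 * x A e + 2 * \<eta>\<^sup>2 - (2 * r A e + \<eta>)\<^sup>2 = (2 * r A e - \<eta>)\<^sup>2"
      unfolding xr by (simp add: power2_eq_square algebra_simps)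
    then show ?thesis by (smt (verit) zero_le_power2)
  qed
  have step: "\<bar>cube_diff (e, j) W A\<bar> \<le> \<bar>\<theta>\<bar> * \<eta> * \<phi> e (A - {(e, j)})" if ej: "(e, j) \<in> I" for e j A
  proof -
    define B where "B = A - {(e, j)}"
    have jn: "j < n" using ej I by simp
    define s where "s = bit_sum n e B"
    define d where "d = (R (s + 2 / sqrt n))\<^sup>2 - (R s)\<^sup>2"
    define t where "t = R (s + 2 / sqrt n) - R s"
    have t0: "0 \<le> t" unfolding t_def using R(3)[of s "s + 2 / sqrt n"] by simp
    have t1: "t \<le> \<eta>" unfolding t_def \<eta>(1) using R(4)[of s "s + 2 / sqrt n"] by (simp add: field_simps)
    have dt: "d = t * (2 * R s + t)" unfolding d_def t_def by (simp add: power2_eq_square algebra_simps)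
    have rs: "r B e = R s" by (simp add: r_def s_def)
    have d0: "0 \<le> d" unfolding dt using t0 R(1)[of s] by simp
    have d1: "d \<le> \<eta> * (2 * r B e + \<eta>)" unfolding dt rs
      using t0 t1 R(1)[of s] \<eta>0 by (intro mult_mono) auto
    have xi: "x (insert (e, j) A) = (x B)(e := x B e + d)"
    proof
      fix e'
      show "x (insert (e, j) A) e' = ((x B)(e := x B e + d)) e'"
      proof (cases "e' = e")
        case True
        then show ?thesis
          using bit_sum_remove_insert[OF jn n, of e A] by (simp add: x d_def B_def s_def)
      next
        case False
        then show ?thesis using bit_sum_other[OF False] by (simp add: x B_def)
      qed
    qed
    define D where "D = avg_trunc_weight M Z \<S> (x (insert (e, j) A)) - avg_trunc_weight M Z \<S> (x B)"
    have D: "D = (\<Sum>z\<in>Z. trunc_min_weight M (\<S> z) ((x B)(e := x B e + d)) - trunc_min_weight M (\<S> z) (x B)) / card Z"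
      unfolding D_def avg_trunc_weight_def xi by (simp add: sum_subtractf diff_divide_distrib)
    have D0: "0 \<le> D" unfolding D
      by (intro divide_nonneg_nonneg sum_nonneg)
        (use trunc_min_weight_increment(1)[OF \<S>(1,2) fS d0] in auto)
    have D1: "D \<le> d * P B e"
    proof -
      have "(\<Sum>z\<in>Z. trunc_min_weight M (\<S> z) ((x B)(e := x B e + d)) - trunc_min_weight M (\<S> z) (x B))
         \<le> (\<Sum>z\<in>Z. d * of_bool (e \<in> pivotal M (\<S> z) (x B)))"
        using trunc_min_weight_increment(2)[OF \<S>(1,2) fS d0, of _ _ M "x B" e]
        by (intro sum_mono) (simp add: algebra_simps)
      then show ?thesis unfolding D P_def pivotal_freq_def
        using cZ by (simp add: sum_distrib_left divide_right_mono)
    qed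
    have D2: "D \<le> P B e * (\<eta> * (2 * r B e + \<eta>))"
    proof -
      have "d * P B e \<le> (\<eta> * (2 * r B e + \<eta>)) * P B e" using d1 P0 by (rule mult_right_mono)
      then show ?thesis using D1 by (simp add: mult.commute)
    qed
    have "\<eta> * (2 * r B e + \<eta>) \<le> 1"
    proof -
      have "\<eta> * (2 * r B e + \<eta>) \<le> \<eta> * (2 * sqrt M + \<eta>)" using rM[of B e] \<eta>0 by (intro mult_left_mono) auto
      then show ?thesis using \<eta>(2) by simp
    qed
    then have "D \<le> 1"
    proof -
      have "P B e * (\<eta> * (2 * r B e + \<eta>)) \<le> 1 * 1"
        using \<open>\<eta> * (2 * r B e + \<eta>) \<le> 1\<close> P0 P1 r0[of B e] \<eta>0 by (intro mult_mono) auto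
      then show ?thesis using D2 by simp
    qed
    have "\<bar>\<theta> / 2 * D\<bar> \<le> 1 / 2"
    proof -
      have "\<bar>\<theta>\<bar> * D \<le> 1 * 1" using \<theta> D0 \<open>D \<le> 1\<close> by (intro mult_mono) auto
      then show ?thesis using D0 by (simp add: abs_mult)
    qed
    then have "\<bar>exp (\<theta> / 2 * D) - 1\<bar> \<le> 2 * \<bar>\<theta> / 2 * D\<bar>" by (rule abs_exp_minus_one_le)
    also have "\<dots> = \<bar>\<theta>\<bar> * D" using D0 by (simp add: abs_mult)
    finally have e1: "\<bar>exp (\<theta> / 2 * D) - 1\<bar> \<le> \<bar>\<theta>\<bar> * D" .
    have "cube_diff (e, j) W A = W B * (exp (\<theta> / 2 * D) - 1)"
      unfolding cube_diff_def B_def[symmetric] W D_def by (simp add: algebra_simps exp_add[symmetric])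
    then have "\<bar>cube_diff (e, j) W A\<bar> = W B * \<bar>exp (\<theta> / 2 * D) - 1\<bar>"
      using W0[of B] by (simp add: abs_mult)
    also have "\<dots> \<le> W B * (\<bar>\<theta>\<bar> * (P B e * (\<eta> * (2 * r B e + \<eta>))))"
      using W0[of B] e1 D2 by (intro mult_left_mono order_trans[OF e1]) auto
    also have "\<dots> = \<bar>\<theta>\<bar> * \<eta> * \<phi> e B" unfolding \<phi>_def by (simp add: mult_ac)
    finally show ?thesis unfolding B_def .
  qed
  have \<phi>sq: "(\<phi> e A)\<^sup>2 \<le> \<Psi> e A" for e A
  proof -
    have "(\<phi> e A)\<^sup>2 = ((W A)\<^sup>2 * (P A e * P A e)) * (2 * r A e + \<eta>)\<^sup>2"
      unfolding \<phi>_def by (simp add: power_mult_distrib power2_eq_square mult_ac)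
    also have "\<dots> \<le> ((W A)\<^sup>2 * (P A e * 1)) * (8 * x A e + 2 * \<eta>\<^sup>2)"
      using P0 P1 sq by (intro mult_mono mult_left_mono) auto
    finally show ?thesis unfolding \<Psi>_def by simp
  qed
  have first: "(cube_avg I (\<lambda>A. \<bar>cube_diff (e, j) W A\<bar>))\<^sup>2 \<le> 4 * \<theta>\<^sup>2 * \<eta>\<^sup>2 * \<rho> * cube_avg I (\<Psi> e)"
    if ej: "(e, j) \<in> I" for e j
  proof -
    have eJ: "e \<in> J" using ej I by simp
    have "cube_avg I (\<lambda>A. \<bar>cube_diff (e, j) W A\<bar>) \<le> cube_avg I (\<lambda>A. \<bar>\<theta>\<bar> * \<eta> * \<phi> e (A - {(e, j)}))"
      by (intro cube_avg_mono step ej)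
    also have "\<dots> = \<bar>\<theta>\<bar> * \<eta> * cube_avg I (\<lambda>A. \<phi> e (A - {(e, j)}))" by (rule cube_avg_cmult)
    also have "\<dots> \<le> \<bar>\<theta>\<bar> * \<eta> * (2 * cube_avg I (\<phi> e))"
      using \<eta>0 by (intro mult_left_mono cube_avg_remove_le fI ej \<phi>0) auto
    finally have 1: "cube_avg I (\<lambda>A. \<bar>cube_diff (e, j) W A\<bar>) \<le> 2 * \<bar>\<theta>\<bar> * \<eta> * cube_avg I (\<phi> e)" by simp
    have "(cube_avg I (\<phi> e))\<^sup>2 = (cube_avg I (\<lambda>A. (W A * sqrt (P A e) * (2 * r A e + \<eta>)) * sqrt (P A e)))\<^sup>2"
      unfolding \<phi>_def using P0 by (intro arg_cong[where f = "\<lambda>u. u\<^sup>2"] cube_avg_cong) (simp add: mult_ac)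
    also have "\<dots> \<le> cube_avg I (\<lambda>A. (W A * sqrt (P A e) * (2 * r A e + \<eta>))\<^sup>2) * cube_avg I (\<lambda>A. (sqrt (P A e))\<^sup>2)"
      by (rule cube_avg_Cauchy_Schwarz[OF fI])
    also have "\<dots> \<le> cube_avg I (\<Psi> e) * \<rho>"
    proof (rule mult_mono)
      show "cube_avg I (\<lambda>A. (W A * sqrt (P A e) * (2 * r A e + \<eta>))\<^sup>2) \<le> cube_avg I (\<Psi> e)"
      proof (rule cube_avg_mono)
        fix A
        have "(W A * sqrt (P A e) * (2 * r A e + \<eta>))\<^sup>2 = (W A)\<^sup>2 * P A e * (2 * r A e + \<eta>)\<^sup>2"
          using P0 by (simp add: power_mult_distrib)
        also have "\<dots> \<le> \<Psi> e A" unfolding \<Psi>_def using sq P0 by (intro mult_left_mono) auto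
        finally show "(W A * sqrt (P A e) * (2 * r A e + \<eta>))\<^sup>2 \<le> \<Psi> e A" .
      qed
      show "cube_avg I (\<lambda>A. (sqrt (P A e))\<^sup>2) \<le> \<rho>" using freq[OF eJ] P0 by (simp add: P_def[symmetric])
    qed (auto intro!: cube_avg_nonneg \<Psi>0)
    finally have 2: "(cube_avg I (\<phi> e))\<^sup>2 \<le> cube_avg I (\<Psi> e) * \<rho>" .
    have "(cube_avg I (\<lambda>A. \<bar>cube_diff (e, j) W A\<bar>))\<^sup>2 \<le> (2 * \<bar>\<theta>\<bar> * \<eta> * cube_avg I (\<phi> e))\<^sup>2"
      using 1 by (intro power_mono cube_avg_nonneg) auto
    also have "\<dots> = 4 * \<theta>\<^sup>2 * \<eta>\<^sup>2 * (cube_avg I (\<phi> e))\<^sup>2" by (simp add: power_mult_distrib)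
    also have "\<dots> \<le> 4 * \<theta>\<^sup>2 * \<eta>\<^sup>2 * (cube_avg I (\<Psi> e) * \<rho>)" using 2 by (intro mult_left_mono) auto
    finally show ?thesis by (simp add: mult_ac)
  qed
  have second: "cube_avg I (\<lambda>A. (cube_diff (e, j) W A)\<^sup>2) \<le> 2 * \<theta>\<^sup>2 * \<eta>\<^sup>2 * cube_avg I (\<Psi> e)"
    if ej: "(e, j) \<in> I" for e j
  proof -
    have "cube_avg I (\<lambda>A. (cube_diff (e, j) W A)\<^sup>2) \<le> cube_avg I (\<lambda>A. \<theta>\<^sup>2 * \<eta>\<^sup>2 * \<Psi> e (A - {(e, j)}))"
    proof (rule cube_avg_mono)
      fix A
      have "(cube_diff (e, j) W A)\<^sup>2 = \<bar>cube_diff (e, j) W A\<bar>\<^sup>2" by simp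
      also have "\<dots> \<le> (\<bar>\<theta>\<bar> * \<eta> * \<phi> e (A - {(e, j)}))\<^sup>2" by (intro power_mono step ej) auto
      also have "\<dots> = \<theta>\<^sup>2 * \<eta>\<^sup>2 * (\<phi> e (A - {(e, j)}))\<^sup>2" by (simp add: power_mult_distrib)
      also have "\<dots> \<le> \<theta>\<^sup>2 * \<eta>\<^sup>2 * \<Psi> e (A - {(e, j)})" by (intro mult_left_mono \<phi>sq) auto
      finally show "(cube_diff (e, j) W A)\<^sup>2 \<le> \<theta>\<^sup>2 * \<eta>\<^sup>2 * \<Psi> e (A - {(e, j)})" .
    qed
    also have "\<dots> = \<theta>\<^sup>2 * \<eta>\<^sup>2 * cube_avg I (\<lambda>A. \<Psi> e (A - {(e, j)}))" by (rule cube_avg_cmult)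
    also have "\<dots> \<le> \<theta>\<^sup>2 * \<eta>\<^sup>2 * (2 * cube_avg I (\<Psi> e))"
      by (intro mult_left_mono cube_avg_remove_le fI ej \<Psi>0) auto
    finally show ?thesis by (simp add: mult_ac)
  qed
  have sum\<Psi>: "(\<Sum>e\<in>J. cube_avg I (\<Psi> e)) \<le> 9 * M * cube_avg I (\<lambda>A. (W A)\<^sup>2)"
  proof -
    have "(\<Sum>e\<in>J. cube_avg I (\<Psi> e)) = cube_avg I (\<lambda>A. \<Sum>e\<in>J. \<Psi> e A)" by (simp add: cube_avg_sum)
    also have "\<dots> \<le> cube_avg I (\<lambda>A. (9 * M) * (W A)\<^sup>2)"
    proof (rule cube_avg_mono)
      fix A
      have "(\<Sum>e\<in>J. x A e * P A e) \<le> M"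
      proof -
        have "(\<Sum>e\<in>J. x A e * P A e) = (\<Sum>z\<in>Z. \<Sum>e\<in>J. x A e * of_bool (e \<in> pivotal M (\<S> z) (x A))) / card Z"
          unfolding P_def pivotal_freq_def
          by (subst sum.swap) (simp add: sum_distrib_left sum_divide_distrib)
        also have "\<dots> \<le> (\<Sum>z\<in>Z. M) / card Z"
          using M by (intro divide_right_mono sum_mono sum_pivotal_le \<S>(1,2) fS J) (auto simp: xr)
        also have "\<dots> = M" using cZ by simp
        finally show ?thesis .
      qed
      moreover have "(\<Sum>e\<in>J. P A e) \<le> card J"
        using sum_mono[of J "P A" "\<lambda>_. 1"] P1 by simp
      moreover have "(\<Sum>e\<in>J. P A e * (8 * x A e + 2 * \<eta>\<^sup>2)) = 8 * (\<Sum>e\<in>J. x A e * P A e) + 2 * \<eta>\<^sup>2 * (\<Sum>e\<in>J. P A e)"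
        by (simp only: distrib_left sum.distrib sum_distrib_left) (simp add: mult_ac)
      moreover have "2 * \<eta>\<^sup>2 * (\<Sum>e\<in>J. P A e) \<le> 2 * \<eta>\<^sup>2 * card J"
        using calculation(2) by (intro mult_left_mono) auto
      ultimately have "(\<Sum>e\<in>J. P A e * (8 * x A e + 2 * \<eta>\<^sup>2)) \<le> 9 * M" using \<eta>(3) by linarith
      then have "(W A)\<^sup>2 * (\<Sum>e\<in>J. P A e * (8 * x A e + 2 * \<eta>\<^sup>2)) \<le> (W A)\<^sup>2 * (9 * M)"
        by (intro mult_left_mono) auto
      then show "(\<Sum>e\<in>J. \<Psi> e A) \<le> (9 * M) * (W A)\<^sup>2"
        unfolding \<Psi>_def by (simp add: sum_distrib_left mult_ac)
    qed
    also have "\<dots> = 9 * M * cube_avg I (\<lambda>A. (W A)\<^sup>2)" by (rule cube_avg_cmult)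
    finally show ?thesis .
  qed
  have n\<eta>: "real n * \<eta>\<^sup>2 = 4 * L\<^sup>2" using n unfolding \<eta>(1) by (simp add: power_divide power_mult_distrib)
  define E where "E = cube_avg I (\<lambda>A. (W A)\<^sup>2)"
  have E0: "E > 0"
  proof -
    have "0 < (\<Sum>A\<in>Pow I. (W A)\<^sup>2)" using fI W0 by (intro sum_pos) (auto simp: less_imp_neq[symmetric])
    then show ?thesis by (simp add: E_def cube_avg_def)
  qed
  define X where "X = 36 * L\<^sup>2 * M * \<theta>\<^sup>2 * E"
  have X0: "X > 0" unfolding X_def using L M th0 E0 by simp
  have SS: "(\<Sum>i\<in>I. F (fst i)) = real n * (\<Sum>e\<in>J. F e)" for F :: "'e \<Rightarrow> real"
  proof -
    have "(\<Sum>i\<in>I. F (fst i)) = (\<Sum>(e, j)\<in>J \<times> {..<n}. F e)" unfolding I by (intro sum.cong) auto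
    also have "\<dots> = (\<Sum>e\<in>J. \<Sum>j<n. F e)" by (rule sum.cartesian_product[symmetric])
    finally show ?thesis by (simp add: sum_distrib_left)
  qed
  have "(\<Sum>i\<in>I. (cube_avg I (\<lambda>A. \<bar>cube_diff i W A\<bar>))\<^sup>2) \<le> (\<Sum>i\<in>I. 4 * \<theta>\<^sup>2 * \<eta>\<^sup>2 * \<rho> * cube_avg I (\<Psi> (fst i)))"
    using first by (intro sum_mono) auto
  also have "\<dots> = (real n * \<eta>\<^sup>2) * (4 * \<theta>\<^sup>2 * \<rho>) * (\<Sum>e\<in>J. cube_avg I (\<Psi> e))"
    unfolding SS[of "\<lambda>e. 4 * \<theta>\<^sup>2 * \<eta>\<^sup>2 * \<rho> * cube_avg I (\<Psi> e)"] by (simp add: sum_distrib_left mult_ac)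
  also have "\<dots> \<le> (real n * \<eta>\<^sup>2) * (4 * \<theta>\<^sup>2 * \<rho>) * (9 * M * E)"
    using sum\<Psi> \<rho> unfolding E_def by (intro mult_left_mono) auto
  also have "\<dots> = 4 * (X * \<rho>)" unfolding n\<eta> X_def by (simp add: mult_ac)
  finally have F1: "(\<Sum>i\<in>I. (cube_avg I (\<lambda>A. \<bar>cube_diff i W A\<bar>))\<^sup>2) / 4 \<le> X * \<rho>" by simp
  have "(\<Sum>i\<in>I. cube_avg I (\<lambda>A. (cube_diff i W A)\<^sup>2)) \<le> (\<Sum>i\<in>I. 2 * \<theta>\<^sup>2 * \<eta>\<^sup>2 * cube_avg I (\<Psi> (fst i)))"
    using second by (intro sum_mono) auto
  also have "\<dots> = (real n * \<eta>\<^sup>2) * (2 * \<theta>\<^sup>2) * (\<Sum>e\<in>J. cube_avg I (\<Psi> e))"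
    unfolding SS[of "\<lambda>e. 2 * \<theta>\<^sup>2 * \<eta>\<^sup>2 * cube_avg I (\<Psi> e)"] by (simp add: sum_distrib_left mult_ac)
  also have "\<dots> \<le> (real n * \<eta>\<^sup>2) * (2 * \<theta>\<^sup>2) * (9 * M * E)"
    using sum\<Psi> unfolding E_def by (intro mult_left_mono) auto
  also have "\<dots> = 2 * X" unfolding n\<eta> X_def by (simp add: mult_ac)
  finally have F2: "(\<Sum>i\<in>I. cube_avg I (\<lambda>A. (cube_diff i W A)\<^sup>2)) \<le> 2 * X" .
  have dep: "depends_on I W"
  proof (rule depends_onI)
    fix A
    have "bit_sum n e A = bit_sum n e (A \<inter> I)" if "e \<in> J" for e
    proof -
      have "{i. i < n \<and> (e, i) \<in> A} = {i. i < n \<and> (e, i) \<in> A \<inter> I}" using that I by auto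
      then show ?thesis unfolding bit_sum_def by presburger
    qed
    then have "x A e = x (A \<inter> I) e" if "e \<in> J" for e unfolding x using that by presburger
    then have "avg_trunc_weight M Z \<S> (x A) = avg_trunc_weight M Z \<S> (x (A \<inter> I))"
      unfolding avg_trunc_weight_def
      by (intro arg_cong2[where f = "(/)"] sum.cong refl trunc_min_weight_cong) (use \<S>(3) in blast)
    then show "W A = W (A \<inter> I)" unfolding W by presburger
  qed
  have "X * \<rho> > 0" using X0 \<rho> by simp
  from cube_falik_samorodnitsky[OF fI dep this F1 refl] F2
  have "(E - (cube_avg I W)\<^sup>2) * ln ((E - (cube_avg I W)\<^sup>2) / (X * \<rho>)) \<le> 2 * X"
    unfolding E_def by simp
  then have "E - (cube_avg I W)\<^sup>2 \<le> 4 * X / ln (1 / \<rho>)" by (rule le_of_mult_ln_le[OF X0 \<rho>])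
  then show ?thesis unfolding X_def E_def by (simp add: mult_ac)
qed

section \<open>From signs to Gaussian variables\<close>

definition sign_sum :: "nat \<Rightarrow> nat set \<Rightarrow> real" where
  "sign_sum n a = (2 * real (card a) - real n) / sqrt (real n)"

definition sign_law :: "nat \<Rightarrow> real measure" where
  "sign_law n = distr (measure_pmf (pmf_of_set (Pow {..<n}))) borel (sign_sum n)"

lemma real_distribution_sign_law: "real_distribution (sign_law n)"
  unfolding sign_law_def
  by (intro real_distribution.intro real_distribution_axioms.intro prob_space.prob_space_distr)
    (auto simp: measure_pmf.prob_space_axioms)

lemma integral_sign_law:
  fixes f :: "real \<Rightarrow> 'b :: {banach, second_countable_topology}"
  assumes "f \<in> borel_measurable borel"
  shows "(\<integral>y. f y \<partial>sign_law n) = (\<Sum>a\<in>Pow {..<n}. f (sign_sum n a)) /\<^sub>R 2 ^ n"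
proof -
  have "(\<integral>y. f y \<partial>sign_law n) = (\<integral>a. f (sign_sum n a) \<partial>measure_pmf (pmf_of_set (Pow {..<n})))"
    unfolding sign_law_def using assms by (subst integral_distr) auto
  also have "\<dots> = (\<Sum>a\<in>Pow {..<n}. pmf (pmf_of_set (Pow {..<n})) a *\<^sub>R f (sign_sum n a))"
    by (rule integral_measure_pmf) (auto simp: Pow_not_empty)
  also have "\<dots> = (\<Sum>a\<in>Pow {..<n}. (1 / 2 ^ n) *\<^sub>R f (sign_sum n a))"
    by (intro sum.cong) (auto simp: Pow_not_empty card_Pow)
  finally show ?thesis by (simp add: scaleR_sum_right divide_inverse)
qed

lemma char_sign_law:
  assumes "n > 0"
  shows "char (sign_law n) t = complex_of_real (cos (t / sqrt (real n)) ^ n)"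
proof -
  define u where "u = t / sqrt (real n)"
  have "char (sign_law n) t = (\<Sum>a\<in>Pow {..<n}. iexp (t * sign_sum n a)) /\<^sub>R 2 ^ n"
    unfolding char_def by (subst integral_sign_law) auto
  also have "(\<Sum>a\<in>Pow {..<n}. iexp (t * sign_sum n a))
     = (\<Sum>a\<in>Pow {..<n}. (\<Prod>i\<in>a. iexp u) * (\<Prod>i\<in>{..<n} - a. iexp (- u)))"
  proof (rule sum.cong)
    fix a assume a: "a \<in> Pow {..<n}"
    then have fa: "finite a" by (auto intro: finite_subset)
    have ca: "real (card ({..<n} - a)) = real n - real (card a)"
      using a fa card_mono[of "{..<n}" a] by (subst card_Diff_subset) (auto simp: of_nat_diff)
    have "t * sign_sum n a = real (card a) * u + real (card ({..<n} - a)) * (- u)"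
      unfolding ca sign_sum_def u_def by (simp add: field_simps diff_divide_distrib)
    then have "iexp (t * sign_sum n a) = iexp (real (card a) * u) * iexp (real (card ({..<n} - a)) * (- u))"
      unfolding exp_add[symmetric] distrib_left[symmetric] of_real_add[symmetric] by (rule arg_cong)
    also have "\<dots> = iexp u ^ card a * iexp (- u) ^ card ({..<n} - a)"
      unfolding exp_of_nat_mult[symmetric] of_real_mult of_real_of_nat_eq
      by (simp only: mult.left_commute)
    finally show "iexp (t * sign_sum n a) = (\<Prod>i\<in>a. iexp u) * (\<Prod>i\<in>{..<n} - a. iexp (- u))" by simp
  qed simp
  also have "\<dots> = (\<Prod>i\<in>{..<n}. iexp u + iexp (- u))" by (rule prod_add[symmetric]) simp
  also have "\<dots> = (2 * complex_of_real (cos u)) ^ n"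
  proof -
    have "iexp u + iexp (- u) = 2 * complex_of_real (cos u)"
      unfolding cis_conv_exp[symmetric] by (simp add: complex_eq_iff)
    then show ?thesis by simp
  qed
  also have "\<dots> /\<^sub>R 2 ^ n = complex_of_real (cos u ^ n)"
    by (simp add: power_mult_distrib scaleR_conv_of_real)
  finally show ?thesis by (simp add: u_def)
qed

lemma weak_conv_sign_law: "weak_conv_m (\<lambda>n. sign_law n) std_normal_distribution"
proof (rule levy_continuity)
  fix t :: real
  have "(\<lambda>n. cos (t / sqrt (real n)) ^ n) \<longlonglongrightarrow> exp (- (t * t / 2))"
    by real_asymp
  then have "(\<lambda>n. cos (t / sqrt (real n)) ^ n) \<longlonglongrightarrow> exp (- (t\<^sup>2) / 2)"
    by (simp add: power2_eq_square)
  then have "(\<lambda>n. complex_of_real (cos (t / sqrt (real n)) ^ n)) \<longlonglongrightarrow> complex_of_real (exp (- (t\<^sup>2) / 2))"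
    by (rule tendsto_of_real)
  moreover have "eventually (\<lambda>n. char (sign_law n) t = complex_of_real (cos (t / sqrt (real n)) ^ n)) sequentially"
    using eventually_gt_at_top[of 0] by eventually_elim (rule char_sign_law)
  ultimately show "(\<lambda>n. char (sign_law n) t) \<longlonglongrightarrow> char std_normal_distribution t"
    unfolding char_std_normal_distribution by (simp add: tendsto_cong)
qed (auto intro: real_distribution_sign_law real_dist_normal_dist)

text \<open>Weak convergence of finite products, by realising the convergence of one factor pointwise on
  some probability space and taking independent copies of that space.\<close>

lemma PiM_sign_law_tendsto:
  fixes \<Phi> :: "('e \<Rightarrow> real) \<Rightarrow> real"
  assumes J: "finite J" and m [measurable]: "\<Phi> \<in> borel_measurable (PiM J (\<lambda>_. borel))"
    and B: "\<And>y. \<bar>\<Phi> y\<bar> \<le> B"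
    and cont: "\<And>Y y. (\<And>e. e \<in> J \<Longrightarrow> (\<lambda>n. Y n e) \<longlonglongrightarrow> y e) \<Longrightarrow> (\<lambda>n. \<Phi> (Y n)) \<longlonglongrightarrow> \<Phi> y"
  shows "(\<lambda>n. \<integral>y. \<Phi> y \<partial>PiM J (\<lambda>_. sign_law n)) \<longlonglongrightarrow> (\<integral>y. \<Phi> y \<partial>PiM J (\<lambda>_. std_normal_distribution))"
proof -
  obtain \<Omega> :: "real measure" and Yn Y where \<Omega>: "prob_space \<Omega>"
    and Yn [measurable]: "\<And>n. Yn n \<in> measurable \<Omega> borel" and dYn: "\<And>n. distr \<Omega> borel (Yn n) = sign_law n"
    and Y': "Y \<in> measurable \<Omega> lborel" and dY: "distr \<Omega> borel Y = std_normal_distribution"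
    and lim: "\<And>x. x \<in> space \<Omega> \<Longrightarrow> (\<lambda>n. Yn n x) \<longlonglongrightarrow> Y x"
    using Skorohod[OF real_distribution_sign_law real_dist_normal_dist weak_conv_sign_law] by blast
  have Y [measurable]: "Y \<in> measurable \<Omega> borel" using Y' by simp
  interpret O: prob_space \<Omega> by fact
  interpret PO: prob_space "PiM J (\<lambda>_. \<Omega>)" by (intro prob_space_PiM \<Omega>)
  have pb: "prob_space std_normal_distribution" using real_dist_normal_dist by (simp add: real_distribution_def)
  have sb: "sets (PiM J (\<lambda>_. std_normal_distribution)) = sets (PiM J (\<lambda>_. borel))"
    by (intro sets_PiM_cong) auto
  have eq: "(\<integral>y. \<Phi> y \<partial>PiM J (\<lambda>_. distr \<Omega> borel V)) = (\<integral>w. \<Phi> (compose J V w) \<partial>PiM J (\<lambda>_. \<Omega>))"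
    if V [measurable]: "V \<in> measurable \<Omega> borel" for V
  proof -
    have V': "V \<in> measurable \<Omega> std_normal_distribution" by simp
    have "distr (PiM J (\<lambda>_. \<Omega>)) (PiM J (\<lambda>_. std_normal_distribution)) (compose J V)
        = PiM J (\<lambda>_. distr \<Omega> std_normal_distribution V)"
      by (rule distr_PiM_finite_prob_space') (auto intro: J \<Omega> pb V')
    moreover have "distr \<Omega> std_normal_distribution V = distr \<Omega> borel V" by (intro distr_cong) auto
    ultimately have e: "PiM J (\<lambda>_. distr \<Omega> borel V)
        = distr (PiM J (\<lambda>_. \<Omega>)) (PiM J (\<lambda>_. std_normal_distribution)) (compose J V)" by simp
    have [measurable]: "compose J V \<in> measurable (PiM J (\<lambda>_. \<Omega>)) (PiM J (\<lambda>_. std_normal_distribution))"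
      using V' unfolding compose_def by (intro measurable_restrict) measurable
    have "\<Phi> \<in> borel_measurable (PiM J (\<lambda>_. std_normal_distribution))"
      by (subst measurable_cong_sets[OF sb refl]) (rule m)
    then show ?thesis unfolding e by (subst integral_distr) auto
  qed
  have mc: "(\<lambda>w. \<Phi> (compose J V w)) \<in> borel_measurable (PiM J (\<lambda>_. \<Omega>))"
    if V [measurable]: "V \<in> measurable \<Omega> borel" for V
  proof -
    have "compose J V \<in> measurable (PiM J (\<lambda>_. \<Omega>)) (PiM J (\<lambda>_. borel))"
      unfolding compose_def by (intro measurable_restrict) measurable
    then show ?thesis using m by (rule measurable_compose)
  qed
  have "(\<lambda>n. \<integral>w. \<Phi> (compose J (Yn n) w) \<partial>PiM J (\<lambda>_. \<Omega>)) \<longlonglongrightarrow> (\<integral>w. \<Phi> (compose J Y w) \<partial>PiM J (\<lambda>_. \<Omega>))"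
  proof (rule integral_dominated_convergence[where w = "\<lambda>_. B"])
    show "AE w in PiM J (\<lambda>_. \<Omega>). (\<lambda>n. \<Phi> (compose J (Yn n) w)) \<longlonglongrightarrow> \<Phi> (compose J Y w)"
    proof (rule AE_I2)
      fix w assume w: "w \<in> space (PiM J (\<lambda>_. \<Omega>))"
      show "(\<lambda>n. \<Phi> (compose J (Yn n) w)) \<longlonglongrightarrow> \<Phi> (compose J Y w)"
      proof (rule cont)
        fix e assume "e \<in> J"
        then have "w e \<in> space \<Omega>" using w by (auto simp: space_PiM)
        then show "(\<lambda>n. compose J (Yn n) w e) \<longlonglongrightarrow> compose J Y w e"
          using lim \<open>e \<in> J\<close> by (simp add: compose_eq)
      qed
    qed
  qed (auto intro!: mc B)
  then show ?thesis unfolding eq[OF Yn, symmetric] eq[OF Y, symmetric] dYn dY .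
qed

lemma cube_avg_disjoint_Un:
  assumes "finite A" "finite B" "A \<inter> B = {}"
  shows "cube_avg (A \<union> B) f = cube_avg B (\<lambda>b. cube_avg A (\<lambda>a. f (a \<union> b)))"
proof -
  have "(\<Sum>C\<in>Pow (A \<union> B). f C) = (\<Sum>(b, a)\<in>Pow B \<times> Pow A. f (a \<union> b))"
    by (rule sum.reindex_bij_witness[of _ "\<lambda>(b, a). a \<union> b" "\<lambda>C. (C \<inter> B, C \<inter> A)"])
      (use assms(3) in \<open>auto intro!: arg_cong[where f = f]\<close>)
  also have "\<dots> = (\<Sum>b\<in>Pow B. \<Sum>a\<in>Pow A. f (a \<union> b))" by (rule sum.cartesian_product[symmetric])
  finally show ?thesis using assms
    by (simp add: cube_avg_def card_Un_disjoint power_add sum_divide_distrib mult.commute)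
qed

text \<open>By induction on \<open>J\<close>: a new coordinate brings its own block of \<open>n\<close> signs.\<close>

lemma cube_avg_PiM_sign_law:
  fixes \<Phi> :: "('e \<Rightarrow> real) \<Rightarrow> real"
  assumes J: "finite J" and "\<Phi> \<in> borel_measurable (PiM J (\<lambda>_. borel))" and "\<And>y. \<bar>\<Phi> y\<bar> \<le> B"
  shows "(\<integral>y. \<Phi> y \<partial>PiM J (\<lambda>_. sign_law n))
    = cube_avg (J \<times> {..<n}) (\<lambda>A. \<Phi> (\<lambda>e\<in>J. sign_sum n {i. i < n \<and> (e, i) \<in> A}))"
  using assms
proof (induction J arbitrary: \<Phi>)
  case empty
  interpret product_sigma_finite "\<lambda>_. sign_law n"
    by (intro product_sigma_finite.intro prob_space_imp_sigma_finite real_distribution.axioms(1) real_distribution_sign_law)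
  show ?case by (simp add: PiM_empty lebesgue_integral_count_space_finite restrict_def)
next
  case (insert e J)
  have ps: "prob_space (sign_law n)" using real_distribution_sign_law by (rule real_distribution.axioms(1))
  interpret product_sigma_finite "\<lambda>_. sign_law n"
    by (intro product_sigma_finite.intro prob_space_imp_sigma_finite ps)
  interpret PJ: prob_space "PiM (insert e J) (\<lambda>_. sign_law n)" by (intro prob_space_PiM ps)
  have sb: "sets (sign_law n) = sets borel" by (simp add: sign_law_def)
  have sbJ: "sets (PiM K (\<lambda>_. sign_law n)) = sets (PiM K (\<lambda>_. borel))" for K :: "'e set"
    by (intro sets_PiM_cong) (auto simp: sb)
  note [measurable] = insert.prems(1)
  define \<Phi>' where "\<Phi>' x = cube_avg ({e} \<times> {..<n}) (\<lambda>a. \<Phi> (x(e := sign_sum n {i. (e, i) \<in> a})))" for x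
  have up [measurable]: "(\<lambda>x. x(e := c)) \<in> measurable (PiM J (\<lambda>_. borel)) (PiM (insert e J) (\<lambda>_. borel))" for c :: real
    by (intro measurable_fun_upd[where J = J]) auto
  have m': "\<Phi>' \<in> borel_measurable (PiM J (\<lambda>_. borel))"
    unfolding \<Phi>'_def cube_avg_def by measurable
  have b': "\<bar>\<Phi>' x\<bar> \<le> B" for x
  proof -
    have "\<bar>\<Phi>' x\<bar> \<le> cube_avg ({e} \<times> {..<n}) (\<lambda>a. \<bar>\<Phi> (x(e := sign_sum n {i. (e, i) \<in> a}))\<bar>)"
      unfolding \<Phi>'_def by (rule cube_avg_abs)
    also have "\<dots> \<le> cube_avg ({e} \<times> {..<n}) (\<lambda>a. B)" by (intro cube_avg_mono insert.prems(2))
    finally show ?thesis by simp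
  qed
  have inner: "(\<integral>y. \<Phi> (x(e := y)) \<partial>sign_law n) = \<Phi>' x" if x: "x \<in> space (PiM J (\<lambda>_. sign_law n))" for x
  proof -
    have "x \<in> space (PiM J (\<lambda>_. borel))" using x sets_eq_imp_space_eq[OF sbJ] by blast
    then have "(\<lambda>y. x(e := y)) \<in> measurable borel (PiM (insert e J) (\<lambda>_. borel))"
      by (intro measurable_component_update insert.hyps)
    then have "(\<lambda>y. \<Phi> (x(e := y))) \<in> borel_measurable borel"
      using insert.prems(1) by (rule measurable_compose)
    then have "(\<integral>y. \<Phi> (x(e := y)) \<partial>sign_law n) = (\<Sum>a\<in>Pow {..<n}. \<Phi> (x(e := sign_sum n a))) / 2 ^ n"
      by (subst integral_sign_law) (auto simp: divide_inverse)
    also have "(\<Sum>a\<in>Pow {..<n}. \<Phi> (x(e := sign_sum n a)))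
        = (\<Sum>a\<in>Pow ({e} \<times> {..<n}). \<Phi> (x(e := sign_sum n {i. (e, i) \<in> a})))"
      by (rule sum.reindex_bij_witness[of _ "\<lambda>a. {i. (e, i) \<in> a}" "\<lambda>a. {e} \<times> a"])
        (auto intro!: arg_cong[where f = \<Phi>] arg_cong[where f = "sign_sum n"] ext)
    finally have "(\<integral>y. \<Phi> (x(e := y)) \<partial>sign_law n)
        = (\<Sum>a\<in>Pow ({e} \<times> {..<n}). \<Phi> (x(e := sign_sum n {i. (e, i) \<in> a}))) / 2 ^ n" .
    moreover have "card ({e} \<times> {..<n}) = n" by simp
    ultimately show ?thesis unfolding \<Phi>'_def cube_avg_def by (simp only:)
  qed
  have "integrable (PiM (insert e J) (\<lambda>_. sign_law n)) \<Phi>"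
  proof (rule PJ.integrable_const_bound[where B = B])
    show "\<Phi> \<in> borel_measurable (PiM (insert e J) (\<lambda>_. sign_law n))"
      by (subst measurable_cong_sets[OF sbJ refl]) (rule insert.prems(1))
  qed (simp add: insert.prems(2))
  then have "(\<integral>y. \<Phi> y \<partial>PiM (insert e J) (\<lambda>_. sign_law n))
      = (\<integral>x. (\<integral>y. \<Phi> (x(e := y)) \<partial>sign_law n) \<partial>PiM J (\<lambda>_. sign_law n))"
    by (intro product_integral_insert insert.hyps)
  also have "\<dots> = (\<integral>x. \<Phi>' x \<partial>PiM J (\<lambda>_. sign_law n))"
    by (intro Bochner_Integration.integral_cong inner) auto
  also have "\<dots> = cube_avg (J \<times> {..<n}) (\<lambda>A. \<Phi>' (\<lambda>e\<in>J. sign_sum n {i. i < n \<and> (e, i) \<in> A}))"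
    by (rule insert.IH[OF m' b'])
  also have "\<dots> = cube_avg (({e} \<times> {..<n}) \<union> (J \<times> {..<n}))
      (\<lambda>A. \<Phi> (\<lambda>e\<in>insert e J. sign_sum n {i. i < n \<and> (e, i) \<in> A}))"
  proof (subst cube_avg_disjoint_Un)
    show "cube_avg (J \<times> {..<n}) (\<lambda>A. \<Phi>' (\<lambda>e\<in>J. sign_sum n {i. i < n \<and> (e, i) \<in> A}))
      = cube_avg (J \<times> {..<n}) (\<lambda>b. cube_avg ({e} \<times> {..<n})
          (\<lambda>a. \<Phi> (\<lambda>e\<in>insert e J. sign_sum n {i. i < n \<and> (e, i) \<in> a \<union> b})))"
      unfolding \<Phi>'_def
    proof (intro cube_avg_cong arg_cong[where f = \<Phi>] ext)
      fix b a e' assume b: "b \<subseteq> J \<times> {..<n}" and a: "a \<subseteq> {e} \<times> {..<n}"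
      show "((\<lambda>e\<in>J. sign_sum n {i. i < n \<and> (e, i) \<in> b})(e := sign_sum n {i. (e, i) \<in> a})) e'
         = (\<lambda>e\<in>insert e J. sign_sum n {i. i < n \<and> (e, i) \<in> a \<union> b}) e'"
      proof (cases "e' = e")
        case True
        have "{i. (e, i) \<in> a} = {i. i < n \<and> (e, i) \<in> a \<union> b}" using a b insert.hyps by auto
        then show ?thesis using True by simp
      next
        case False
        then have "{i. i < n \<and> (e', i) \<in> b} = {i. i < n \<and> (e', i) \<in> a \<union> b}" using a by auto
        then show ?thesis using False by (simp add: restrict_def)
      qed
    qed
  qed (use insert.hyps in auto)
  also have "({e} \<times> {..<n}) \<union> (J \<times> {..<n}) = insert e J \<times> {..<n}" by auto
  finally show ?case .
qed

text \<open>Both the restriction to \<open>J\<close> and the map \<open>q\<close> act coordinatewise, so they commute with taking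
  products.\<close>

lemma integral_PiM_distr_restrict:
  fixes \<Phi> :: "('e \<Rightarrow> real) \<Rightarrow> real"
  assumes J: "finite J" "J \<subseteq> E" and \<kappa>: "real_distribution \<kappa>"
    and q: "q \<in> borel_measurable borel" "\<And>y. 0 \<le> q y"
    and m [measurable]: "\<Phi> \<in> borel_measurable (PiM J (\<lambda>_. restrict_space borel {0..}))"
  shows "(\<integral>x. \<Phi> (restrict x J) \<partial>PiM E (\<lambda>_. distr \<kappa> (restrict_space borel {0..}) q))
    = (\<integral>y. \<Phi> (\<lambda>e\<in>J. q (y e)) \<partial>PiM J (\<lambda>_. \<kappa>))"
proof -
  interpret K: real_distribution \<kappa> by fact
  let ?R = "restrict_space borel {0..} :: real measure"
  let ?\<nu> = "distr \<kappa> ?R q"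
  have q1: "q \<in> measurable \<kappa> ?R"
    by (rule measurable_restrict_space2) (use q in auto)
  have pn: "prob_space ?\<nu>" by (rule K.prob_space_distr[OF q1])
  interpret product_prob_space "\<lambda>_. ?\<nu>" E
    by (intro product_prob_spaceI pn)
  have sR: "sets (PiM J (\<lambda>_. ?\<nu>)) = sets (PiM J (\<lambda>_. ?R))" by (intro sets_PiM_cong) auto
  have m1: "\<Phi> \<in> borel_measurable (PiM J (\<lambda>_. ?\<nu>))" by (subst measurable_cong_sets[OF sR refl]) (rule m)
  have "(\<integral>x. \<Phi> (restrict x J) \<partial>PiM E (\<lambda>_. ?\<nu>))
      = (\<integral>x. \<Phi> x \<partial>distr (PiM E (\<lambda>_. ?\<nu>)) (PiM J (\<lambda>_. ?\<nu>)) (\<lambda>x. restrict x J))"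
    using J m1 by (subst integral_distr) (auto intro!: measurable_restrict_subset)
  also have "\<dots> = (\<integral>x. \<Phi> x \<partial>PiM J (\<lambda>_. ?\<nu>))"
    using distr_PiM_restrict_finite[OF J] by simp
  also have "PiM J (\<lambda>_. ?\<nu>) = distr (PiM J (\<lambda>_. \<kappa>)) (PiM J (\<lambda>_. ?\<nu>)) (compose J q)"
  proof -
    have q2: "q \<in> measurable \<kappa> ?\<nu>" using q1 by simp
    have "distr (PiM J (\<lambda>_. \<kappa>)) (PiM J (\<lambda>_. ?\<nu>)) (compose J q) = PiM J (\<lambda>_. distr \<kappa> ?\<nu> q)"
      by (rule distr_PiM_finite_prob_space') (auto intro: J pn K.prob_space_axioms q1)
    moreover have "distr \<kappa> ?\<nu> q = ?\<nu>" by (intro distr_cong) auto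
    ultimately show ?thesis by simp
  qed
  also have "(\<integral>x. \<Phi> x \<partial>distr (PiM J (\<lambda>_. \<kappa>)) (PiM J (\<lambda>_. ?\<nu>)) (compose J q)) = (\<integral>y. \<Phi> (compose J q y) \<partial>PiM J (\<lambda>_. \<kappa>))"
  proof (subst integral_distr)
    have q2 [measurable]: "q \<in> measurable \<kappa> ?\<nu>" using q1 by simp
    show "compose J q \<in> measurable (PiM J (\<lambda>_. \<kappa>)) (PiM J (\<lambda>_. ?\<nu>))"
      unfolding compose_def
    proof (rule measurable_restrict)
      fix i assume "i \<in> J"
      then have "(\<lambda>y. y i) \<in> measurable (PiM J (\<lambda>_. \<kappa>)) \<kappa>" by (rule measurable_component_singleton)
      then show "(\<lambda>y. q (y i)) \<in> measurable (PiM J (\<lambda>_. \<kappa>)) ?\<nu>" using q2 by (rule measurable_compose)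
    qed
  qed (use m1 in auto)
  finally show ?thesis unfolding compose_def .
qed

section \<open>Lattice paths\<close>

fun list_weight :: "('v set \<Rightarrow> real) \<Rightarrow> 'v list \<Rightarrow> real" where
  "list_weight x (a # b # p) = x {a, b} + list_weight x (b # p)"
| "list_weight x [a] = 0"
| "list_weight x [] = 0"

lemma path_edges_simps [simp]:
  "path_edges [] = {}" "path_edges [a] = {}"
  "path_edges (a # b # p) = insert {a, b} (path_edges (b # p))"
proof -
  show "path_edges [] = {}" "path_edges [a] = {}" by (auto simp: path_edges_def)
  show "path_edges (a # b # p) = insert {a, b} (path_edges (b # p))"
  proof (rule set_eqI)
    fix e
    show "e \<in> path_edges (a # b # p) \<longleftrightarrow> e \<in> insert {a, b} (path_edges (b # p))"
    proof
      assume "e \<in> path_edges (a # b # p)"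
      then obtain i where i: "Suc i < length (a # b # p)" "e = {(a # b # p) ! i, (a # b # p) ! Suc i}"
        unfolding path_edges_def by blast
      show "e \<in> insert {a, b} (path_edges (b # p))"
      proof (cases i)
        case 0
        then show ?thesis using i by simp
      next
        case (Suc k)
        then have "Suc k < length (b # p)" "e = {(b # p) ! k, (b # p) ! Suc k}" using i by simp_all
        then have "e \<in> path_edges (b # p)" unfolding path_edges_def by (intro CollectI exI[of _ k] conjI)
        then show ?thesis by simp
      qed
    next
      assume "e \<in> insert {a, b} (path_edges (b # p))"
      then consider "e = {a, b}" | i where "Suc i < length (b # p)" "e = {(b # p) ! i, (b # p) ! Suc i}"
        unfolding path_edges_def by blast
      then show "e \<in> path_edges (a # b # p)"
      proof cases
        case 1
        then show ?thesis unfolding path_edges_def by (intro CollectI exI[of _ 0]) simp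
      next
        case 2
        then show ?thesis unfolding path_edges_def by (intro CollectI exI[of _ "Suc i"]) simp
      qed
    qed
  qed
qed

lemma finite_path_edges [simp]: "finite (path_edges p)"
  by (induction p rule: induct_list012) auto

lemma path_edges_subset_set: "e \<in> path_edges p \<Longrightarrow> e \<subseteq> set p"
  by (induction p rule: induct_list012) auto

lemma path_edges_lattice: "successively lattice_adj p \<Longrightarrow> path_edges p \<subseteq> lattice_edges"
  by (induction p rule: induct_list012) (auto simp: lattice_edges_def)

lemma sum_path_edges_le_list_weight:
  assumes "\<And>e. e \<in> path_edges p \<Longrightarrow> 0 \<le> x e"
  shows "sum x (path_edges p) \<le> list_weight x p"
  using assms
proof (induction p rule: induct_list012)
  case (3 a b p)
  have "sum x (path_edges (a # b # p)) \<le> x {a, b} + sum x (path_edges (b # p))"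
    using 3(3)[of "{a, b}"] by (simp add: sum.insert_if)
  then show ?case using 3 by auto
qed auto

lemma distinct_path_edges:
  assumes "distinct p"
  shows "sum x (path_edges p) = list_weight x p" "card (path_edges p) = length p - 1"
proof -
  have "sum x (path_edges p) = list_weight x p \<and> card (path_edges p) = length p - 1"
    using assms
  proof (induction p rule: induct_list012)
    case (3 a b p)
    have "{a, b} \<notin> path_edges (b # p)" using path_edges_subset_set[of "{a, b}" "b # p"] 3(3) by auto
    then show ?case using 3 by simp
  qed auto
  then show "sum x (path_edges p) = list_weight x p" "card (path_edges p) = length p - 1" by auto
qed

lemma path_edges_append: "path_edges (p @ u # q) = path_edges (p @ [u]) \<union> path_edges (u # q)"
  by (induction p rule: induct_list012) auto

lemma list_weight_append: "list_weight x (p @ u # q) = list_weight x (p @ [u]) + list_weight x (u # q)"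
  by (induction p rule: induct_list012) auto

lemma successively_split: "successively P (p @ u # q) \<longleftrightarrow> successively P (p @ [u]) \<and> successively P (u # q)"
  by (induction p rule: induct_list012) auto

text \<open>The part of a path between two visits to the same vertex can be cut out, which creates no new
  edges.\<close>

lemma lattice_path_distinct:
  assumes "lattice_path u p v"
  obtains p' where "lattice_path u p' v" "distinct p'" "length p' \<le> length p" "path_edges p' \<subseteq> path_edges p"
proof -
  have "\<exists>p'. lattice_path u p' v \<and> distinct p' \<and> length p' \<le> length p \<and> path_edges p' \<subseteq> path_edges p"
    using assms
  proof (induction "length p" arbitrary: p rule: less_induct)
    case less
    show ?case
    proof (cases "distinct p")
      case False
      then obtain xs ys zs y where p: "p = xs @ [y] @ ys @ [y] @ zs" using not_distinct_decomp by blast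
      define p1 where "p1 = xs @ y # zs"
      have p': "p = xs @ y # (ys @ y # zs)" using p by simp
      have "successively lattice_adj (xs @ [y])" "successively lattice_adj (y # ys @ y # zs)"
        using less.prems successively_split[of lattice_adj xs y "ys @ y # zs"] unfolding lattice_path_def p' by blast+
      moreover have "y # ys @ y # zs = (y # ys) @ y # zs" by simp
      ultimately have "successively lattice_adj (y # zs)" "successively lattice_adj (xs @ [y])"
        using successively_split[of lattice_adj "y # ys" y zs] by metis+
      then have "successively lattice_adj p1" unfolding p1_def using successively_split[of lattice_adj xs y zs] by blast
      moreover have "hd p1 = u" "last p1 = v" "p1 \<noteq> []"
        using less.prems unfolding lattice_path_def p p1_def by (cases xs; auto)+
      ultimately have l1: "lattice_path u p1 v" unfolding lattice_path_def by simp
      have "length p1 < length p" by (simp add: p p1_def)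
      then obtain p2 where p2: "lattice_path u p2 v" "distinct p2" "length p2 \<le> length p1" "path_edges p2 \<subseteq> path_edges p1"
        using less.hyps[OF _ l1] by metis
      have "path_edges p1 \<subseteq> path_edges p"
      proof -
        have "path_edges p = path_edges (xs @ [y]) \<union> path_edges ((y # ys) @ y # zs)"
          unfolding p' by (subst path_edges_append) simp
        also have "\<dots> = path_edges (xs @ [y]) \<union> (path_edges ((y # ys) @ [y]) \<union> path_edges (y # zs))"
          by (subst (2) path_edges_append) simp
        finally show ?thesis unfolding p1_def by (subst path_edges_append) auto
      qed
      then show ?thesis using p2 \<open>length p1 < length p\<close> by (intro exI[of _ p2]) auto
    qed (use less.prems in \<open>intro exI[of _ p], simp\<close>)
  qed
  then show ?thesis using that by blast
qed

subsection \<open>Finitely many paths\<close>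

lemma l1_norm_nonneg: "0 \<le> l1_norm v"
  unfolding l1_norm_def by (intro sum_nonneg) auto

lemma l1_norm_minus: "l1_norm (u - w) = l1_norm (w - u)"
  unfolding l1_norm_def by (intro sum.cong) auto

lemma abs_component_le_l1_norm: "\<bar>v $ i\<bar> \<le> l1_norm v"
  unfolding l1_norm_def by (rule member_le_sum) auto

lemma finite_bounded_vectors: "finite {v :: int ^ 'd::finite. \<forall>i. v $ i \<in> S}" if "finite S" for S
proof -
  have "finite (UNIV \<rightarrow>\<^sub>E S :: ('d \<Rightarrow> int) set)" using that by (intro finite_PiE) auto
  moreover have "{v :: int ^ 'd. \<forall>i. v $ i \<in> S} \<subseteq> vec_lambda ` (UNIV \<rightarrow>\<^sub>E S)"
  proof
    fix v :: "int ^ 'd" assume "v \<in> {v. \<forall>i. v $ i \<in> S}"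
    then have "(\<lambda>i. v $ i) \<in> UNIV \<rightarrow>\<^sub>E S" "v = vec_lambda (\<lambda>i. v $ i)" by (auto simp: vec_eq_iff)
    then show "v \<in> vec_lambda ` (UNIV \<rightarrow>\<^sub>E S)" by blast
  qed
  ultimately show ?thesis by (meson finite_imageI finite_subset)
qed

definition lattice_degree :: "'d::finite itself \<Rightarrow> nat" where
  "lattice_degree _ = card {w :: int ^ 'd. lattice_adj 0 w}"

lemma neighbours_translate: "{w. lattice_adj u w} = (+) u ` {w. lattice_adj 0 w}"
proof -
  have "lattice_adj u w \<longleftrightarrow> lattice_adj 0 (w - u)" for w by (simp add: lattice_adj_def l1_norm_def)
  then have "w \<in> {w. lattice_adj u w} \<longleftrightarrow> w \<in> (+) u ` {w. lattice_adj 0 w}" for w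
    by (metis (mono_tags, lifting) add_diff_cancel_left' diff_add_cancel add.commute image_iff mem_Collect_eq)
  then show ?thesis by blast
qed

lemma finite_neighbours: "finite {w :: int ^ 'd::finite. lattice_adj u w}"
proof -
  have "{w :: int ^ 'd. lattice_adj 0 w} \<subseteq> {v. \<forall>i. v $ i \<in> {-1..1}}"
  proof
    fix w :: "int ^ 'd" assume "w \<in> {w. lattice_adj 0 w}"
    then have "l1_norm w = 1" by (simp add: lattice_adj_def l1_norm_def)
    then have "\<bar>w $ i\<bar> \<le> 1" for i using abs_component_le_l1_norm[of w i] by simp
    then show "w \<in> {v. \<forall>i. v $ i \<in> {-1..1}}" by (auto simp: abs_le_iff minus_le_iff)
  qed
  then have "finite {w :: int ^ 'd. lattice_adj 0 w}"
    using finite_bounded_vectors[of "{-1..1}"] finite_subset by blast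
  then show ?thesis unfolding neighbours_translate[of u] by simp
qed

lemma card_neighbours: "card {w :: int ^ 'd::finite. lattice_adj u w} = lattice_degree TYPE('d)"
  unfolding neighbours_translate[of u] lattice_degree_def by (rule card_image) simp

definition walks :: "nat \<Rightarrow> int ^ 'd \<Rightarrow> (int ^ 'd) list set" where
  "walks j u = {p. length p = Suc j \<and> hd p = u \<and> successively lattice_adj p}"

lemma walks_Suc: "walks (Suc j) u = (\<Union>w\<in>{w. lattice_adj u w}. (#) u ` walks j w)"
proof (intro set_eqI iffI)
  fix p assume "p \<in> walks (Suc j) u"
  then have p: "length p = Suc (Suc j)" "hd p = u" "successively lattice_adj p" by (auto simp: walks_def)
  then obtain w q where "p = u # w # q" by (cases p; cases "tl p") auto
  then show "p \<in> (\<Union>w\<in>{w. lattice_adj u w}. (#) u ` walks j w)"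
    using p by (auto simp: walks_def)
next
  fix p assume "p \<in> (\<Union>w\<in>{w. lattice_adj u w}. (#) u ` walks j w)"
  then obtain w q where q: "lattice_adj u w" "q \<in> walks j w" "p = u # q" by blast
  then obtain q' where "q = w # q'" by (cases q) (auto simp: walks_def)
  then show "p \<in> walks (Suc j) u" using q by (auto simp: walks_def)
qed

lemma walks_0: "walks 0 u = {[u]}"
  by (auto simp: walks_def length_Suc_conv)

lemma finite_walks: "finite (walks j (u :: int ^ 'd::finite))"
  by (induction j arbitrary: u) (auto simp: walks_0 walks_Suc finite_neighbours)

text \<open>The number of walks grows at most exponentially; this is the entropy term in the union bound
  over simple paths below.\<close>

lemma card_walks: "card (walks j (u :: int ^ 'd::finite)) \<le> lattice_degree TYPE('d) ^ j"
proof (induction j arbitrary: u)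
  case (Suc j)
  have "card (walks (Suc j) u) \<le> (\<Sum>w\<in>{w. lattice_adj u w}. card ((#) u ` walks j w))"
    unfolding walks_Suc by (rule card_UN_le[OF finite_neighbours])
  also have "\<dots> \<le> (\<Sum>w\<in>{w. lattice_adj u w}. lattice_degree TYPE('d) ^ j)"
    by (intro sum_mono order_trans[OF card_image_le[OF finite_walks] Suc.IH])
  finally show ?case by (simp add: card_neighbours)
qed (simp add: walks_0)

definition simple_paths :: "nat \<Rightarrow> int ^ 'd \<Rightarrow> (int ^ 'd) list set" where
  "simple_paths k v = {p. lattice_path 0 p v \<and> distinct p \<and> length p \<le> k}"

lemma finite_simple_paths: "finite (simple_paths k (v :: int ^ 'd::finite))"
proof (rule finite_subset)
  show "simple_paths k v \<subseteq> (\<Union>j\<in>{..k}. walks j 0)"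
  proof
    fix p assume p: "p \<in> simple_paths k v"
    then have "length p = Suc (length p - 1)" by (cases p) (auto simp: simple_paths_def lattice_path_def)
    then have "p \<in> walks (length p - 1) 0" using p by (auto simp: simple_paths_def lattice_path_def walks_def)
    then show "p \<in> (\<Union>j\<in>{..k}. walks j 0)" using p by (auto simp: simple_paths_def)
  qed
qed (simp add: finite_walks)

text \<open>A shortest path: each step lowers one coordinate difference in absolute value.\<close>

lemma short_lattice_path:
  fixes u w :: "int ^ 'd::finite"
  obtains p where "lattice_path u p w" "distinct p" "int (length p) \<le> l1_norm (u - w) + 1"
proof -
  have "\<exists>p. lattice_path u p w \<and> int (length p) \<le> l1_norm (u - w) + 1"
  proof (induction "nat (l1_norm (u - w))" arbitrary: u)
    case 0
    then have "l1_norm (u - w) = 0" using l1_norm_nonneg[of "u - w"] by simp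
    then have "\<bar>(u - w) $ i\<bar> \<le> 0" for i using abs_component_le_l1_norm[of "u - w" i] by simp
    then have "u = w" by (simp add: vec_eq_iff)
    then show ?case using \<open>l1_norm (u - w) = 0\<close> by (intro exI[of _ "[u]"]) (simp add: lattice_path_def)
  next
    case (Suc n)
    then have pos: "l1_norm (u - w) = int n + 1" by simp
    then obtain i where i: "(u - w) $ i \<noteq> 0"
    proof -
      have "\<exists>i. (u - w) $ i \<noteq> 0"
      proof (rule ccontr)
        assume "\<not> ?thesis"
        then have "l1_norm (u - w) = 0" unfolding l1_norm_def by (intro sum.neutral) simp
        then show False using pos by simp
      qed
      then show ?thesis using that by blast
    qed
    define c where "c = sgn ((w - u) $ i)"
    define u' where "u' = u + (\<chi> j. if j = i then c else 0)"
    have n1: "l1_norm (u - u') = 1"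
    proof -
      have "l1_norm (u - u') = (\<Sum>j\<in>UNIV. if j = i then \<bar>c\<bar> else 0)"
        unfolding l1_norm_def u'_def by (intro sum.cong) auto
      also have "\<dots> = 1" using i by (simp add: c_def sgn_if)
      finally show ?thesis .
    qed
    have n2: "l1_norm (u' - w) = int n"
    proof -
      have "l1_norm (u' - w) = (\<Sum>j\<in>UNIV. \<bar>(u - w) $ j\<bar> - (if j = i then 1 else 0))"
        unfolding l1_norm_def u'_def c_def using i by (intro sum.cong) (auto simp: sgn_if)
      also have "\<dots> = l1_norm (u - w) - 1" unfolding l1_norm_def by (simp add: sum_subtractf)
      finally show ?thesis using pos by simp
    qed
    then obtain p where p: "lattice_path u' p w" "int (length p) \<le> int n + 1"
      using Suc.hyps(1)[of u'] by auto
    then have "lattice_path u (u # p) w"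
      using n1 by (cases p) (auto simp: lattice_path_def lattice_adj_def)
    then show ?case using p pos by (intro exI[of _ "u # p"]) simp
  qed
  then obtain p where p: "lattice_path u p w" "int (length p) \<le> l1_norm (u - w) + 1" by blast
  obtain p' where "lattice_path u p' w" "distinct p'" "length p' \<le> length p"
    by (rule lattice_path_distinct[OF p(1)]) (rule that)
  then show ?thesis using that p(2) by force
qed

definition short_path :: "int ^ 'd::finite \<Rightarrow> int ^ 'd \<Rightarrow> (int ^ 'd) list" where
  "short_path u w = (SOME p. lattice_path u p w \<and> distinct p \<and> int (length p) \<le> l1_norm (u - w) + 1)"

lemma short_path:
  shows "lattice_path u (short_path u w) w" "distinct (short_path u w)"
    "int (length (short_path u w)) \<le> l1_norm (u - w) + 1"
proof -
  have "\<exists>p. lattice_path u p w \<and> distinct p \<and> int (length p) \<le> l1_norm (u - w) + 1"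
    using short_lattice_path[of u w] by blast
  from someI_ex[OF this] show "lattice_path u (short_path u w) w" "distinct (short_path u w)"
    "int (length (short_path u w)) \<le> l1_norm (u - w) + 1"
    unfolding short_path_def by blast+
qed

subsection \<open>Passage times\<close>

lemma lattice_path_edges: "lattice_path u p v \<Longrightarrow> path_edges p \<subseteq> lattice_edges"
  unfolding lattice_path_def using path_edges_lattice by blast

lemma sum_path_edges_nonneg:
  fixes x :: "(int ^ 'd) set \<Rightarrow> real"
  assumes x: "\<forall>e\<in>lattice_edges. 0 \<le> x e" and p: "lattice_path u p v"
  shows "0 \<le> sum x (path_edges p)"
  using lattice_path_edges[OF p] x by (intro sum_nonneg) auto

lemma passage_time_le_sum:
  assumes x: "\<forall>e\<in>lattice_edges. 0 \<le> x e" and p: "lattice_path u p v"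
  shows "passage_time x u v \<le> sum x (path_edges p)"
  unfolding passage_time_def
proof (rule cINF_lower)
  show "bdd_below ((\<lambda>p. sum x (path_edges p)) ` {p. lattice_path u p v})"
    using sum_path_edges_nonneg[OF x] by (intro bdd_belowI[of _ 0]) auto
qed (use p in simp)

lemma passage_time_le:
  assumes x: "\<forall>e\<in>lattice_edges. 0 \<le> x e" and p: "lattice_path u p v"
  shows "passage_time x u v \<le> list_weight x p"
proof -
  have "0 \<le> x e" if "e \<in> path_edges p" for e using that x lattice_path_edges[OF p] by blast
  then show ?thesis
    using passage_time_le_sum[OF x p] sum_path_edges_le_list_weight[of p x] by fastforce
qed

lemma passage_time_nonneg:
  assumes x: "\<forall>e\<in>lattice_edges. 0 \<le> x e"
  shows "0 \<le> passage_time x (u :: int ^ 'd::finite) v"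
  unfolding passage_time_def
  by (rule cINF_greatest) (use short_path(1)[of u v] sum_path_edges_nonneg[OF x] in auto)

lemma passage_time_approx:
  fixes u v :: "int ^ 'd::finite"
  assumes x: "\<forall>e\<in>lattice_edges. 0 \<le> x e" and c: "passage_time x u v < c"
  obtains p where "lattice_path u p v" "distinct p" "list_weight x p < c"
proof -
  have "\<exists>p\<in>{p. lattice_path u p v}. sum x (path_edges p) < c"
  proof (rule ccontr)
    assume "\<not> ?thesis"
    then have "c \<le> passage_time x u v"
      unfolding passage_time_def using short_path(1)[of u v] by (intro cINF_greatest) auto
    then show False using c by simp
  qed
  then obtain p where p: "lattice_path u p v" "sum x (path_edges p) < c" by blast
  obtain p' where p': "lattice_path u p' v" "distinct p'" "path_edges p' \<subseteq> path_edges p"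
    by (rule lattice_path_distinct[OF p(1)]) (rule that)
  have "sum x (path_edges p') \<le> sum x (path_edges p)"
    using p'(3) lattice_path_edges[OF p(1)] x by (intro sum_mono2) auto
  then show ?thesis using that p p' distinct_path_edges(1)[OF p'(2), of x] by simp
qed

lemma lattice_path_concat:
  assumes "lattice_path u p v" "lattice_path v q w"
  shows "lattice_path u (p @ tl q) w" "list_weight x (p @ tl q) = list_weight x p + list_weight x q"
proof -
  obtain q' where q: "q = v # q'" using assms(2) by (cases q) (auto simp: lattice_path_def)
  obtain p' where p: "p = p' @ [v]" using assms(1) by (cases p rule: rev_cases) (auto simp: lattice_path_def)
  show "lattice_path u (p @ tl q) w"
  proof -
    have "successively lattice_adj (p' @ v # q')"
      using assms successively_split[of lattice_adj p' v q'] unfolding lattice_path_def p q by blast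
    moreover have "hd (p' @ v # q') = u" "last (p' @ v # q') = w"
      using assms unfolding lattice_path_def p q by (cases p'; auto)+
    ultimately show ?thesis unfolding lattice_path_def p q by simp
  qed
  show "list_weight x (p @ tl q) = list_weight x p + list_weight x q"
    unfolding p q using list_weight_append[of x p' v q'] by simp
qed

lemma passage_time_detour:
  fixes u v u' v' :: "int ^ 'd::finite"
  assumes x: "\<forall>e\<in>lattice_edges. 0 \<le> x e"
    and p: "lattice_path u p u'" and q: "lattice_path v' q v"
  shows "passage_time x u v \<le> list_weight x p + passage_time x u' v' + list_weight x q"
proof (rule field_le_epsilon)
  fix \<epsilon> :: real assume "\<epsilon> > 0"
  then obtain r where r: "lattice_path u' r v'" "list_weight x r < passage_time x u' v' + \<epsilon>"
    using passage_time_approx[OF x, of u' v' "passage_time x u' v' + \<epsilon>"] by auto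
  note 1 = lattice_path_concat[OF p r(1)]
  note 2 = lattice_path_concat[OF 1(1) q]
  have "passage_time x u v \<le> list_weight x ((p @ tl r) @ tl q)" by (rule passage_time_le[OF x 2(1)])
  then show "passage_time x u v \<le> list_weight x p + passage_time x u' v' + list_weight x q + \<epsilon>"
    using 1(2)[of x] 2(2)[of x] r(2) by simp
qed

section \<open>Independent edge times\<close>

abbreviation translate :: "int ^ 'd \<Rightarrow> (int ^ 'd) set \<Rightarrow> (int ^ 'd) set" where
  "translate z \<equiv> (`) ((+) z)"

definition shift :: "int ^ 'd \<Rightarrow> ((int ^ 'd) set \<Rightarrow> real) \<Rightarrow> (int ^ 'd) set \<Rightarrow> real" where
  "shift z x e = x (translate z e)"

lemma translate_translate [simp]: "translate z (translate w e) = translate (z + w) e"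
  by (simp add: image_image add.assoc)

lemma translate_0 [simp]: "translate 0 e = e" by simp

lemma inj_translate: "inj (translate z)"
  by (rule injI) (metis translate_0 translate_translate left_minus)

lemma path_edges_map_add: "path_edges (map ((+) z) p) = translate z ` path_edges p"
  by (induction p rule: induct_list012) auto

lemma lattice_adj_add [simp]: "lattice_adj (z + u) (z + w) \<longleftrightarrow> lattice_adj u w"
  by (simp add: lattice_adj_def)

lemma lattice_path_map_add: "lattice_path (z + u) (map ((+) z) p) (z + v)" if "lattice_path u p v"
  using that unfolding lattice_path_def by (auto simp: hd_map last_map successively_map)

lemma translate_lattice_edges: "e \<in> lattice_edges \<Longrightarrow> translate z e \<in> lattice_edges"
  unfolding lattice_edges_def using lattice_adj_add[of z] by (auto simp del: lattice_adj_add)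

lemma shift_nonneg: "\<forall>e\<in>lattice_edges. 0 \<le> x e \<Longrightarrow> \<forall>e\<in>lattice_edges. 0 \<le> shift z x e"
  by (simp add: shift_def translate_lattice_edges)

lemma sum_shift: "sum (shift z x) S = sum x (translate z ` S)"
  unfolding shift_def by (subst sum.reindex) (auto intro: inj_on_subset[OF inj_translate])

lemma passage_time_shift: "passage_time (shift z x) u v = passage_time x (z + u) (z + v)"
proof -
  have 1: "{p. lattice_path (z + u) p (z + v)} = map ((+) z) ` {p. lattice_path u p v}"
  proof (intro set_eqI iffI)
    fix p assume "p \<in> {p. lattice_path (z + u) p (z + v)}"
    then have "lattice_path (- z + (z + u)) (map ((+) (- z)) p) (- z + (z + v))"
      using lattice_path_map_add by blast
    then have "map ((+) (- z)) p \<in> {p. lattice_path u p v}" by simp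
    moreover have "p = map ((+) z) (map ((+) (- z)) p)" by (simp add: comp_def)
    ultimately show "p \<in> map ((+) z) ` {p. lattice_path u p v}" by blast
  qed (use lattice_path_map_add in auto)
  show ?thesis unfolding passage_time_def 1 image_image sum_shift path_edges_map_add ..
qed

text \<open>Bounding the number of vertices by \<open>k\<close> makes the family finite, and defining it by translation
  of the paths from \<open>0\<close> to \<open>v\<close> preserves the symmetry under translations, which a restriction to a
  finite part of the lattice would break.\<close>

definition path_family :: "nat \<Rightarrow> int ^ 'd \<Rightarrow> int ^ 'd \<Rightarrow> (int ^ 'd) set set set" where
  "path_family k v z = (\<lambda>p. translate z ` path_edges p) ` simple_paths k v"

lemma path_family_0: "path_family k v 0 = path_edges ` simple_paths k v"
  unfolding path_family_def by simp

lemma finite_path_family: "finite (path_family k (v :: int ^ 'd::finite) z)"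
  unfolding path_family_def by (simp add: finite_simple_paths)

lemma path_family_edges:
  assumes "S \<in> path_family k v z"
  shows "finite S" "S \<subseteq> lattice_edges"
proof -
  obtain p where p: "p \<in> simple_paths k v" "S = translate z ` path_edges p"
    using assms unfolding path_family_def by blast
  show "finite S" using p by simp
  show "S \<subseteq> lattice_edges"
    using p translate_lattice_edges lattice_path_edges[of 0 p v] unfolding simple_paths_def by auto
qed

lemma min_weight_path_family: "min_weight (path_family k v z) x = min_weight (path_family k v 0) (shift z x)"
  unfolding min_weight_def path_family_def image_image sum_shift by simp

lemma pivotal_path_family:
  "e \<in> pivotal M (path_family k v z) x \<longleftrightarrow> translate (- z) e \<in> pivotal M (path_family k v 0) (shift z x)"
proof -
  have "e \<in> translate z ` S \<longleftrightarrow> translate (- z) e \<in> S" for S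
    by (metis (no_types, lifting) image_iff left_minus right_minus translate_0 translate_translate)
  then show ?thesis
    unfolding pivotal_def min_weight_path_family[of k v z] unfolding path_family_def
    by (simp add: sum_shift)
qed

lemma borel_measurable_min_weight:
  assumes "finite \<S>" "\<And>S. S \<in> \<S> \<Longrightarrow> (\<lambda>x. sum x S) \<in> borel_measurable N"
  shows "(\<lambda>x. min_weight \<S> x) \<in> borel_measurable N"
  unfolding min_weight_def using assms by (rule borel_measurable_Min)

lemma sets_pivotal:
  assumes \<S>: "finite \<S>" "\<And>S. S \<in> \<S> \<Longrightarrow> (\<lambda>x. sum x S) \<in> borel_measurable N"
  shows "{x \<in> space N. e \<in> pivotal M \<S> x} \<in> sets N"
proof -
  have [measurable]: "(\<lambda>x. min_weight \<S> x) \<in> borel_measurable N"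
    by (rule borel_measurable_min_weight[OF \<S>])
  have "{x \<in> space N. sum x S = min_weight \<S> x} \<in> sets N" if "S \<in> \<S>" for S
  proof -
    have [measurable]: "(\<lambda>x. sum x S) \<in> borel_measurable N" using that by (rule \<S>(2))
    show ?thesis by measurable
  qed
  then have "{x \<in> space N. \<forall>S\<in>\<S>. sum x S = min_weight \<S> x \<longrightarrow> e \<in> S} \<in> sets N"
    by (intro sets.sets_Collect_finite_All sets.sets_Collect_imp \<S>(1)) auto
  moreover have "{x \<in> space N. min_weight \<S> x < M} \<in> sets N" by measurable
  ultimately have "{x \<in> space N. \<forall>S\<in>\<S>. sum x S = min_weight \<S> x \<longrightarrow> e \<in> S}
      \<inter> {x \<in> space N. min_weight \<S> x < M} \<in> sets N" by (rule sets.Int)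
  moreover have "{x \<in> space N. e \<in> pivotal M \<S> x}
    = {x \<in> space N. \<forall>S\<in>\<S>. sum x S = min_weight \<S> x \<longrightarrow> e \<in> S} \<inter> {x \<in> space N. min_weight \<S> x < M}"
    unfolding pivotal_def by auto
  ultimately show ?thesis by simp
qed

lemma borel_measurable_pivotal_freq:
  assumes \<S>: "\<And>z. z \<in> Z \<Longrightarrow> finite (\<S> z)"
    "\<And>z S. z \<in> Z \<Longrightarrow> S \<in> \<S> z \<Longrightarrow> (\<lambda>x. sum x S) \<in> borel_measurable N"
  shows "(\<lambda>x. pivotal_freq M Z \<S> x e) \<in> borel_measurable N"
  unfolding pivotal_freq_def
proof (intro borel_measurable_divide borel_measurable_sum borel_measurable_const)
  fix z assume z: "z \<in> Z"
  have "(\<lambda>x. indicator {x \<in> space N. e \<in> pivotal M (\<S> z) x} x :: real) \<in> borel_measurable N"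
    using sets_pivotal[of "\<S> z" N e M] \<S> z by simp
  then show "(\<lambda>x. of_bool (e \<in> pivotal M (\<S> z) x) :: real) \<in> borel_measurable N"
    by (rule measurable_cong[THEN iffD1, rotated]) (simp add: indicator_def)
qed

lemma borel_measurable_avg_trunc_weight:
  assumes \<S>: "\<And>z. z \<in> Z \<Longrightarrow> finite (\<S> z)"
    "\<And>z S. z \<in> Z \<Longrightarrow> S \<in> \<S> z \<Longrightarrow> (\<lambda>x. sum x S) \<in> borel_measurable N"
  shows "(\<lambda>x. avg_trunc_weight M Z \<S> x) \<in> borel_measurable N"
  unfolding avg_trunc_weight_def trunc_min_weight_def
proof (intro borel_measurable_divide borel_measurable_sum borel_measurable_const)
  fix z assume z: "z \<in> Z"
  show "(\<lambda>x. min M (min_weight (\<S> z) x)) \<in> borel_measurable N"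
    by (intro borel_measurable_min borel_measurable_const borel_measurable_min_weight) (use \<S> z in auto)
qed

locale edge_times =
  fixes \<nu> :: "real measure" and \<mu> :: "((int ^ 'd::finite) set \<Rightarrow> real) measure"
  assumes prob_nu: "prob_space \<nu>"
    and sets_nu: "sets \<nu> = sets (restrict_space borel {0..})"
    and mu: "\<mu> = PiM lattice_edges (\<lambda>_. \<nu>)"
begin

sublocale PP: product_prob_space "\<lambda>_. \<nu>" "lattice_edges :: (int ^ 'd) set set"
  by (intro product_prob_spaceI prob_nu)

sublocale prob_space \<mu>
  unfolding mu by (rule PP.prob_space_axioms)

lemma space_nu: "space \<nu> = {0..}"
  using sets_eq_imp_space_eq[OF sets_nu] by simp

lemma nonneg: "x \<in> space \<mu> \<Longrightarrow> \<forall>e\<in>lattice_edges. 0 \<le> x e"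
  unfolding mu space_PiM using space_nu by (auto simp: PiE_def Pi_def)

lemma measurable_nu: "f \<in> borel_measurable borel \<Longrightarrow> f \<in> borel_measurable \<nu>"
  unfolding measurable_cong_sets[OF sets_nu refl] by (rule measurable_restrict_space1)

lemma measurable_component: "e \<in> lattice_edges \<Longrightarrow> (\<lambda>x. x e) \<in> borel_measurable \<mu>"
  unfolding mu
  by (rule measurable_compose[OF measurable_component_singleton[where M = "\<lambda>_. \<nu>"]], assumption)
    (simp add: measurable_nu)

lemma measurable_sum_edges: "S \<subseteq> lattice_edges \<Longrightarrow> (\<lambda>x. sum x S) \<in> borel_measurable \<mu>"
  by (intro borel_measurable_sum measurable_component) auto

lemma measurable_list_weight:
  assumes "successively lattice_adj p"
  shows "(\<lambda>x. list_weight x p) \<in> borel_measurable \<mu>"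
  using assms
proof (induction p rule: induct_list012)
  case (3 a b p)
  then have "{a, b} \<in> lattice_edges" by (auto simp: lattice_edges_def)
  then show ?case using 3 by (auto intro!: borel_measurable_add measurable_component)
qed auto

lemma measurable_min_weight: "(\<lambda>x. min_weight (path_family k v z) x) \<in> borel_measurable \<mu>"
  by (intro borel_measurable_min_weight finite_path_family measurable_sum_edges path_family_edges)

lemma measurable_pivotal: "{x \<in> space \<mu>. e \<in> pivotal M (path_family k v z) x} \<in> sets \<mu>"
  by (intro sets_pivotal finite_path_family measurable_sum_edges path_family_edges)

text \<open>Points of the product space are \<open>undefined\<close> outside the lattice edges, and \<open>shift\<close> does not
  preserve this; hence the second hypothesis.\<close>

lemma integral_shift:
  fixes \<Phi> :: "((int ^ 'd) set \<Rightarrow> real) \<Rightarrow> real"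
  assumes m: "\<Phi> \<in> borel_measurable \<mu>" and d: "\<And>x. \<Phi> (restrict x lattice_edges) = \<Phi> x"
  shows "(\<integral>x. \<Phi> (shift z x) \<partial>\<mu>) = (\<integral>x. \<Phi> x \<partial>\<mu>)"
proof -
  let ?t = "\<lambda>x. \<lambda>e\<in>lattice_edges. x (translate z e)"
  have "distr \<mu> \<mu> ?t = \<mu>"
    unfolding mu using distr_PiM_reindex[of lattice_edges "\<lambda>_. \<nu>" "translate z" lattice_edges]
      inj_translate[of z] translate_lattice_edges[of _ z] prob_nu by (auto intro: inj_on_subset)
  moreover have t: "?t \<in> measurable \<mu> \<mu>"
    unfolding mu by (intro measurable_restrict measurable_component_singleton translate_lattice_edges)
  ultimately have "(\<integral>x. \<Phi> x \<partial>\<mu>) = (\<integral>x. \<Phi> (?t x) \<partial>\<mu>)"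
    using integral_distr[OF t m] by simp
  also have "\<dots> = (\<integral>x. \<Phi> (shift z x) \<partial>\<mu>)"
  proof -
    have "?t x = restrict (shift z x) lattice_edges" for x by (auto simp: shift_def restrict_def)
    then show ?thesis using d by presburger
  qed
  finally show ?thesis ..
qed

text \<open>The edges of a simple path are distinct, so their edge times are independent.\<close>

lemma nn_integral_exp_list_weight:
  assumes p: "successively lattice_adj p" "distinct p"
  shows "(\<integral>\<^sup>+x. ennreal (exp (c * list_weight x p)) \<partial>\<mu>) = (\<integral>\<^sup>+t. ennreal (exp (c * t)) \<partial>\<nu>) ^ (length p - 1)"
proof -
  let ?S = "path_edges p"
  have S: "finite ?S" "?S \<subseteq> lattice_edges" using path_edges_lattice[OF p(1)] by auto
  have mf: "(\<lambda>t. ennreal (exp (c * t))) \<in> borel_measurable \<nu>"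
    by (intro measurable_compose[OF measurable_nu]) measurable
  have mf': "(\<lambda>x. \<Prod>e\<in>?S. ennreal (exp (c * x e))) \<in> borel_measurable (PiM ?S (\<lambda>_. \<nu>))"
    by (intro borel_measurable_prod_ennreal measurable_compose[OF _ mf] measurable_component_singleton)
  have "(\<integral>\<^sup>+x. ennreal (exp (c * list_weight x p)) \<partial>\<mu>) = (\<integral>\<^sup>+x. (\<Prod>e\<in>?S. ennreal (exp (c * restrict x ?S e))) \<partial>\<mu>)"
  proof (intro nn_integral_cong)
    fix x
    have "exp (c * list_weight x p) = (\<Prod>e\<in>?S. exp (c * restrict x ?S e))"
      unfolding distinct_path_edges(1)[OF p(2), symmetric]
      by (simp add: sum_distrib_left exp_sum)
    then show "ennreal (exp (c * list_weight x p)) = (\<Prod>e\<in>?S. ennreal (exp (c * restrict x ?S e)))"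
      by (subst prod_ennreal) auto
  qed
  also have "\<dots> = (\<integral>\<^sup>+x. (\<Prod>e\<in>?S. ennreal (exp (c * x e))) \<partial>distr \<mu> (PiM ?S (\<lambda>_. \<nu>)) (\<lambda>x. restrict x ?S))"
    unfolding mu using S mf' by (subst nn_integral_distr) (auto intro!: measurable_restrict_subset)
  also have "\<dots> = (\<integral>\<^sup>+x. (\<Prod>e\<in>?S. ennreal (exp (c * x e))) \<partial>PiM ?S (\<lambda>_. \<nu>))"
    unfolding mu by (subst PP.distr_PiM_restrict_finite[OF S]) simp
  also have "\<dots> = (\<Prod>e\<in>?S. \<integral>\<^sup>+t. ennreal (exp (c * t)) \<partial>\<nu>)"
    by (rule PP.product_nn_integral_prod) (use mf S in blast)+
  finally show ?thesis using distinct_path_edges(2)[OF p(2)] by simp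
qed

end

section \<open>A minimal path uses few edges of a box\<close>

text \<open>The piece \<open>u # bs @ [w]\<close> of a minimal path between its first and last visit to \<open>\<Lambda>\<close> either has
  at most as many edges as a shortest path from \<open>u\<close> to \<open>w\<close>, or can be replaced by that path, and
  then its weight is at most \<open>D\<close>. In the second case the comparison of lengths with weights, valid
  for all simple paths, bounds its number of edges. The restriction to paths of at most \<open>k\<close> vertices
  survives the replacement because the path is not made longer.\<close>

lemma card_minimal_path_Int_le:
  fixes x :: "(int ^ 'd::finite) set \<Rightarrow> real" and v :: "int ^ 'd"
  assumes x: "\<forall>e\<in>lattice_edges. 0 \<le> x e"
    and p: "p \<in> simple_paths k v" "sum x (path_edges p) = min_weight (path_family k v 0) x"
    and \<Lambda>: "finite \<Lambda>" "\<And>u w. u \<in> \<Lambda> \<Longrightarrow> w \<in> \<Lambda> \<Longrightarrow> l1_norm (u - w) \<le> int r"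
    and Y: "0 \<le> Y" "\<And>j u \<pi>. u \<in> \<Lambda> \<Longrightarrow> j < k \<Longrightarrow> \<pi> \<in> walks j u \<Longrightarrow> distinct \<pi> \<Longrightarrow>
      real j \<le> \<kappa> * list_weight x \<pi> + Y"
    and D: "0 \<le> D" "\<And>u w. u \<in> \<Lambda> \<Longrightarrow> w \<in> \<Lambda> \<Longrightarrow> list_weight x (short_path u w) \<le> D"
    and \<kappa>: "0 \<le> \<kappa>"
  shows "real (card (set p \<inter> \<Lambda>)) \<le> 1 + real r + \<kappa> * D + Y"
proof -
  have base: "0 \<le> \<kappa> * D" using \<kappa> D by simp
  have lp: "lattice_path 0 p v" "distinct p" "length p \<le> k" using p(1) by (auto simp: simple_paths_def)
  show ?thesis
  proof (cases "\<exists>a\<in>set p. a \<in> \<Lambda>")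
    case False
    then have "set p \<inter> \<Lambda> = {}" by auto
    then show ?thesis using base Y by simp
  next
    case True
    then obtain as u rest where p1: "p = as @ u # rest" "u \<in> \<Lambda>" "\<forall>a\<in>set as. a \<notin> \<Lambda>"
      using split_list_first_prop[of p "\<lambda>a. a \<in> \<Lambda>"] by blast
    show ?thesis
    proof (cases "\<exists>a\<in>set rest. a \<in> \<Lambda>")
      case False
      then have "set p \<inter> \<Lambda> = {u}" using p1 by auto
      then show ?thesis using base Y by simp
    next
      case True
      then obtain bs w cs where p2: "rest = bs @ w # cs" "w \<in> \<Lambda>" "\<forall>a\<in>set cs. a \<notin> \<Lambda>"
        using split_list_last_prop[of rest "\<lambda>a. a \<in> \<Lambda>"] by blast
      define sub where "sub = u # bs @ [w]"
      define n where "n = length bs + 1"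
      have peq: "p = as @ u # (bs @ w # cs)" using p1 p2 by simp
      have succ: "successively lattice_adj (as @ [u])" "successively lattice_adj sub" "successively lattice_adj (w # cs)"
      proof -
        have s: "successively lattice_adj (as @ u # (bs @ w # cs))" using lp(1) unfolding lattice_path_def peq by blast
        then have s2: "successively lattice_adj ((u # bs) @ w # cs)" "successively lattice_adj (as @ [u])"
          using successively_split[of lattice_adj as u "bs @ w # cs"] by auto
        then show "successively lattice_adj (as @ [u])" by blast
        show "successively lattice_adj sub" "successively lattice_adj (w # cs)"
          using s2(1) successively_split[of lattice_adj "u # bs" w cs] unfolding sub_def by auto
      qed
      have lp1: "lattice_path 0 (as @ [u]) u" using lp(1) succ(1) unfolding lattice_path_def peq by (cases as) auto
      have lp3: "lattice_path w (w # cs) v" using lp(1) succ(3) unfolding lattice_path_def peq by auto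
      have lps: "lattice_path u sub w" using succ(2) unfolding lattice_path_def sub_def by auto
      have card: "card (set p \<inter> \<Lambda>) \<le> n + 1"
      proof -
        have "set p \<inter> \<Lambda> \<subseteq> set sub" using p1 p2 unfolding sub_def by auto
        then have "card (set p \<inter> \<Lambda>) \<le> card (set sub)" by (intro card_mono) auto
        also have "\<dots> \<le> length sub" by (rule card_length)
        finally show ?thesis by (simp add: sub_def n_def)
      qed
      show ?thesis
      proof (cases "n \<le> r")
        case True
        then have "real n \<le> real r" by simp
        moreover have "real (card (set p \<inter> \<Lambda>)) \<le> real n + 1" using card by linarith
        ultimately show ?thesis using base Y by linarith
      next
        case False
        define q where "q = short_path u w"
        have q: "lattice_path u q w" "distinct q" unfolding q_def by (rule short_path)+
        have "int (length q) \<le> int r + 1"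
          using short_path(3)[of u w] \<Lambda>(2)[OF p1(2) p2(2)] unfolding q_def by linarith
        then have lq: "length q \<le> n" using False by linarith
        note c1 = lattice_path_concat[OF lp1 q(1)]
        note c2 = lattice_path_concat[OF c1(1) lp3]
        define p' where "p' = ((as @ [u]) @ tl q) @ tl (w # cs)"
        have p': "lattice_path 0 p' v" unfolding p'_def by (rule c2(1))
        have wp': "list_weight x p' = list_weight x (as @ [u]) + list_weight x q + list_weight x (w # cs)"
          unfolding p'_def c2(2) c1(2) ..
        have qne: "q \<noteq> []" using q(1) by (simp add: lattice_path_def)
        have "length p' \<le> k"
        proof -
          have "length p' = length as + length q + length cs" unfolding p'_def using qne by (cases q) auto
          also have "\<dots> \<le> length p" unfolding peq using lq by (simp add: n_def)
          finally show ?thesis using lp(3) by simp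
        qed
        obtain p'' where p'': "lattice_path 0 p'' v" "distinct p''" "length p'' \<le> length p'" "path_edges p'' \<subseteq> path_edges p'"
          by (rule lattice_path_distinct[OF p']) (rule that)
        have "p'' \<in> simple_paths k v" using p'' \<open>length p' \<le> k\<close> by (simp add: simple_paths_def)
        then have "sum x (path_edges p) \<le> sum x (path_edges p'')"
          unfolding p(2) by (intro min_weight_le finite_path_family) (auto simp: path_family_0)
        also have "\<dots> \<le> sum x (path_edges p')"
          using p''(4) lattice_path_edges[OF p'] x by (intro sum_mono2) auto
        also have "\<dots> \<le> list_weight x p'"
          using lattice_path_edges[OF p'] x by (intro sum_path_edges_le_list_weight) auto
        finally have le: "list_weight x p \<le> list_weight x p'"
          unfolding distinct_path_edges(1)[OF lp(2)] .
        have "list_weight x p = list_weight x (as @ [u]) + (list_weight x sub + list_weight x (w # cs))"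
          unfolding peq list_weight_append[of x as u "bs @ w # cs"] sub_def
          using list_weight_append[of x "u # bs" w cs] by simp
        then have "list_weight x sub \<le> list_weight x q" using le wp' by linarith
        also have "\<dots> \<le> D" unfolding q_def by (rule D(2)[OF p1(2) p2(2)])
        finally have "list_weight x sub \<le> D" .
        moreover have "real n \<le> \<kappa> * list_weight x sub + Y"
        proof (rule Y(2)[OF p1(2)])
          show "n < k" using lp(3) unfolding peq n_def by simp
          show "sub \<in> walks n u" unfolding walks_def using succ(2) by (simp add: sub_def n_def)
          show "distinct sub" using lp(2) unfolding peq sub_def by auto
        qed
        ultimately have "real n \<le> \<kappa> * D + Y" using \<kappa> by (smt (verit) mult_left_mono)
        moreover have "real (card (set p \<inter> \<Lambda>)) \<le> real n + 1" using card by linarith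
        ultimately show ?thesis by linarith
      qed
    qed
  qed
qed

definition lattice_box :: "nat \<Rightarrow> (int ^ 'd) set" where
  "lattice_box m = {z. \<forall>i. z $ i \<in> {0..<int m}}"

lemma finite_lattice_box: "finite (lattice_box m :: (int ^ 'd::finite) set)"
  unfolding lattice_box_def by (rule finite_bounded_vectors) simp

lemma card_lattice_box: "card (lattice_box m :: (int ^ 'd::finite) set) = m ^ CARD('d)"
proof -
  have "bij_betw vec_lambda (UNIV \<rightarrow>\<^sub>E {0..<int m} :: ('d \<Rightarrow> int) set) (lattice_box m)"
    by (rule bij_betwI[where g = vec_nth]) (auto simp: lattice_box_def PiE_def Pi_def extensional_def)
  then have "card (lattice_box m :: (int ^ 'd) set) = card (UNIV \<rightarrow>\<^sub>E {0..<int m} :: ('d \<Rightarrow> int) set)"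
    by (metis bij_betw_same_card)
  then show ?thesis by (simp add: card_PiE)
qed

lemma l1_norm_box_diff:
  assumes "z \<in> lattice_box m" "w \<in> lattice_box m"
  shows "l1_norm (z - w :: int ^ 'd::finite) \<le> int (CARD('d) * m)"
proof -
  have "l1_norm (z - w) \<le> (\<Sum>i\<in>(UNIV :: 'd set). int m)"
    unfolding l1_norm_def
  proof (rule sum_mono)
    fix i show "\<bar>(z - w) $ i\<bar> \<le> int m"
      using assms unfolding lattice_box_def by (auto simp: abs_le_iff dest!: spec[of _ i])
  qed
  then show ?thesis by simp
qed

lemma le_ln_plus_exp_div:
  fixes s N :: real
  assumes "N > 0"
  shows "s \<le> ln N + exp s / N"
proof -
  have "s - ln N \<le> exp (s - ln N)" using exp_ge_add_one_self[of "s - ln N"] by linarith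
  also have "\<dots> = exp s / N" using assms by (simp add: exp_diff)
  finally show ?thesis by simp
qed

context edge_times
begin

text \<open>For nonnegative functions an upper bound on the Lebesgue integral includes integrability, so
  bounds of this form can be added without separate proofs of integrability.\<close>

definition mean_le :: "(((int ^ 'd) set \<Rightarrow> real) \<Rightarrow> real) \<Rightarrow> real \<Rightarrow> bool" where
  "mean_le f b \<longleftrightarrow> f \<in> borel_measurable \<mu> \<and> (\<forall>x. 0 \<le> f x) \<and> 0 \<le> b \<and> (\<integral>\<^sup>+x. ennreal (f x) \<partial>\<mu>) \<le> ennreal b"

lemma mean_le_const: "0 \<le> c \<Longrightarrow> mean_le (\<lambda>_. c) c"
  unfolding mean_le_def by (simp add: emeasure_space_1)

lemma mean_le_add:
  assumes "mean_le f b" "mean_le g c"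
  shows "mean_le (\<lambda>x. f x + g x) (b + c)"
proof -
  have [measurable]: "f \<in> borel_measurable \<mu>" "g \<in> borel_measurable \<mu>" using assms by (auto simp: mean_le_def)
  have "(\<integral>\<^sup>+x. ennreal (f x + g x) \<partial>\<mu>) = (\<integral>\<^sup>+x. ennreal (f x) + ennreal (g x) \<partial>\<mu>)"
    using assms by (intro nn_integral_cong) (auto simp: mean_le_def)
  also have "\<dots> = (\<integral>\<^sup>+x. ennreal (f x) \<partial>\<mu>) + (\<integral>\<^sup>+x. ennreal (g x) \<partial>\<mu>)" by (rule nn_integral_add) auto
  also have "\<dots> \<le> ennreal b + ennreal c" using assms by (intro add_mono) (auto simp: mean_le_def)
  finally show ?thesis using assms by (auto simp: mean_le_def)
qed

lemma mean_le_cmult: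
  assumes "mean_le f b" "0 \<le> c"
  shows "mean_le (\<lambda>x. c * f x) (c * b)"
proof -
  have [measurable]: "f \<in> borel_measurable \<mu>" using assms by (auto simp: mean_le_def)
  have "(\<integral>\<^sup>+x. ennreal (c * f x) \<partial>\<mu>) = ennreal c * (\<integral>\<^sup>+x. ennreal (f x) \<partial>\<mu>)"
    using assms by (subst nn_integral_cmult[symmetric]) (auto simp: ennreal_mult mean_le_def)
  also have "\<dots> \<le> ennreal c * ennreal b" using assms by (intro mult_left_mono) (auto simp: mean_le_def)
  also have "\<dots> = ennreal (c * b)" using assms by (auto simp: ennreal_mult mean_le_def)
  finally show ?thesis using assms by (auto simp: mean_le_def)
qed

lemma mean_le_sum:
  assumes "finite K" "\<And>i. i \<in> K \<Longrightarrow> mean_le (f i) (b i)"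
  shows "mean_le (\<lambda>x. \<Sum>i\<in>K. f i x) (\<Sum>i\<in>K. b i)"
  using assms
proof (induction K)
  case empty
  then show ?case by (simp add: mean_le_const)
next
  case (insert i K)
  then show ?case using mean_le_add[of "f i" "b i" "\<lambda>x. \<Sum>i\<in>K. f i x" "\<Sum>i\<in>K. b i"] by simp
qed

lemma mean_le_mono: "mean_le f b \<Longrightarrow> b \<le> c \<Longrightarrow> mean_le f c"
  unfolding mean_le_def by (meson ennreal_leI order_trans)

lemma mean_le_exp_list_weight:
  assumes p: "successively lattice_adj p" "distinct p" and n: "length p - 1 = n"
    and b: "(\<integral>\<^sup>+t. ennreal (exp (c * t)) \<partial>\<nu>) \<le> ennreal b" "0 \<le> b"
  shows "mean_le (\<lambda>x. exp (c * list_weight x p)) (b ^ n)"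
proof -
  have [measurable]: "(\<lambda>x. list_weight x p) \<in> borel_measurable \<mu>" by (rule measurable_list_weight[OF p(1)])
  have "(\<integral>\<^sup>+x. ennreal (exp (c * list_weight x p)) \<partial>\<mu>) \<le> ennreal b ^ n"
    unfolding nn_integral_exp_list_weight[OF p] n by (intro power_mono b) auto
  also have "\<dots> = ennreal (b ^ n)" using b by (simp add: ennreal_power)
  finally show ?thesis using b unfolding mean_le_def by auto
qed

lemma mean_le_exp_short_path:
  assumes \<delta>: "(\<integral>\<^sup>+t. ennreal (exp (\<delta> * t)) \<partial>\<nu>) \<le> ennreal M0" "M0 \<ge> 1"
    and r: "l1_norm (u - w) \<le> int r"
  shows "mean_le (\<lambda>x. exp (\<delta> * list_weight x (short_path u w))) (M0 ^ r)"
proof -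
  have "mean_le (\<lambda>x. exp (\<delta> * list_weight x (short_path u w))) (M0 ^ (length (short_path u w) - 1))"
    using short_path(1,2)[of u w] \<delta> by (intro mean_le_exp_list_weight) (auto simp: lattice_path_def)
  moreover have "M0 ^ (length (short_path u w) - 1) \<le> M0 ^ r"
    using short_path(3)[of u w] r \<delta>(2) by (intro power_increasing) linarith+
  ultimately show ?thesis by (rule mean_le_mono)
qed

text \<open>By translation invariance, the expected number of \<open>z\<close> in the box for which \<open>e\<close> is pivotal for the
  paths from \<open>z\<close> to \<open>z + v\<close> is the expected number of edges \<open>e - z\<close> that are pivotal for the paths from
  \<open>0\<close> to \<open>v\<close>. The latter lie on one minimal path and meet the set \<open>\<Lambda>\<close> of points \<open>a - z\<close>, a box of side \<open>m\<close>,
  where the path spends of order \<open>m\<close> steps. The comparison of lengths with weights is a union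
  bound over all simple paths from \<open>\<Lambda>\<close>, in the variable \<open>\<Xi>\<close>: their number grows exponentially with
  the length, but the Laplace transform of \<open>\<nu>\<close> at \<open>\<kappa>\<close> is small enough to compensate this. The
  weights of the shortest paths inside \<open>\<Lambda>\<close> are controlled by their exponential moments, in the
  variable \<open>\<Xi>'\<close>.\<close>

lemma expected_pivotal_freq_le:
  fixes v :: "int ^ 'd"
  assumes \<delta>: "\<delta> > 0" "(\<integral>\<^sup>+t. ennreal (exp (\<delta> * t)) \<partial>\<nu>) \<le> ennreal M0" "M0 \<ge> 1"
    and \<kappa>: "\<kappa> \<ge> 0" "(\<integral>\<^sup>+t. ennreal (exp (- \<kappa> * t)) \<partial>\<nu>) \<le> ennreal q" "q \<ge> 0"
      "exp 1 * real (lattice_degree TYPE('d)) * q \<le> 1 / 2"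
    and m: "m \<ge> 1" and k: "simple_paths k v \<noteq> {}" and e: "e \<in> lattice_edges"
    and N: "N = real (m ^ CARD('d))" and r: "r = CARD('d) * m"
  shows "(\<integral>x. pivotal_freq M (lattice_box m) (path_family k v) x e \<partial>\<mu>)
    \<le> (3 + real r + ln N + \<kappa> / \<delta> * (2 * ln N + real r * ln M0 + 1)) / N"
proof -
  define F where "F = path_family k v 0"
  have F: "finite F" "F \<noteq> {}" using k finite_path_family[of k v 0] unfolding F_def by (simp_all add: path_family_0)
  obtain a where a: "a \<in> e" using e unfolding lattice_edges_def by blast
  define B where "B = N\<^sup>2 * M0 ^ r"
  have N1: "N \<ge> 1" unfolding N using m by simp
  have B1: "B \<ge> 1" unfolding B_def using mult_mono[of 1 "N\<^sup>2" 1 "M0 ^ r"] one_le_power[OF N1, of 2] one_le_power[OF \<delta>(3), of r] by simp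
  have lnB: "ln B = 2 * ln N + real r * ln M0"
    unfolding B_def using N1 \<delta>(3) by (simp add: ln_mult ln_realpow)
  define \<Lambda> where "\<Lambda> = (\<lambda>z. a - z) ` (lattice_box m :: (int ^ 'd) set)"
  have \<Lambda>fin: "finite \<Lambda>" unfolding \<Lambda>_def by (simp add: finite_lattice_box)
  have \<Lambda>card: "real (card \<Lambda>) \<le> N"
    unfolding \<Lambda>_def N using card_image_le[OF finite_lattice_box, of "\<lambda>z. a - z" m] by (simp add: card_lattice_box)
  have \<Lambda>dist: "l1_norm (u - w) \<le> int r" if uw: "u \<in> \<Lambda>" "w \<in> \<Lambda>" for u w
  proof -
    obtain z z' where z: "u = a - z" "w = a - z'" "z \<in> lattice_box m" "z' \<in> lattice_box m" using uw unfolding \<Lambda>_def by blast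
    have "u - w = z' - z" using z by simp
    then show ?thesis using l1_norm_box_diff[OF z(4,3)] by (simp add: r)
  qed
  define \<Xi> where "\<Xi> x = (\<Sum>u\<in>\<Lambda>. \<Sum>j<k. \<Sum>\<pi>\<in>{\<pi>\<in>walks j u. distinct \<pi>}. exp (real j) * exp (- \<kappa> * list_weight x \<pi>))" for x
  define \<Xi>' where "\<Xi>' x = (\<Sum>u\<in>\<Lambda>. \<Sum>w\<in>\<Lambda>. exp (\<delta> * list_weight x (short_path u w)))" for x
  have wfin: "finite {\<pi>\<in>walks j u. distinct \<pi>}" for j and u :: "int ^ 'd" using finite_walks[of j u] by simp
  have \<Xi>mean: "mean_le \<Xi> (2 * N)"
  proof -
    have "mean_le \<Xi> (\<Sum>u\<in>\<Lambda>. \<Sum>j<k. \<Sum>\<pi>\<in>{\<pi>\<in>walks j u. distinct \<pi>}. exp (real j) * q ^ j)"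
      unfolding \<Xi>_def[abs_def]
      by (intro mean_le_sum \<Lambda>fin finite_lessThan wfin mean_le_cmult mean_le_exp_list_weight \<kappa>)
        (auto simp: walks_def)
    moreover have "(\<Sum>u\<in>\<Lambda>. \<Sum>j<k. \<Sum>\<pi>\<in>{\<pi>\<in>walks j u. distinct \<pi>}. exp (real j) * q ^ j) \<le> 2 * N"
    proof -
      have "(\<Sum>\<pi>\<in>{\<pi>\<in>walks j u. distinct \<pi>}. exp (real j) * q ^ j) \<le> (1 / 2) ^ j" for j and u :: "int ^ 'd"
      proof -
        have "card {\<pi>\<in>walks j u. distinct \<pi>} \<le> card (walks j u)" by (intro card_mono finite_walks) auto
        also have "\<dots> \<le> lattice_degree TYPE('d) ^ j" by (rule card_walks)
        finally have "real (card {\<pi>\<in>walks j u. distinct \<pi>}) \<le> real (lattice_degree TYPE('d) ^ j)" by linarith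
        then have "real (card {\<pi>\<in>walks j u. distinct \<pi>}) * (exp (real j) * q ^ j)
            \<le> real (lattice_degree TYPE('d) ^ j) * (exp (real j) * q ^ j)"
          using \<kappa>(3) by (intro mult_right_mono) auto
        also have "\<dots> = (exp 1 * real (lattice_degree TYPE('d)) * q) ^ j"
          using exp_of_nat_mult[of j "1::real"] by (simp add: power_mult_distrib)
        also have "\<dots> \<le> (1 / 2) ^ j" using \<kappa>(3,4) by (intro power_mono) auto
        finally show ?thesis by simp
      qed
      then have "(\<Sum>u\<in>\<Lambda>. \<Sum>j<k. \<Sum>\<pi>\<in>{\<pi>\<in>walks j u. distinct \<pi>}. exp (real j) * q ^ j)
          \<le> (\<Sum>u\<in>\<Lambda>. \<Sum>j<k. (1 / 2) ^ j)" by (intro sum_mono)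
      also have "\<dots> \<le> (\<Sum>u\<in>\<Lambda>. 2)"
      proof (rule sum_mono)
        have "(\<Sum>j<k. (1 / 2 :: real) ^ j) = 2 * (1 - (1 / 2) ^ k)" by (subst sum_gp_strict) auto
        then show "(\<Sum>j<k. (1 / 2 :: real) ^ j) \<le> 2" by simp
      qed
      finally show ?thesis using \<Lambda>card by simp
    qed
    ultimately show ?thesis by (rule mean_le_mono)
  qed
  have \<Xi>'mean: "mean_le \<Xi>' B"
  proof -
    have "mean_le \<Xi>' (\<Sum>u\<in>\<Lambda>. \<Sum>w\<in>\<Lambda>. M0 ^ r)"
      unfolding \<Xi>'_def[abs_def]
    proof (intro mean_le_sum \<Lambda>fin)
      fix u w assume uw: "u \<in> \<Lambda>" "w \<in> \<Lambda>"
      show "mean_le (\<lambda>x. exp (\<delta> * list_weight x (short_path u w))) (M0 ^ r)"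
        by (rule mean_le_exp_short_path[OF \<delta>(2,3) \<Lambda>dist[OF uw]])
    qed
    moreover have "(\<Sum>u\<in>\<Lambda>. \<Sum>w\<in>\<Lambda>. M0 ^ r) \<le> B"
    proof -
      have "real (card \<Lambda>) * real (card \<Lambda>) \<le> N * N" using \<Lambda>card N1 by (intro mult_mono) auto
      then have "real (card \<Lambda>) * real (card \<Lambda>) * M0 ^ r \<le> N * N * M0 ^ r"
        using \<delta>(3) by (intro mult_right_mono) auto
      then show ?thesis by (simp add: B_def power2_eq_square mult.assoc)
    qed
    ultimately show ?thesis by (rule mean_le_mono)
  qed
  define T where "T x = (1 + real r + ln N + \<kappa> / \<delta> * ln B) + (1 / N * \<Xi> x + \<kappa> / \<delta> / B * \<Xi>' x)" for x
  define C where "C = (1 + real r + ln N + \<kappa> / \<delta> * ln B) + (1 / N * (2 * N) + \<kappa> / \<delta> / B * B)"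
  have c0: "0 \<le> ln N" "0 \<le> ln B" using N1 B1 by auto
  have Tmean: "mean_le T C"
    unfolding T_def[abs_def] C_def
    using \<delta>(1) \<kappa>(1) N1 B1 c0 by (intro mean_le_add mean_le_const mean_le_cmult \<Xi>mean \<Xi>'mean add_nonneg_nonneg) auto
  define cnt where "cnt x = (\<Sum>z\<in>lattice_box m. of_bool (translate (- z) e \<in> pivotal M F x) :: real)" for x
  have cntT: "cnt x \<le> T x" if x: "x \<in> space \<mu>" for x
  proof -
    have xn: "\<forall>e\<in>lattice_edges. 0 \<le> x e" by (rule nonneg[OF x])
    obtain S where S: "S \<in> F" "sum x S = min_weight F x" using min_weight_attained[OF F] .
    then obtain p where p: "p \<in> simple_paths k v" "S = path_edges p" unfolding F_def path_family_0 by blast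
    have "cnt x = real (card {z \<in> lattice_box m. translate (- z) e \<in> pivotal M F x})"
      unfolding cnt_def using finite_lattice_box[of m] by (subst sum_of_bool_eq) (auto simp: Int_def)
    also have "card {z \<in> lattice_box m. translate (- z) e \<in> pivotal M F x} \<le> card (set p \<inter> \<Lambda>)"
    proof (rule card_inj_on_le[where f = "\<lambda>z. a - z"])
      show "inj_on (\<lambda>z. a - z) {z \<in> lattice_box m. translate (- z) e \<in> pivotal M F x}" by (auto simp: inj_on_def)
      show "(\<lambda>z. a - z) ` {z \<in> lattice_box m. translate (- z) e \<in> pivotal M F x} \<subseteq> set p \<inter> \<Lambda>"
      proof safe
        fix z assume z: "z \<in> lattice_box m" "translate (- z) e \<in> pivotal M F x"
        then have "translate (- z) e \<in> path_edges p" using S p unfolding pivotal_def by auto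
        then have "translate (- z) e \<subseteq> set p" by (rule path_edges_subset_set)
        then have "- z + a \<in> set p" using a by blast
        then show "a - z \<in> set p" by simp
        show "a - z \<in> \<Lambda>" unfolding \<Lambda>_def using z by blast
      qed
    qed simp
    also have "real (card (set p \<inter> \<Lambda>)) \<le> 1 + real r + \<kappa> * ((ln B + \<Xi>' x / B) / \<delta>) + (ln N + \<Xi> x / N)"
    proof (rule card_minimal_path_Int_le[OF xn p(1) _ \<Lambda>fin \<Lambda>dist])
      show "sum x (path_edges p) = min_weight (path_family k v 0) x" using S p by (simp add: F_def)
      have \<Xi>0: "0 \<le> \<Xi> x" unfolding \<Xi>_def by (intro sum_nonneg) auto
      have \<Xi>'0: "0 \<le> \<Xi>' x" unfolding \<Xi>'_def by (intro sum_nonneg) auto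
      show "0 \<le> ln N + \<Xi> x / N" using c0 \<Xi>0 N1 by auto
      show "0 \<le> (ln B + \<Xi>' x / B) / \<delta>" using c0 \<Xi>'0 B1 \<delta>(1) by auto
      show "0 \<le> \<kappa>" by (rule \<kappa>(1))
      show "real j \<le> \<kappa> * list_weight x \<pi> + (ln N + \<Xi> x / N)"
        if "u \<in> \<Lambda>" "j < k" "\<pi> \<in> walks j u" "distinct \<pi>" for j u \<pi>
      proof -
        have "exp (real j) * exp (- \<kappa> * list_weight x \<pi>)
            \<le> (\<Sum>\<pi>\<in>{\<pi>\<in>walks j u. distinct \<pi>}. exp (real j) * exp (- \<kappa> * list_weight x \<pi>))"
          using that wfin by (intro member_le_sum) auto
        also have "\<dots> \<le> (\<Sum>j<k. \<Sum>\<pi>\<in>{\<pi>\<in>walks j u. distinct \<pi>}. exp (real j) * exp (- \<kappa> * list_weight x \<pi>))"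
          using that by (intro member_le_sum[of j "{..<k}" "\<lambda>j. \<Sum>\<pi>\<in>{\<pi>\<in>walks j u. distinct \<pi>}. exp (real j) * exp (- \<kappa> * list_weight x \<pi>)"]) (auto intro!: sum_nonneg)
        also have "\<dots> \<le> \<Xi> x"
          unfolding \<Xi>_def using that \<Lambda>fin
          by (intro member_le_sum[of u \<Lambda> "\<lambda>u. \<Sum>j<k. \<Sum>\<pi>\<in>{\<pi>\<in>walks j u. distinct \<pi>}. exp (real j) * exp (- \<kappa> * list_weight x \<pi>)"]) (auto intro!: sum_nonneg)
        finally have "exp (real j - \<kappa> * list_weight x \<pi>) / N \<le> \<Xi> x / N"
          using N1 by (intro divide_right_mono) (auto simp: exp_diff exp_minus divide_inverse)
        then show ?thesis using le_ln_plus_exp_div[of N "real j - \<kappa> * list_weight x \<pi>"] N1 by linarith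
      qed
      show "list_weight x (short_path u w) \<le> (ln B + \<Xi>' x / B) / \<delta>" if "u \<in> \<Lambda>" "w \<in> \<Lambda>" for u w
      proof -
        have "exp (\<delta> * list_weight x (short_path u w)) \<le> (\<Sum>w\<in>\<Lambda>. exp (\<delta> * list_weight x (short_path u w)))"
          using that \<Lambda>fin by (intro member_le_sum[of w \<Lambda> "\<lambda>w. exp (\<delta> * list_weight x (short_path u w))"]) auto
        also have "\<dots> \<le> \<Xi>' x"
          unfolding \<Xi>'_def using that \<Lambda>fin
          by (intro member_le_sum[of u \<Lambda> "\<lambda>u. \<Sum>w\<in>\<Lambda>. exp (\<delta> * list_weight x (short_path u w))"]) (auto intro!: sum_nonneg)
        finally have "exp (\<delta> * list_weight x (short_path u w)) / B \<le> \<Xi>' x / B"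
          using B1 by (intro divide_right_mono) auto
        then have "\<delta> * list_weight x (short_path u w) \<le> ln B + \<Xi>' x / B"
          using le_ln_plus_exp_div[of B "\<delta> * list_weight x (short_path u w)"] B1 by linarith
        then show ?thesis using \<delta>(1) by (simp add: pos_le_divide_eq mult.commute)
      qed
    qed
    also have "\<dots> = T x" unfolding T_def using \<delta>(1) by (simp add: field_simps)
    finally show ?thesis by simp
  qed
  have piv_m [measurable]: "{x \<in> space \<mu>. translate (- z) e \<in> pivotal M F x} \<in> sets \<mu>" for z
    unfolding F_def by (rule measurable_pivotal)
  have ind_m: "(\<lambda>x. of_bool (translate (- z) e \<in> pivotal M F x) :: real) \<in> borel_measurable \<mu>" for z
  proof -
    have "(\<lambda>x. indicator {x \<in> space \<mu>. translate (- z) e \<in> pivotal M F x} x :: real) \<in> borel_measurable \<mu>"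
      using piv_m by simp
    then show ?thesis by (rule measurable_cong[THEN iffD1, rotated]) (simp add: indicator_def)
  qed
  have int: "(\<integral>x. cnt x \<partial>\<mu>) \<le> C"
  proof (rule integral_real_bounded)
    show "0 \<le> C" using Tmean by (simp add: mean_le_def)
    have "(\<integral>\<^sup>+x. ennreal (cnt x) \<partial>\<mu>) \<le> (\<integral>\<^sup>+x. ennreal (T x) \<partial>\<mu>)"
      by (intro nn_integral_mono ennreal_leI cntT)
    then show "(\<integral>\<^sup>+x. ennreal (cnt x) \<partial>\<mu>) \<le> ennreal C" using Tmean by (auto simp: mean_le_def)
  qed
  have restrict_inv: "pivotal M F (restrict x lattice_edges) = pivotal M F x" for x
  proof (rule pivotal_cong)
    fix S e assume "S \<in> F" "e \<in> S"
    then have "e \<in> lattice_edges" using path_family_edges(2)[of S k v 0] by (auto simp: F_def)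
    then show "restrict x lattice_edges e = x e" by simp
  qed
  have "(\<integral>x. pivotal_freq M (lattice_box m) (path_family k v) x e \<partial>\<mu>)
      = (\<integral>x. (\<Sum>z\<in>lattice_box m. of_bool (translate (- z) e \<in> pivotal M F (shift z x))) / N \<partial>\<mu>)"
    unfolding pivotal_freq_def card_lattice_box N F_def pivotal_path_family[of e M k v] ..
  also have "\<dots> = (\<Sum>z\<in>lattice_box m. \<integral>x. of_bool (translate (- z) e \<in> pivotal M F (shift z x)) \<partial>\<mu>) / N"
  proof -
    have "integrable \<mu> (\<lambda>x. of_bool (translate (- z) e \<in> pivotal M F (shift z x)) :: real)" for z
    proof (rule integrable_const_bound[where B = 1])
      have "(\<lambda>x. of_bool (e \<in> pivotal M (path_family k v z) x) :: real) \<in> borel_measurable \<mu>"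
      proof -
        have "(\<lambda>x. indicator {x \<in> space \<mu>. e \<in> pivotal M (path_family k v z) x} x :: real) \<in> borel_measurable \<mu>"
          using measurable_pivotal[of e M k v z] by simp
        then show ?thesis by (rule measurable_cong[THEN iffD1, rotated]) (simp add: indicator_def)
      qed
      then show "(\<lambda>x. of_bool (translate (- z) e \<in> pivotal M F (shift z x)) :: real) \<in> borel_measurable \<mu>"
        unfolding F_def pivotal_path_family[of e M k v z] .
    qed auto
    then show ?thesis by (simp add: Bochner_Integration.integral_sum)
  qed
  also have "\<dots> = (\<Sum>z\<in>lattice_box m. \<integral>x. of_bool (translate (- z) e \<in> pivotal M F x) \<partial>\<mu>) / N"
    using integral_shift[OF ind_m] restrict_inv by simp
  also have "\<dots> = (\<integral>x. cnt x \<partial>\<mu>) / N"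
    unfolding cnt_def using ind_m
    by (subst Bochner_Integration.integral_sum) (auto intro!: integrable_const_bound[where B = 1])
  also have "\<dots> \<le> C / N" using int N1 by (intro divide_right_mono) auto
  also have "C = 3 + real r + ln N + \<kappa> / \<delta> * (2 * ln N + real r * ln M0 + 1)"
    unfolding C_def lnB using N1 B1 by (simp add: distrib_left)
  finally show ?thesis .
qed

end

section \<open>The variance bound for exponentials of averaged passage times\<close>

lemma avg_trunc_weight_cong:
  assumes "\<And>z S e. z \<in> Z \<Longrightarrow> S \<in> \<S> z \<Longrightarrow> e \<in> S \<Longrightarrow> x e = y e"
  shows "avg_trunc_weight M Z \<S> x = avg_trunc_weight M Z \<S> y"
  unfolding avg_trunc_weight_def
  by (intro arg_cong2[where f = "(/)"] sum.cong refl trunc_min_weight_cong) (use assms in blast)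

lemma pivotal_freq_cong:
  assumes "\<And>z S e. z \<in> Z \<Longrightarrow> S \<in> \<S> z \<Longrightarrow> e \<in> S \<Longrightarrow> x e = y e"
  shows "pivotal_freq M Z \<S> x e' = pivotal_freq M Z \<S> y e'"
proof -
  have "pivotal M (\<S> z) x = pivotal M (\<S> z) y" if "z \<in> Z" for z
    by (rule pivotal_cong) (use assms that in blast)
  then show ?thesis unfolding pivotal_freq_def by simp
qed

text \<open>A set that contains an element of weight above \<open>M\<close> has total weight at least \<open>M\<close>, before and
  after that weight is lowered to \<open>M\<close>.\<close>

lemma trunc_min_weight_truncate:
  assumes \<S>: "finite \<S>" "\<S> \<noteq> {}" "\<And>S. S \<in> \<S> \<Longrightarrow> finite S"
    and x: "\<And>S e. S \<in> \<S> \<Longrightarrow> e \<in> S \<Longrightarrow> 0 \<le> x e" and M: "0 \<le> M"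
  shows "trunc_min_weight M \<S> (\<lambda>e. min (x e) M) = trunc_min_weight M \<S> x"
proof (rule antisym)
  let ?y = "\<lambda>e. min (x e) M"
  have "min_weight \<S> ?y \<le> min_weight \<S> x"
  proof (rule min_weight_greatest[OF \<S>(1,2)])
    fix S assume S: "S \<in> \<S>"
    have "min_weight \<S> ?y \<le> sum ?y S" by (rule min_weight_le[OF \<S>(1) S])
    also have "\<dots> \<le> sum x S" by (intro sum_mono) simp
    finally show "min_weight \<S> ?y \<le> sum x S" .
  qed
  then show "trunc_min_weight M \<S> ?y \<le> trunc_min_weight M \<S> x" unfolding trunc_min_weight_def by simp
  obtain S where S: "S \<in> \<S>" "sum ?y S = min_weight \<S> ?y" using min_weight_attained[OF \<S>(1,2)] .
  have "min M (min_weight \<S> x) \<le> sum ?y S"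
  proof (cases "\<exists>e\<in>S. M < x e")
    case True
    then obtain e where e: "e \<in> S" "M < x e" by blast
    have "?y e \<le> sum ?y S"
      using \<S>(3)[OF S(1)] e x[OF S(1)] M by (intro member_le_sum) auto
    then show ?thesis using e by simp
  next
    case False
    then have "sum ?y S = sum x S" by (intro sum.cong) (auto simp: min_def)
    then show ?thesis using min_weight_le[OF \<S>(1) S(1), of x] by simp
  qed
  then show "trunc_min_weight M \<S> x \<le> trunc_min_weight M \<S> ?y"
    unfolding trunc_min_weight_def S(2) by simp
qed

lemma tendsto_min_weight:
  assumes "finite \<S>" "\<S> \<noteq> {}" "\<And>S e. S \<in> \<S> \<Longrightarrow> e \<in> S \<Longrightarrow> (\<lambda>n. Y n e) \<longlonglongrightarrow> y e"
  shows "(\<lambda>n. min_weight \<S> (Y n)) \<longlonglongrightarrow> min_weight \<S> y"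
proof -
  have s: "(\<lambda>n. sum (Y n) S) \<longlonglongrightarrow> sum y S" if "S \<in> \<S>" for S
    using assms(3)[OF that] by (intro tendsto_sum)
  have "(\<lambda>n. Min ((\<lambda>S. sum (Y n) S) ` \<S>)) \<longlonglongrightarrow> Min ((\<lambda>S. sum y S) ` \<S>)"
    using assms(1,2) s
  proof (induction \<S> rule: finite_ne_induct)
    case (insert S \<S>)
    then show ?case by (simp add: tendsto_min)
  qed simp
  then show ?thesis unfolding min_weight_def .
qed

lemma tendsto_avg_trunc_weight:
  assumes "\<And>z. z \<in> Z \<Longrightarrow> finite (\<S> z)" "\<And>z. z \<in> Z \<Longrightarrow> \<S> z \<noteq> {}"
    "\<And>z S e. z \<in> Z \<Longrightarrow> S \<in> \<S> z \<Longrightarrow> e \<in> S \<Longrightarrow> (\<lambda>n. Y n e) \<longlonglongrightarrow> y e"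
  shows "(\<lambda>n. avg_trunc_weight M Z \<S> (Y n)) \<longlonglongrightarrow> avg_trunc_weight M Z \<S> y"
  unfolding avg_trunc_weight_def trunc_min_weight_def divide_inverse
  by (intro tendsto_mult tendsto_sum tendsto_min tendsto_const tendsto_min_weight) (use assms in blast)+

lemma avg_trunc_weight_bounds:
  assumes Z: "finite Z" "Z \<noteq> {}" and M: "0 \<le> M"
    and \<S>: "\<And>z. z \<in> Z \<Longrightarrow> finite (\<S> z)" "\<And>z. z \<in> Z \<Longrightarrow> \<S> z \<noteq> {}"
    and x: "\<And>z S e. z \<in> Z \<Longrightarrow> S \<in> \<S> z \<Longrightarrow> e \<in> S \<Longrightarrow> 0 \<le> x e"
  shows "0 \<le> avg_trunc_weight M Z \<S> x" "avg_trunc_weight M Z \<S> x \<le> M"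
proof -
  show "0 \<le> avg_trunc_weight M Z \<S> x" unfolding avg_trunc_weight_def
    by (intro divide_nonneg_nonneg sum_nonneg trunc_min_weight_nonneg) (use assms in auto)
  have "(\<Sum>z\<in>Z. trunc_min_weight M (\<S> z) x) \<le> (\<Sum>z\<in>Z. M)" by (intro sum_mono trunc_min_weight_le)
  moreover have "real (card Z) > 0" using Z by (simp add: card_gt_0_iff)
  ultimately show "avg_trunc_weight M Z \<S> x \<le> M"
    unfolding avg_trunc_weight_def by (simp add: divide_le_eq mult.commute)
qed

lemma bit_sum_eq_sign_sum: "bit_sum n e A = sign_sum n {i. i < n \<and> (e, i) \<in> A}"
  unfolding bit_sum_def sign_sum_def ..

lemma norm_exp_mult_le:
  fixes c F M :: real
  assumes "0 \<le> F" "F \<le> M"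
  shows "norm (exp (c * F)) \<le> exp (\<bar>c\<bar> * M)"
proof -
  have "c * F \<le> \<bar>c\<bar> * F" using assms by (intro mult_right_mono) auto
  also have "\<dots> \<le> \<bar>c\<bar> * M" using assms by (intro mult_left_mono) auto
  finally show ?thesis by simp
qed

lemma abs_exp_mult_le:
  fixes c F M :: real
  assumes "\<bar>c\<bar> \<le> 1" "0 \<le> F" "F \<le> M"
  shows "\<bar>exp (c * F)\<bar> \<le> exp M"
proof -
  have "\<bar>c\<bar> * M \<le> 1 * M" using assms by (intro mult_right_mono) auto
  then have "exp (\<bar>c\<bar> * M) \<le> exp M" by simp
  then show ?thesis using norm_exp_mult_le[OF assms(2,3), of c] by simp
qed

context edge_times
begin

text \<open>The bound on the cube passes to the limit of many signs. Truncating \<open>R\<close> at \<open>sqrt M\<close> makes all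
  test functions bounded and continuous without changing the average weight.\<close>

lemma exp_variance_path_family:
  fixes v :: "int ^ 'd" and R :: "real \<Rightarrow> real"
  assumes R: "\<And>s. 0 \<le> R s" "mono R" "\<And>s t. s \<le> t \<Longrightarrow> R t - R s \<le> L * (t - s)" "L > 0"
    and \<nu>: "\<nu> = distr std_normal_distribution (restrict_space borel {0..}) (\<lambda>s. (R s)\<^sup>2)"
    and \<delta>: "\<delta> > 0" "(\<integral>\<^sup>+t. ennreal (exp (\<delta> * t)) \<partial>\<nu>) < ennreal M0" "M0 \<ge> 1"
    and \<kappa>: "\<kappa> \<ge> 0" "(\<integral>\<^sup>+t. ennreal (exp (- \<kappa> * t)) \<partial>\<nu>) + ennreal (exp (- \<kappa> * M)) < ennreal q" "q \<ge> 0"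
      "exp 1 * real (lattice_degree TYPE('d)) * q \<le> 1 / 2"
    and m: "m \<ge> 1" and k: "simple_paths k v \<noteq> {}" and M: "M > 0"
    and N: "N = real (m ^ CARD('d))" and r: "r = CARD('d) * m"
    and \<rho>: "\<rho> = (3 + real r + ln N + \<kappa> / \<delta> * (2 * ln N + real r * ln M0 + 1)) / N" "\<rho> < 1"
    and \<theta>: "\<bar>\<theta>\<bar> \<le> 1"
    and F: "F = avg_trunc_weight M (lattice_box m) (path_family k v)"
  shows "(\<integral>x. exp (\<theta> * F x) \<partial>\<mu>) - (\<integral>x. exp (\<theta> / 2 * F x) \<partial>\<mu>)\<^sup>2
    \<le> 144 * L\<^sup>2 * M * \<theta>\<^sup>2 * (\<integral>x. exp (\<theta> * F x) \<partial>\<mu>) / ln (1 / \<rho>)"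
proof -
  let ?Rp = "restrict_space borel {0..} :: real measure"
  define Z where "Z = (lattice_box m :: (int ^ 'd) set)"
  define \<S> where "\<S> = path_family k v"
  have Z: "finite Z" "Z \<noteq> {}"
  proof -
    have "0 \<in> Z" unfolding Z_def lattice_box_def using m by simp
    then show "finite Z" "Z \<noteq> {}" unfolding Z_def by (auto simp: finite_lattice_box)
  qed
  have \<S>: "finite (\<S> z)" "\<S> z \<noteq> {}" for z
    using k unfolding \<S>_def by (simp_all add: finite_path_family) (simp add: path_family_def)
  define J where "J = (\<Union>z\<in>Z. \<Union>(\<S> z))"
  have Sedges: "finite S" "S \<subseteq> lattice_edges" if "S \<in> \<S> z" for z S
    using path_family_edges[of S k v z] that unfolding \<S>_def by auto
  have J: "finite J" "J \<subseteq> lattice_edges"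
    unfolding J_def by (intro finite_Union finite_UN_I Z \<S> | use Sedges in blast)+
  have SJ: "S \<subseteq> J" if "z \<in> Z" "S \<in> \<S> z" for z S using that unfolding J_def by blast
  have Sfin: "finite S" if "S \<in> \<S> z" for z S using Sedges(1)[OF that] .
  define RM where "RM s = min (R s) (sqrt M)" for s
  define q\<^sub>M where "q\<^sub>M s = (RM s)\<^sup>2" for s
  have RM0: "0 \<le> RM s" for s using R(1) M by (simp add: RM_def)
  have RMM: "q\<^sub>M s \<le> M" for s
  proof -
    have "(RM s)\<^sup>2 \<le> (sqrt M)\<^sup>2" by (intro power_mono RM0) (simp add: RM_def)
    then show ?thesis using M by (simp add: q\<^sub>M_def)
  qed
  have qMin: "q\<^sub>M s = min ((R s)\<^sup>2) M" for s
  proof (cases "R s \<le> sqrt M")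
    case True
    then have "(R s)\<^sup>2 \<le> (sqrt M)\<^sup>2" using R(1) by (intro power_mono) auto
    then show ?thesis using True M by (simp add: q\<^sub>M_def RM_def)
  next
    case False
    then have "(sqrt M)\<^sup>2 \<le> (R s)\<^sup>2" using M by (intro power_mono) auto
    then show ?thesis using False M by (simp add: q\<^sub>M_def RM_def)
  qed
  have RMmono: "RM s \<le> RM t" if "s \<le> t" for s t
    using monoD[OF R(2) that] unfolding RM_def by linarith
  have RML: "RM t - RM s \<le> L * (t - s)" if "s \<le> t" for s t
  proof -
    have "RM t - RM s \<le> max 0 (R t - R s)" using monoD[OF R(2) that] unfolding RM_def by linarith
    also have "\<dots> \<le> L * (t - s)" using R(3)[OF that] R(4) that by simp
    finally show ?thesis .
  qed
  have qc: "continuous_on UNIV q\<^sub>M"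
  proof -
    have "\<bar>R t - R s\<bar> \<le> L * \<bar>t - s\<bar>" for s t
      using R(3)[of s t] R(3)[of t s] monoD[OF R(2), of s t] monoD[OF R(2), of t s] by (cases "s \<le> t") auto
    then have "L-lipschitz_on UNIV R"
      using R(4) by (intro lipschitz_onI) (auto simp: dist_real_def)
    then have "continuous_on UNIV R" by (rule lipschitz_on_continuous_on)
    then show ?thesis unfolding q\<^sub>M_def RM_def by (intro continuous_intros)
  qed
  have qct: "isCont q\<^sub>M s" for s using qc by (simp add: continuous_on_eq_continuous_at)
  have qm [measurable]: "q\<^sub>M \<in> borel_measurable borel" using qc by (rule borel_measurable_continuous_onI)
  have q0: "0 \<le> q\<^sub>M s" for s by (simp add: q\<^sub>M_def)
  have Rm [measurable]: "R \<in> borel_measurable borel" by (rule borel_measurable_mono) (rule R(2))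
  interpret G: real_distribution std_normal_distribution by (rule real_dist_normal_dist)
  define A\<^sub>n where "A\<^sub>n n = J \<times> {..<n :: nat}" for n
  define x\<^sub>n where "x\<^sub>n n A e = q\<^sub>M (bit_sum n e A)" for n :: nat and A and e :: "(int ^ 'd) set"
  have N1: "N \<ge> 1" unfolding N using m by simp
  have \<rho>0: "\<rho> > 0"
  proof -
    have "0 \<le> ln N" "0 \<le> ln M0" using N1 \<delta>(3) by auto
    then have "0 \<le> \<kappa> / \<delta> * (2 * ln N + real r * ln M0 + 1)" using \<kappa>(1) \<delta>(1) by simp
    then show ?thesis unfolding \<rho>(1) using N1 \<open>0 \<le> ln N\<close> by (intro divide_pos_pos add_pos_nonneg) auto
  qed
  have sumJ: "(\<lambda>x. sum x S) \<in> borel_measurable (PiM J (\<lambda>_. K))"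
    if "z \<in> Z" "S \<in> \<S> z" "(\<lambda>t. t) \<in> borel_measurable K" for z S and K :: "real measure"
  proof (intro borel_measurable_sum)
    fix e assume "e \<in> S"
    then have "e \<in> J" using SJ that by blast
    then show "(\<lambda>x. x e) \<in> borel_measurable (PiM J (\<lambda>_. K))"
      by (rule measurable_compose[OF measurable_component_singleton[where M = "\<lambda>_. K"] that(3)])
  qed
  have compq: "(\<lambda>y. \<lambda>e\<in>J. q\<^sub>M (y e)) \<in> measurable (PiM J (\<lambda>_. borel)) (PiM J (\<lambda>_. borel))"
    by (intro measurable_restrict) measurable
  have idRp: "(\<lambda>t. t) \<in> borel_measurable ?Rp" by (intro measurable_restrict_space1) simp
  \<comment> \<open>The cube average is an integral over a product of sign laws. In the Gaussian limit, the edge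
    times may be truncated at \<open>M\<close> or not.\<close>
  have lim: "(\<lambda>n. cube_avg (A\<^sub>n n) (\<lambda>A. exp (c * avg_trunc_weight M Z \<S> (x\<^sub>n n A)))) \<longlonglongrightarrow> (\<integral>x. exp (c * F x) \<partial>\<mu>)"
    if c: "\<bar>c\<bar> \<le> 1" for c
  proof -
    define \<Phi> where "\<Phi> y = exp (c * avg_trunc_weight M Z \<S> (\<lambda>e\<in>J. q\<^sub>M (y e)))" for y
    have \<Phi>m: "\<Phi> \<in> borel_measurable (PiM J (\<lambda>_. borel))"
    proof -
      have "(\<lambda>x. avg_trunc_weight M Z \<S> x) \<in> borel_measurable (PiM J (\<lambda>_. borel))"
        by (intro borel_measurable_avg_trunc_weight \<S> sumJ) auto
      from measurable_compose[OF compq this] show ?thesis unfolding \<Phi>_def by simp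
    qed
    have \<Phi>b: "\<bar>\<Phi> y\<bar> \<le> exp M" for y
      unfolding \<Phi>_def using M SJ
      by (intro abs_exp_mult_le c avg_trunc_weight_bounds Z \<S>) (auto simp: restrict_def q0)
    have "(\<lambda>n. \<integral>y. \<Phi> y \<partial>PiM J (\<lambda>_. sign_law n)) \<longlonglongrightarrow> (\<integral>y. \<Phi> y \<partial>PiM J (\<lambda>_. std_normal_distribution))"
    proof (rule PiM_sign_law_tendsto[OF J(1) \<Phi>m \<Phi>b])
      fix Y :: "nat \<Rightarrow> (int ^ 'd) set \<Rightarrow> real" and y
      assume Y: "\<And>e. e \<in> J \<Longrightarrow> (\<lambda>n. Y n e) \<longlonglongrightarrow> y e"
      show "(\<lambda>n. \<Phi> (Y n)) \<longlonglongrightarrow> \<Phi> y"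
        unfolding \<Phi>_def
      proof (intro tendsto_exp tendsto_mult tendsto_const tendsto_avg_trunc_weight \<S>)
        fix z S e assume "z \<in> Z" "S \<in> \<S> z" "e \<in> S"
        then have "e \<in> J" using SJ by blast
        then show "(\<lambda>n. (\<lambda>e\<in>J. q\<^sub>M (Y n e)) e) \<longlonglongrightarrow> (\<lambda>e\<in>J. q\<^sub>M (y e)) e"
          using isCont_tendsto_compose[OF qct Y] by simp
      qed
    qed
    moreover have "(\<integral>y. \<Phi> y \<partial>PiM J (\<lambda>_. sign_law n)) = cube_avg (A\<^sub>n n) (\<lambda>A. exp (c * avg_trunc_weight M Z \<S> (x\<^sub>n n A)))" for n
    proof -
      have eq: "avg_trunc_weight M Z \<S> (\<lambda>e\<in>J. q\<^sub>M ((\<lambda>e\<in>J. sign_sum n {i. i < n \<and> (e, i) \<in> A}) e)) = avg_trunc_weight M Z \<S> (x\<^sub>n n A)" for A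
        by (rule avg_trunc_weight_cong) (use SJ in \<open>auto simp: x\<^sub>n_def bit_sum_eq_sign_sum\<close>)
      show ?thesis
        unfolding cube_avg_PiM_sign_law[OF J(1) \<Phi>m \<Phi>b] A\<^sub>n_def unfolding \<Phi>_def eq ..
    qed
    moreover have "(\<integral>y. \<Phi> y \<partial>PiM J (\<lambda>_. std_normal_distribution)) = (\<integral>x. exp (c * F x) \<partial>\<mu>)"
    proof -
      define \<Phi>' where "\<Phi>' x = exp (c * avg_trunc_weight M Z \<S> (\<lambda>e. min (x e) M))" for x
      have \<Phi>'m: "\<Phi>' \<in> borel_measurable (PiM J (\<lambda>_. ?Rp))"
      proof -
        have "(\<lambda>x. avg_trunc_weight M Z \<S> x) \<in> borel_measurable (PiM J (\<lambda>_. borel))"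
          by (intro borel_measurable_avg_trunc_weight \<S> sumJ) auto
        moreover have "(\<lambda>x. \<lambda>e\<in>J. min (x e) M) \<in> measurable (PiM J (\<lambda>_. ?Rp)) (PiM J (\<lambda>_. borel))"
          by (intro measurable_restrict borel_measurable_min borel_measurable_const
              measurable_compose[OF _ idRp] measurable_component_singleton)
        ultimately have "(\<lambda>x. avg_trunc_weight M Z \<S> (\<lambda>e\<in>J. min (x e) M)) \<in> borel_measurable (PiM J (\<lambda>_. ?Rp))"
          by (rule measurable_compose[rotated])
        moreover have "avg_trunc_weight M Z \<S> (\<lambda>e\<in>J. min (x e) M) = avg_trunc_weight M Z \<S> (\<lambda>e. min (x e) M)" for x
          by (rule avg_trunc_weight_cong) (use SJ in auto)
        ultimately show ?thesis unfolding \<Phi>'_def by simp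
      qed
      have "(\<integral>x. exp (c * F x) \<partial>\<mu>) = (\<integral>x. \<Phi>' (restrict x J) \<partial>\<mu>)"
      proof (intro Bochner_Integration.integral_cong refl)
        fix x assume x: "x \<in> space \<mu>"
        have "avg_trunc_weight M Z \<S> (\<lambda>e. min (restrict x J e) M) = avg_trunc_weight M Z \<S> (\<lambda>e. min (x e) M)"
          by (rule avg_trunc_weight_cong) (use SJ in auto)
        also have "\<dots> = F x"
          unfolding F Z_def[symmetric] \<S>_def[symmetric] avg_trunc_weight_def
        proof (intro arg_cong2[where f = "(/)"] sum.cong refl trunc_min_weight_truncate \<S> Sfin)
          fix z S e assume "z \<in> Z" "S \<in> \<S> z" "e \<in> S"
          then have "e \<in> lattice_edges" using SJ J(2) by blast
          then show "0 \<le> x e" using nonneg[OF x] by blast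
        qed (use M in auto)
        finally show "exp (c * F x) = \<Phi>' (restrict x J)" unfolding \<Phi>'_def by simp
      qed
      also have "\<dots> = (\<integral>y. \<Phi>' (\<lambda>e\<in>J. (R (y e))\<^sup>2) \<partial>PiM J (\<lambda>_. std_normal_distribution))"
        unfolding mu \<nu> by (rule integral_PiM_distr_restrict[OF J real_dist_normal_dist _ _ \<Phi>'m]) auto
      also have "\<dots> = (\<integral>y. \<Phi> y \<partial>PiM J (\<lambda>_. std_normal_distribution))"
      proof -
        have "avg_trunc_weight M Z \<S> (\<lambda>e. min ((\<lambda>e\<in>J. (R (y e))\<^sup>2) e) M) = avg_trunc_weight M Z \<S> (\<lambda>e\<in>J. q\<^sub>M (y e))" for y
          by (rule avg_trunc_weight_cong) (use SJ in \<open>auto simp: qMin\<close>)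
        then show ?thesis unfolding \<Phi>_def \<Phi>'_def by simp
      qed
      finally show ?thesis ..
    qed
    ultimately show ?thesis by simp
  qed
  \<comment> \<open>The law \<open>\<nu>\<^sub>n\<close> of a truncated edge time made of \<open>n\<close> signs satisfies the moment conditions for
    large \<open>n\<close>, because the limit satisfies them with strict inequalities.\<close>
  define \<nu>\<^sub>n where "\<nu>\<^sub>n n = distr (sign_law n) ?Rp q\<^sub>M" for n
  have qRp: "q\<^sub>M \<in> measurable (sign_law n) ?Rp" for n
  proof (rule measurable_restrict_space2)
    show "q\<^sub>M \<in> borel_measurable (sign_law n)" by (simp add: sign_law_def)
  qed (use q0 in auto)
  have lap: "(\<lambda>n. \<integral>s. exp (c * q\<^sub>M s) \<partial>sign_law n) \<longlonglongrightarrow> (\<integral>s. exp (c * q\<^sub>M s) \<partial>std_normal_distribution)" for c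
  proof (rule weak_conv_imp_integral_bdd_continuous_conv)
    show "weak_conv_m sign_law std_normal_distribution" by (rule weak_conv_sign_law)
    show "isCont (\<lambda>s. exp (c * q\<^sub>M s)) s" for s using qct by (intro continuous_intros)
    show "norm (exp (c * q\<^sub>M s)) \<le> exp (\<bar>c\<bar> * M)" for s by (rule norm_exp_mult_le[OF q0 RMM])
  qed (auto intro: real_distribution_sign_law real_dist_normal_dist)
  have lapn: "(\<integral>\<^sup>+t. ennreal (exp (c * t)) \<partial>\<nu>\<^sub>n n) = ennreal (\<integral>s. exp (c * q\<^sub>M s) \<partial>sign_law n)" for c n
  proof -
    interpret S: real_distribution "sign_law n" by (rule real_distribution_sign_law)
    have "(\<integral>\<^sup>+t. ennreal (exp (c * t)) \<partial>\<nu>\<^sub>n n) = (\<integral>\<^sup>+s. ennreal (exp (c * q\<^sub>M s)) \<partial>sign_law n)"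
      unfolding \<nu>\<^sub>n_def
      by (subst nn_integral_distr[OF qRp]) (auto intro!: measurable_restrict_space1 simp: space_restrict_space)
    also have "\<dots> = ennreal (\<integral>s. exp (c * q\<^sub>M s) \<partial>sign_law n)"
    proof (rule nn_integral_eq_integral)
      show "integrable (sign_law n) (\<lambda>s. exp (c * q\<^sub>M s))"
      proof (rule S.integrable_const_bound[where B = "exp (\<bar>c\<bar> * M)"])
        show "AE s in sign_law n. norm (exp (c * q\<^sub>M s)) \<le> exp (\<bar>c\<bar> * M)"
          by (intro AE_I2 norm_exp_mult_le q0 RMM)
      qed (simp add: sign_law_def)
    qed simp
    finally show ?thesis .
  qed
  have lapnu: "(\<integral>\<^sup>+t. ennreal (exp (c * t)) \<partial>\<nu>) = (\<integral>\<^sup>+s. ennreal (exp (c * (R s)\<^sup>2)) \<partial>std_normal_distribution)" for c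
  proof -
    have "(\<lambda>s. (R s)\<^sup>2) \<in> measurable std_normal_distribution ?Rp"
      by (rule measurable_restrict_space2) auto
    then show ?thesis unfolding \<nu> by (subst nn_integral_distr) (auto intro!: measurable_restrict_space1)
  qed
  have gint: "ennreal (\<integral>s. exp (c * q\<^sub>M s) \<partial>std_normal_distribution) = (\<integral>\<^sup>+s. ennreal (exp (c * q\<^sub>M s)) \<partial>std_normal_distribution)" for c
  proof (rule nn_integral_eq_integral[symmetric])
    show "integrable std_normal_distribution (\<lambda>s. exp (c * q\<^sub>M s))"
    proof (rule G.integrable_const_bound[where B = "exp (\<bar>c\<bar> * M)"])
      show "AE s in std_normal_distribution. norm (exp (c * q\<^sub>M s)) \<le> exp (\<bar>c\<bar> * M)"
        by (intro AE_I2 norm_exp_mult_le q0 RMM)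
    qed simp
  qed simp
  have g1: "(\<integral>s. exp (\<delta> * q\<^sub>M s) \<partial>std_normal_distribution) < M0"
  proof -
    have "ennreal (\<integral>s. exp (\<delta> * q\<^sub>M s) \<partial>std_normal_distribution) \<le> (\<integral>\<^sup>+t. ennreal (exp (\<delta> * t)) \<partial>\<nu>)"
      unfolding gint lapnu using \<delta>(1)
      by (intro nn_integral_mono ennreal_leI) (auto simp: qMin intro!: mult_left_mono)
    also have "\<dots> < ennreal M0" by (rule \<delta>(2))
    finally show ?thesis using \<delta>(3) by (simp add: ennreal_less_iff)
  qed
  have g2: "(\<integral>s. exp (- \<kappa> * q\<^sub>M s) \<partial>std_normal_distribution) < q"
  proof -
    have "ennreal (\<integral>s. exp (- \<kappa> * q\<^sub>M s) \<partial>std_normal_distribution)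
        \<le> (\<integral>\<^sup>+s. ennreal (exp (- \<kappa> * (R s)\<^sup>2)) + ennreal (exp (- \<kappa> * M)) \<partial>std_normal_distribution)"
      unfolding gint
    proof (rule nn_integral_mono)
      fix s
      have "exp (- \<kappa> * q\<^sub>M s) \<le> exp (- \<kappa> * (R s)\<^sup>2) + exp (- \<kappa> * M)"
        unfolding qMin by (cases "(R s)\<^sup>2 \<le> M") auto
      then show "ennreal (exp (- \<kappa> * q\<^sub>M s)) \<le> ennreal (exp (- \<kappa> * (R s)\<^sup>2)) + ennreal (exp (- \<kappa> * M))"
        unfolding ennreal_plus[OF exp_ge_zero exp_ge_zero, symmetric] by (rule ennreal_leI)
    qed
    also have "\<dots> = (\<integral>\<^sup>+t. ennreal (exp (- \<kappa> * t)) \<partial>\<nu>) + ennreal (exp (- \<kappa> * M))"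
      unfolding lapnu using G.emeasure_space_1 by (subst nn_integral_add) auto
    also have "\<dots> < ennreal q" by (rule \<kappa>(2))
    finally show ?thesis using \<kappa>(3) by (simp add: ennreal_less_iff)
  qed
  have ev1: "eventually (\<lambda>n. (\<integral>s. exp (\<delta> * q\<^sub>M s) \<partial>sign_law n) < M0) sequentially"
    by (rule order_tendstoD(2)[OF lap g1])
  have ev2: "eventually (\<lambda>n. (\<integral>s. exp (- \<kappa> * q\<^sub>M s) \<partial>sign_law n) < q) sequentially"
    by (rule order_tendstoD(2)[OF lap g2])
  define \<eta> where "\<eta> n = 2 * L / sqrt (real n)" for n :: nat
  have \<eta>lim: "\<eta> \<longlonglongrightarrow> 0" unfolding \<eta>_def by real_asymp
  have ev3: "eventually (\<lambda>n. \<eta> n * (2 * sqrt M + \<eta> n) < 1) sequentially"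
  proof (rule order_tendstoD(2))
    show "(\<lambda>n. \<eta> n * (2 * sqrt M + \<eta> n)) \<longlonglongrightarrow> 0 * (2 * sqrt M + 0)" by (intro tendsto_intros \<eta>lim)
  qed simp
  have ev4: "eventually (\<lambda>n. 2 * (\<eta> n)\<^sup>2 * card J < M) sequentially"
  proof (rule order_tendstoD(2))
    show "(\<lambda>n. 2 * (\<eta> n)\<^sup>2 * card J) \<longlonglongrightarrow> 2 * (0 :: real)\<^sup>2 * real (card J)" by (intro tendsto_intros \<eta>lim)
  qed (use M in simp)
  define W where "W n A = exp (\<theta> / 2 * avg_trunc_weight M Z \<S> (x\<^sub>n n A))" for n A
  have W2: "(\<lambda>A. (W n A)\<^sup>2) = (\<lambda>A. exp (\<theta> * avg_trunc_weight M Z \<S> (x\<^sub>n n A)))" for n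
    unfolding W_def by (simp add: power2_eq_square exp_add[symmetric])
  have main: "eventually (\<lambda>n. cube_avg (A\<^sub>n n) (\<lambda>A. (W n A)\<^sup>2) - (cube_avg (A\<^sub>n n) (W n))\<^sup>2
    \<le> 144 * L\<^sup>2 * M * \<theta>\<^sup>2 * cube_avg (A\<^sub>n n) (\<lambda>A. (W n A)\<^sup>2) / ln (1 / \<rho>)) sequentially"
    using ev1 ev2 ev3 ev4 eventually_gt_at_top[of 0]
  proof eventually_elim
    case (elim n)
    show ?case
    proof (rule cube_exp_variance[where \<eta> = "\<eta> n" and J = J and Z = Z and \<S> = \<S> and R = RM and x = "x\<^sub>n n" and n = n])
      show "finite J" "finite Z" "Z \<noteq> {}" by (fact J Z)+
      show "finite (\<S> z)" "\<S> z \<noteq> {}" for z by (fact \<S>)+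
      show "S \<subseteq> J" if "z \<in> Z" "S \<in> \<S> z" for z S using that by (rule SJ)
      show "0 \<le> RM s" "(RM s)\<^sup>2 \<le> M" for s using RM0 RMM[of s] by (auto simp: q\<^sub>M_def)
      show "RM s \<le> RM t" "RM t - RM s \<le> L * (t - s)" if "s \<le> t" for s t using that RMmono RML by auto
      show "x\<^sub>n n A = (\<lambda>e. (RM (bit_sum n e A))\<^sup>2)" for A by (simp add: x\<^sub>n_def q\<^sub>M_def fun_eq_iff)
      show "\<eta> n * (2 * sqrt M + \<eta> n) \<le> 1" "2 * (\<eta> n)\<^sup>2 * card J \<le> M" using elim by auto
      show "cube_avg (A\<^sub>n n) (\<lambda>A. pivotal_freq M Z \<S> (x\<^sub>n n A) e) \<le> \<rho>" if e: "e \<in> J" for e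
      proof -
        interpret S: real_distribution "sign_law n" by (rule real_distribution_sign_law)
        interpret E: edge_times "\<nu>\<^sub>n n" "PiM lattice_edges (\<lambda>_. \<nu>\<^sub>n n) :: ((int ^ 'd) set \<Rightarrow> real) measure"
        proof (rule edge_times.intro)
          show "prob_space (\<nu>\<^sub>n n)" unfolding \<nu>\<^sub>n_def by (rule S.prob_space_distr[OF qRp])
          show "sets (\<nu>\<^sub>n n) = sets ?Rp" by (simp add: \<nu>\<^sub>n_def)
        qed (rule refl)
        define \<Phi> where "\<Phi> x = pivotal_freq M Z \<S> x e" for x
        have \<Phi>m: "\<Phi> \<in> borel_measurable (PiM J (\<lambda>_. K))" if "(\<lambda>t. t) \<in> borel_measurable K" for K
          unfolding \<Phi>_def using \<S> sumJ that by (intro borel_measurable_pivotal_freq)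
        have "(\<lambda>y. \<Phi> (\<lambda>e\<in>J. q\<^sub>M (y e))) \<in> borel_measurable (PiM J (\<lambda>_. borel))"
          by (rule measurable_compose[OF compq \<Phi>m]) simp
        moreover have "\<bar>\<Phi> x\<bar> \<le> 1" for x
        proof -
          have "(\<Sum>z\<in>Z. of_bool (e \<in> pivotal M (\<S> z) x) :: real) \<le> (\<Sum>z\<in>Z. 1)" by (intro sum_mono) simp
          moreover have "0 \<le> (\<Sum>z\<in>Z. of_bool (e \<in> pivotal M (\<S> z) x) :: real)" by (intro sum_nonneg) simp
          ultimately show ?thesis unfolding \<Phi>_def pivotal_freq_def using Z by (simp add: divide_le_eq_1 card_gt_0_iff)
        qed
        ultimately have e1: "(\<integral>y. \<Phi> (\<lambda>e\<in>J. q\<^sub>M (y e)) \<partial>PiM J (\<lambda>_. sign_law n))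
            = cube_avg (A\<^sub>n n) (\<lambda>A. \<Phi> (\<lambda>e\<in>J. q\<^sub>M ((\<lambda>e\<in>J. sign_sum n {i. i < n \<and> (e, i) \<in> A}) e)))"
          unfolding A\<^sub>n_def by (rule cube_avg_PiM_sign_law[OF J(1)])
        have e2: "\<Phi> (\<lambda>e\<in>J. q\<^sub>M ((\<lambda>e\<in>J. sign_sum n {i. i < n \<and> (e, i) \<in> A}) e)) = \<Phi> (x\<^sub>n n A)" for A
          unfolding \<Phi>_def by (rule pivotal_freq_cong) (use SJ in \<open>auto simp: x\<^sub>n_def bit_sum_eq_sign_sum\<close>)
        have e3: "(\<integral>y. \<Phi> (\<lambda>e\<in>J. q\<^sub>M (y e)) \<partial>PiM J (\<lambda>_. sign_law n))
            = (\<integral>x. \<Phi> (restrict x J) \<partial>PiM lattice_edges (\<lambda>_. \<nu>\<^sub>n n))"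
          unfolding \<nu>\<^sub>n_def
          by (rule integral_PiM_distr_restrict[symmetric, OF J real_distribution_sign_law qm q0 \<Phi>m[OF idRp]])
        have e4: "\<Phi> (restrict x J) = pivotal_freq M (lattice_box m) (path_family k v) x e" for x
          unfolding \<Phi>_def Z_def[symmetric] \<S>_def[symmetric] by (rule pivotal_freq_cong) (use SJ in auto)
        have "(\<integral>x. pivotal_freq M (lattice_box m) (path_family k v) x e \<partial>PiM lattice_edges (\<lambda>_. \<nu>\<^sub>n n)) \<le> \<rho>"
          unfolding \<rho>(1)
        proof (rule E.expected_pivotal_freq_le[OF \<delta>(1) _ \<delta>(3) \<kappa>(1) _ \<kappa>(3,4) m k _ N r])
          show "(\<integral>\<^sup>+t. ennreal (exp (\<delta> * t)) \<partial>\<nu>\<^sub>n n) \<le> ennreal M0"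
            unfolding lapn using elim by (intro ennreal_leI) simp
          show "(\<integral>\<^sup>+t. ennreal (exp (- \<kappa> * t)) \<partial>\<nu>\<^sub>n n) \<le> ennreal q"
            unfolding lapn using elim by (intro ennreal_leI) simp
          show "e \<in> lattice_edges" using e J by blast
        qed
        then have "(\<integral>x. \<Phi> (restrict x J) \<partial>PiM lattice_edges (\<lambda>_. \<nu>\<^sub>n n)) \<le> \<rho>"
          unfolding e4 .
        then have "cube_avg (A\<^sub>n n) (\<lambda>A. \<Phi> (x\<^sub>n n A)) \<le> \<rho>"
          using e1 unfolding e2 e3 by linarith
        then show ?thesis unfolding \<Phi>_def .
      qed
    qed (use R(4) M elim \<rho>0 \<rho>(2) \<theta> in \<open>auto simp: \<eta>_def A\<^sub>n_def W_def\<close>)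
  qed
  have l1: "(\<lambda>n. cube_avg (A\<^sub>n n) (\<lambda>A. (W n A)\<^sup>2)) \<longlonglongrightarrow> (\<integral>x. exp (\<theta> * F x) \<partial>\<mu>)"
    unfolding W2 by (rule lim[OF \<theta>])
  have l2: "(\<lambda>n. cube_avg (A\<^sub>n n) (W n)) \<longlonglongrightarrow> (\<integral>x. exp (\<theta> / 2 * F x) \<partial>\<mu>)"
    unfolding W_def[abs_def] by (rule lim) (use \<theta> in simp)
  have "ln (1 / \<rho>) \<noteq> 0" using \<rho>0 \<rho>(2) by simp
  then show ?thesis
    by (intro tendsto_le[OF sequentially_bot _ _ main] tendsto_intros l1 l2)
qed

end

section \<open>From variances of exponentials to exponential tails\<close>

text \<open>The variance inequality at \<open>\<theta>\<close> bounds the moment generating function at \<open>\<theta>\<close> by the square of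
  its value at \<open>\<theta> / 2\<close>, up to the factor \<open>1 / (1 - K \<theta>\<^sup>2)\<close>. Iteration reduces to an argument near
  \<open>0\<close>, where Hoeffding's lemma applies, and the factors have a convergent product.\<close>

lemma (in prob_space) exp_moment_of_exp_variance:
  fixes X :: "'a \<Rightarrow> real"
  assumes X: "random_variable borel X" and b: "\<And>x. x \<in> space M \<Longrightarrow> 0 \<le> X x \<and> X x \<le> B"
    and K: "K \<ge> 1 / 2"
    and var: "\<And>\<theta>. \<bar>\<theta>\<bar> \<le> 1 \<Longrightarrow>
      expectation (\<lambda>x. exp (\<theta> * X x)) - (expectation (\<lambda>x. exp (\<theta> / 2 * X x)))\<^sup>2
        \<le> K * \<theta>\<^sup>2 * expectation (\<lambda>x. exp (\<theta> * X x))"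
    and \<theta>: "2 * K * \<theta>\<^sup>2 \<le> 1"
  shows "expectation (\<lambda>x. exp (\<theta> * (X x - expectation X))) \<le> exp 2"
proof -
  note [measurable] = X
  define a where "a = expectation X"
  define m where "m t = expectation (\<lambda>x. exp (t * (X x - a)))" for t
  have B0: "0 \<le> B" using b not_empty by (meson all_not_in_conv order_trans)
  have me: "m t = exp (- t * a) * expectation (\<lambda>x. exp (t * X x))" for t
  proof -
    have "m t = expectation (\<lambda>x. exp (- t * a) * exp (t * X x))"
      unfolding m_def by (intro Bochner_Integration.integral_cong) (auto simp: exp_add[symmetric] algebra_simps)
    then show ?thesis by simp
  qed
  have m0: "0 \<le> m t" for t unfolding m_def by (intro Bochner_Integration.integral_nonneg) simp
  have step: "m t \<le> (m (t / 2))\<^sup>2 * exp (2 * K * t\<^sup>2)" if t: "2 * K * t\<^sup>2 \<le> 1" for t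
  proof -
    have "1 * t\<^sup>2 \<le> 2 * K * t\<^sup>2" using K by (intro mult_right_mono) auto
    then have "\<bar>t\<bar>\<^sup>2 \<le> 1" using t by simp
    then have t1: "\<bar>t\<bar> \<le> 1" using abs_square_le_1 by auto
    define u where "u = K * t\<^sup>2"
    have u: "0 \<le> u" "u \<le> 1 / 2" using K t by (auto simp: u_def)
    have "m t - (m (t / 2))\<^sup>2
        = exp (- t * a) * (expectation (\<lambda>x. exp (t * X x)) - (expectation (\<lambda>x. exp (t / 2 * X x)))\<^sup>2)"
    proof -
      have "(exp (- (t / 2) * a))\<^sup>2 = exp (- t * a)" by (simp add: power2_eq_square exp_add[symmetric])
      then show ?thesis unfolding me by (simp add: power_mult_distrib right_diff_distrib)
    qed
    also have "\<dots> \<le> exp (- t * a) * (K * t\<^sup>2 * expectation (\<lambda>x. exp (t * X x)))"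
      by (intro mult_left_mono var t1) simp
    also have "\<dots> = u * m t" unfolding me u_def by simp
    finally have "(1 - u) * m t \<le> (m (t / 2))\<^sup>2" by (simp add: left_diff_distrib)
    have "1 / (1 - u) = 1 + u / (1 - u)" using u by (simp add: field_simps)
    also have "\<dots> \<le> exp (u / (1 - u))" by (rule exp_ge_add_one_self)
    also have "\<dots> \<le> exp (2 * u)"
    proof -
      have "u \<le> (2 * u) * (1 - u)"
      proof -
        have "0 \<le> u * (1 - 2 * u)" using u by (intro mult_nonneg_nonneg) auto
        then show ?thesis by (simp add: algebra_simps)
      qed
      then show ?thesis using u by (simp add: divide_le_eq)
    qed
    finally have e: "1 / (1 - u) \<le> exp (2 * u)" .
    have "m t \<le> (m (t / 2))\<^sup>2 * (1 / (1 - u))"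
      using \<open>(1 - u) * m t \<le> (m (t / 2))\<^sup>2\<close> u by (simp add: pos_le_divide_eq mult.commute)
    also have "\<dots> \<le> (m (t / 2))\<^sup>2 * exp (2 * u)" using e by (intro mult_left_mono) auto
    finally show ?thesis by (simp add: u_def mult.assoc)
  qed
  have iter: "m \<theta> \<le> m (\<theta> / 2 ^ j) ^ (2 ^ j) * exp (4 * K * \<theta>\<^sup>2 * (1 - 1 / 2 ^ j))" for j
  proof (induction j)
    case (Suc j)
    have sq: "(\<theta> / 2 ^ j)\<^sup>2 = \<theta>\<^sup>2 / (2 ^ j * 2 ^ j)" by (simp add: power2_eq_square)
    have le: "2 * K * (\<theta> / 2 ^ j)\<^sup>2 \<le> 1"
    proof -
      have "(\<theta> / 2 ^ j)\<^sup>2 \<le> \<theta>\<^sup>2"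
      proof -
        have "\<theta>\<^sup>2 / (2 ^ j * 2 ^ j) \<le> \<theta>\<^sup>2 / 1"
          using mult_mono[of 1 "2 ^ j :: real" 1 "2 ^ j"] by (intro divide_left_mono) auto
        then show ?thesis by (simp add: sq)
      qed
      then have "2 * K * (\<theta> / 2 ^ j)\<^sup>2 \<le> 2 * K * \<theta>\<^sup>2" using K by (intro mult_left_mono) auto
      then show ?thesis using \<theta> by simp
    qed
    have "m (\<theta> / 2 ^ j) ^ (2 ^ j) \<le> ((m (\<theta> / 2 ^ j / 2))\<^sup>2 * exp (2 * K * (\<theta> / 2 ^ j)\<^sup>2)) ^ (2 ^ j)"
      by (intro power_mono step le m0)
    also have "\<dots> = m (\<theta> / 2 ^ Suc j) ^ (2 ^ Suc j) * exp (2 * K * \<theta>\<^sup>2 / 2 ^ j)"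
    proof -
      have "real (2 ^ j) * (2 * K * (\<theta> / 2 ^ j)\<^sup>2) = 2 * K * \<theta>\<^sup>2 / 2 ^ j"
        unfolding sq by (simp add: field_simps)
      then have "exp (2 * K * (\<theta> / 2 ^ j)\<^sup>2) ^ (2 ^ j) = exp (2 * K * \<theta>\<^sup>2 / 2 ^ j)"
        by (metis exp_of_nat_mult)
      moreover have "\<theta> / 2 ^ j / 2 = \<theta> / 2 ^ Suc j" by (simp add: field_simps)
      ultimately show ?thesis by (simp add: power_mult_distrib power_mult mult.commute)
    qed
    finally have "m \<theta> \<le> m (\<theta> / 2 ^ Suc j) ^ (2 ^ Suc j) * exp (2 * K * \<theta>\<^sup>2 / 2 ^ j) * exp (4 * K * \<theta>\<^sup>2 * (1 - 1 / 2 ^ j))"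
      using Suc.IH by (meson exp_ge_zero mult_right_mono order_trans)
    also have "\<dots> = m (\<theta> / 2 ^ Suc j) ^ (2 ^ Suc j) * exp (4 * K * \<theta>\<^sup>2 * (1 - 1 / 2 ^ Suc j))"
      unfolding mult.assoc exp_add[symmetric] by (simp add: field_simps)
    finally show ?case .
  qed simp
  have hoeff: "m t \<le> exp (t\<^sup>2 * B\<^sup>2 / 8)" for t
  proof -
    have pos: "expectation (\<lambda>x. exp (l * (Y x - expectation Y))) \<le> exp (l\<^sup>2 * (d - c)\<^sup>2 / 8)"
      if "l > 0" "random_variable borel Y" "\<And>x. x \<in> space M \<Longrightarrow> Y x \<in> {c..d}" for l c d and Y :: "'a \<Rightarrow> real"
    proof -
      interpret I: interval_bounded_random_variable M Y c d
        by unfold_locales (use that in auto)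
      show ?thesis
        by (rule integral_real_bounded) (use I.Hoeffdings_lemma_nn_integral[OF that(1)] in simp_all)
    qed
    consider "t > 0" | "t = 0" | "t < 0" by linarith
    then show ?thesis
    proof cases
      case 1
      then show ?thesis using pos[of t X 0 B] b X unfolding m_def a_def by simp
    next
      case 2
      then show ?thesis by (simp add: m_def prob_space)
    next
      case 3
      have "- X x \<in> {- B..0}" if "x \<in> space M" for x using b[OF that] by simp
      then have "expectation (\<lambda>x. exp (- t * (- X x - expectation (\<lambda>x. - X x)))) \<le> exp ((- t)\<^sup>2 * (0 - - B)\<^sup>2 / 8)"
        using 3 by (intro pos) auto
      moreover have "- t * (- X x - expectation (\<lambda>x. - X x)) = t * (X x - a)" for x
        unfolding a_def by (simp add: algebra_simps)
      ultimately show ?thesis unfolding m_def by simp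
    qed
  qed
  have "m \<theta> \<le> exp (\<theta>\<^sup>2 * B\<^sup>2 / 8 / 2 ^ j + 4 * K * \<theta>\<^sup>2)" for j
  proof -
    have "m (\<theta> / 2 ^ j) ^ (2 ^ j) \<le> exp ((\<theta> / 2 ^ j)\<^sup>2 * B\<^sup>2 / 8) ^ (2 ^ j)"
      by (intro power_mono hoeff m0)
    also have "\<dots> = exp (\<theta>\<^sup>2 * B\<^sup>2 / 8 / 2 ^ j)"
    proof -
      have "real (2 ^ j) * ((\<theta> / 2 ^ j)\<^sup>2 * B\<^sup>2 / 8) = \<theta>\<^sup>2 * B\<^sup>2 / 8 / 2 ^ j"
        by (simp add: power2_eq_square field_simps)
      then show ?thesis by (metis exp_of_nat_mult)
    qed
    finally have 1: "m (\<theta> / 2 ^ j) ^ (2 ^ j) \<le> exp (\<theta>\<^sup>2 * B\<^sup>2 / 8 / 2 ^ j)" .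
    have 2: "exp (4 * K * \<theta>\<^sup>2 * (1 - 1 / 2 ^ j)) \<le> exp (4 * K * \<theta>\<^sup>2)"
    proof -
      have "4 * K * \<theta>\<^sup>2 * (1 - 1 / 2 ^ j) \<le> 4 * K * \<theta>\<^sup>2 * 1" using K by (intro mult_left_mono) auto
      then show ?thesis by simp
    qed
    have "m \<theta> \<le> exp (\<theta>\<^sup>2 * B\<^sup>2 / 8 / 2 ^ j) * exp (4 * K * \<theta>\<^sup>2)"
      by (rule order_trans[OF iter mult_mono[OF 1 2]]) auto
    then show ?thesis by (simp add: exp_add)
  qed
  moreover have "(\<lambda>j. exp (\<theta>\<^sup>2 * B\<^sup>2 / 8 / 2 ^ j + 4 * K * \<theta>\<^sup>2)) \<longlonglongrightarrow> exp (0 + 4 * K * \<theta>\<^sup>2)"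
  proof (intro tendsto_intros)
    have "(\<lambda>j. \<theta>\<^sup>2 * B\<^sup>2 / 8 * (1 / 2) ^ j) \<longlonglongrightarrow> \<theta>\<^sup>2 * B\<^sup>2 / 8 * 0"
      by (intro tendsto_intros LIMSEQ_power_zero) simp
    then show "(\<lambda>j. \<theta>\<^sup>2 * B\<^sup>2 / 8 / 2 ^ j) \<longlonglongrightarrow> 0" by (simp add: power_divide)
  qed
  ultimately have "m \<theta> \<le> exp (0 + 4 * K * \<theta>\<^sup>2)"
    by (intro LIMSEQ_le_const) auto
  also have "\<dots> \<le> exp 2" using \<theta> by simp
  finally show ?thesis unfolding m_def a_def .
qed

lemma (in prob_space) tail_of_exp_variance:
  fixes X :: "'a \<Rightarrow> real"
  assumes X: "random_variable borel X" and b: "\<And>x. x \<in> space M \<Longrightarrow> 0 \<le> X x \<and> X x \<le> B"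
    and K: "K \<ge> 1 / 2"
    and var: "\<And>\<theta>. \<bar>\<theta>\<bar> \<le> 1 \<Longrightarrow>
      expectation (\<lambda>x. exp (\<theta> * X x)) - (expectation (\<lambda>x. exp (\<theta> / 2 * X x)))\<^sup>2
        \<le> K * \<theta>\<^sup>2 * expectation (\<lambda>x. exp (\<theta> * X x))"
  shows "prob {x \<in> space M. \<bar>X x - expectation X\<bar> \<ge> s} \<le> 2 * exp 2 * exp (- s / sqrt (2 * K))"
proof -
  note [measurable] = X
  define t where "t = 1 / sqrt (2 * K)"
  have t0: "t > 0" using K by (simp add: t_def)
  have t2: "2 * K * t\<^sup>2 \<le> 1" "2 * K * (- t)\<^sup>2 \<le> 1" using K by (simp_all add: t_def power_divide)
  define a where "a = expectation X"
  have int: "integrable M (\<lambda>x. exp (c * (X x - a)))" for c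
  proof (rule integrable_const_bound[where B = "exp (\<bar>c\<bar> * (B + \<bar>a\<bar>))"])
    show "AE x in M. norm (exp (c * (X x - a))) \<le> exp (\<bar>c\<bar> * (B + \<bar>a\<bar>))"
    proof (rule AE_I2)
      fix x assume "x \<in> space M"
      then have "\<bar>X x - a\<bar> \<le> B + \<bar>a\<bar>" using b by fastforce
      then have "\<bar>c\<bar> * \<bar>X x - a\<bar> \<le> \<bar>c\<bar> * (B + \<bar>a\<bar>)" by (rule mult_left_mono) simp
      moreover have "c * (X x - a) \<le> \<bar>c\<bar> * \<bar>X x - a\<bar>" by (metis abs_ge_self abs_mult)
      ultimately show "norm (exp (c * (X x - a))) \<le> exp (\<bar>c\<bar> * (B + \<bar>a\<bar>))" by simp
    qed
  qed measurable
  have one: "prob {x \<in> space M. exp (c * (X x - a)) \<ge> exp (t * s)} \<le> exp 2 * exp (- t * s)"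
    if "2 * K * c\<^sup>2 \<le> 1" for c
  proof -
    have "prob {x \<in> space M. exp (c * (X x - a)) \<ge> exp (t * s)} \<le> expectation (\<lambda>x. exp (c * (X x - a))) / exp (t * s)"
      by (rule integral_Markov_inequality_measure[where A = "space M"]) (use int in auto)
    also have "\<dots> \<le> exp 2 / exp (t * s)"
    proof (rule divide_right_mono)
      show "expectation (\<lambda>x. exp (c * (X x - a))) \<le> exp 2"
        unfolding a_def
      proof (rule exp_moment_of_exp_variance)
        show "random_variable borel X" "K \<ge> 1 / 2" "2 * K * c\<^sup>2 \<le> 1" by fact+
        show "0 \<le> X x \<and> X x \<le> B" if "x \<in> space M" for x using that by (rule b)
        show "expectation (\<lambda>x. exp (\<theta> * X x)) - (expectation (\<lambda>x. exp (\<theta> / 2 * X x)))\<^sup>2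
            \<le> K * \<theta>\<^sup>2 * expectation (\<lambda>x. exp (\<theta> * X x))" if "\<bar>\<theta>\<bar> \<le> 1" for \<theta> using that by (rule var)
      qed
    qed simp
    finally show ?thesis by (simp add: exp_minus divide_inverse)
  qed
  have "{x \<in> space M. \<bar>X x - a\<bar> \<ge> s} \<subseteq> {x \<in> space M. exp (t * (X x - a)) \<ge> exp (t * s)} \<union> {x \<in> space M. exp (- t * (X x - a)) \<ge> exp (t * s)}"
  proof
    fix x assume "x \<in> {x \<in> space M. \<bar>X x - a\<bar> \<ge> s}"
    then have x: "x \<in> space M" "s \<le> X x - a \<or> s \<le> - (X x - a)" by auto
    have "t * s \<le> t * (X x - a) \<or> t * s \<le> t * (- (X x - a))"
      using x(2) t0 mult_left_mono[of s _ t] by (auto intro: less_imp_le)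
    then have "t * s \<le> t * (X x - a) \<or> t * s \<le> - t * (X x - a)"
      by (simp only: mult_minus_right mult_minus_left)
    then show "x \<in> {x \<in> space M. exp (t * (X x - a)) \<ge> exp (t * s)} \<union> {x \<in> space M. exp (- t * (X x - a)) \<ge> exp (t * s)}"
      using x(1) by (simp only: exp_le_cancel_iff mem_Collect_eq Un_iff) blast
  qed
  then have "prob {x \<in> space M. \<bar>X x - a\<bar> \<ge> s} \<le> prob ({x \<in> space M. exp (t * (X x - a)) \<ge> exp (t * s)} \<union> {x \<in> space M. exp (- t * (X x - a)) \<ge> exp (t * s)})"
    by (intro finite_measure_mono) auto
  also have "\<dots> \<le> prob {x \<in> space M. exp (t * (X x - a)) \<ge> exp (t * s)} + prob {x \<in> space M. exp (- t * (X x - a)) \<ge> exp (t * s)}"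
    by (intro measure_Un_le) auto
  also have "\<dots> \<le> exp 2 * exp (- t * s) + exp 2 * exp (- t * s)"
    by (intro add_mono one t2)
  finally show ?thesis unfolding a_def t_def by (simp add: divide_inverse mult.commute)
qed

section \<open>Concentration of the passage time\<close>

context edge_times
begin

text \<open>Every path that is nearly optimal, without restriction on its length, belongs to the families
  of large index.\<close>

lemma min_weight_path_family_tendsto:
  fixes v z :: "int ^ 'd"
  assumes x: "x \<in> space \<mu>"
  shows "(\<lambda>k. min_weight (path_family k v z) x) \<longlonglongrightarrow> passage_time x z (z + v)"
proof -
  define y where "y = shift z x"
  have y: "\<forall>e\<in>lattice_edges. 0 \<le> y e" unfolding y_def by (rule shift_nonneg[OF nonneg[OF x]])
  have pt: "passage_time x z (z + v) = passage_time y 0 v" unfolding y_def passage_time_shift by simp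
  show ?thesis
    unfolding pt min_weight_path_family[of _ v z] y_def[symmetric]
  proof (rule LIMSEQ_I)
    fix \<epsilon> :: real assume "\<epsilon> > 0"
    then obtain p where p: "lattice_path 0 p v" "distinct p" "list_weight y p < passage_time y 0 v + \<epsilon>"
      using passage_time_approx[OF y, of 0 v "passage_time y 0 v + \<epsilon>"] by auto
    show "\<exists>n0. \<forall>k\<ge>n0. norm (min_weight (path_family k v 0) y - passage_time y 0 v) < \<epsilon>"
    proof (intro exI allI impI)
      fix k assume "length p \<le> k"
      then have pk: "p \<in> simple_paths k v" using p by (simp add: simple_paths_def)
      have fin: "finite (path_family k v 0)" by (rule finite_path_family)
      have "min_weight (path_family k v 0) y \<le> sum y (path_edges p)"
        by (rule min_weight_le[OF fin]) (use pk in \<open>auto simp: path_family_0\<close>)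
      also have "\<dots> < passage_time y 0 v + \<epsilon>" using p distinct_path_edges(1)[OF p(2), of y] by simp
      finally have "min_weight (path_family k v 0) y < passage_time y 0 v + \<epsilon>" .
      moreover have "passage_time y 0 v \<le> min_weight (path_family k v 0) y"
      proof (rule min_weight_greatest[OF fin])
        show "path_family k v 0 \<noteq> {}" using pk by (auto simp: path_family_0)
        show "passage_time y 0 v \<le> sum y S" if "S \<in> path_family k v 0" for S
          using that passage_time_le_sum[OF y] by (auto simp: path_family_0 simple_paths_def)
      qed
      ultimately show "norm (min_weight (path_family k v 0) y - passage_time y 0 v) < \<epsilon>" by simp
    qed
  qed
qed

lemma measurable_passage_time: "(\<lambda>x. passage_time x z (z + v)) \<in> borel_measurable \<mu>"
  by (rule borel_measurable_LIMSEQ_real[OF min_weight_path_family_tendsto measurable_min_weight])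

definition avg_passage :: "nat \<Rightarrow> real \<Rightarrow> int ^ 'd \<Rightarrow> ((int ^ 'd) set \<Rightarrow> real) \<Rightarrow> real" where
  "avg_passage m M v x = (\<Sum>z\<in>lattice_box m. min M (passage_time x z (z + v))) / card (lattice_box m :: (int ^ 'd) set)"

lemma measurable_avg_passage: "avg_passage m M v \<in> borel_measurable \<mu>"
  unfolding avg_passage_def[abs_def]
  by (intro borel_measurable_divide borel_measurable_sum borel_measurable_min borel_measurable_const measurable_passage_time)

lemma card_lattice_box_pos: "m \<ge> 1 \<Longrightarrow> real (card (lattice_box m :: (int ^ 'd) set)) > 0"
  by (simp add: card_lattice_box)

lemma avg_passage_bounds:
  assumes x: "x \<in> space \<mu>" and M: "M \<ge> 0" and m: "m \<ge> 1"
  shows "0 \<le> avg_passage m M v x" "avg_passage m M v x \<le> M"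
proof -
  have "0 \<le> min M (passage_time x z (z + v))" for z using passage_time_nonneg[OF nonneg[OF x]] M by simp
  then show "0 \<le> avg_passage m M v x" unfolding avg_passage_def by (intro divide_nonneg_nonneg sum_nonneg) auto
  have "(\<Sum>z\<in>lattice_box m. min M (passage_time x z (z + v))) \<le> (\<Sum>z\<in>(lattice_box m :: (int ^ 'd) set). M)"
    by (intro sum_mono) simp
  then show "avg_passage m M v x \<le> M"
    unfolding avg_passage_def using card_lattice_box_pos[OF m] by (simp add: divide_le_eq mult.commute)
qed

text \<open>The bound for path families does not depend on the maximal number \<open>k\<close> of vertices, which can
  therefore tend to infinity.\<close>

lemma exp_variance_avg_passage:
  fixes v :: "int ^ 'd" and R :: "real \<Rightarrow> real"
  assumes R: "\<And>s. 0 \<le> R s" "mono R" "\<And>s t. s \<le> t \<Longrightarrow> R t - R s \<le> L * (t - s)" "L > 0"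
    and \<nu>: "\<nu> = distr std_normal_distribution (restrict_space borel {0..}) (\<lambda>s. (R s)\<^sup>2)"
    and \<delta>: "\<delta> > 0" "(\<integral>\<^sup>+t. ennreal (exp (\<delta> * t)) \<partial>\<nu>) < ennreal M0" "M0 \<ge> 1"
    and \<kappa>: "\<kappa> \<ge> 0" "(\<integral>\<^sup>+t. ennreal (exp (- \<kappa> * t)) \<partial>\<nu>) + ennreal (exp (- \<kappa> * M)) < ennreal q" "q \<ge> 0"
      "exp 1 * real (lattice_degree TYPE('d)) * q \<le> 1 / 2"
    and m: "m \<ge> 1" and M: "M > 0"
    and N: "N = real (m ^ CARD('d))" and r: "r = CARD('d) * m"
    and \<rho>: "\<rho> = (3 + real r + ln N + \<kappa> / \<delta> * (2 * ln N + real r * ln M0 + 1)) / N" "\<rho> < 1" "\<rho> > 0"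
    and \<theta>: "\<bar>\<theta>\<bar> \<le> 1"
  shows "(\<integral>x. exp (\<theta> * avg_passage m M v x) \<partial>\<mu>) - (\<integral>x. exp (\<theta> / 2 * avg_passage m M v x) \<partial>\<mu>)\<^sup>2
    \<le> 144 * L\<^sup>2 * M * \<theta>\<^sup>2 * (\<integral>x. exp (\<theta> * avg_passage m M v x) \<partial>\<mu>) / ln (1 / \<rho>)"
proof -
  let ?Z = "lattice_box m :: (int ^ 'd) set"
  define F where "F k = avg_trunc_weight M ?Z (path_family k v)" for k
  define k0 where "k0 = length (short_path 0 v)"
  have k: "simple_paths k v \<noteq> {}" if "k \<ge> k0" for k
    using short_path(1,2)[of 0 v] that unfolding simple_paths_def k0_def by blast
  have Z: "finite ?Z" "?Z \<noteq> {}"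
    using finite_lattice_box card_lattice_box_pos[OF m] by auto
  have Fb: "0 \<le> F k x" "F k x \<le> M" if "x \<in> space \<mu>" "k \<ge> k0" for k x
  proof -
    have ne: "path_family k v z \<noteq> {}" for z using k[OF that(2)] by (simp add: path_family_def)
    have x0: "0 \<le> x e" if "S \<in> path_family k v z" "e \<in> S" for z S e
      using nonneg[OF \<open>x \<in> space \<mu>\<close>] path_family_edges(2)[OF that(1)] that(2) by blast
    have fin: "finite (path_family k v z)" for z by (rule finite_path_family)
    have M': "0 \<le> M" using M by simp
    show "0 \<le> F k x" unfolding F_def
      by (rule avg_trunc_weight_bounds(1)) (use Z M' ne fin x0 in blast)+
    show "F k x \<le> M" unfolding F_def
      by (rule avg_trunc_weight_bounds(2)) (use Z M' ne fin x0 in blast)+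
  qed
  have Fm: "F k \<in> borel_measurable \<mu>" for k
    unfolding F_def
    by (intro borel_measurable_avg_trunc_weight finite_path_family measurable_sum_edges path_family_edges(2))
  have lim: "(\<lambda>k. \<integral>x. exp (c * F (k + k0) x) \<partial>\<mu>) \<longlonglongrightarrow> (\<integral>x. exp (c * avg_passage m M v x) \<partial>\<mu>)"
    if c: "\<bar>c\<bar> \<le> 1" for c
  proof (rule integral_dominated_convergence[where w = "\<lambda>_. exp M"])
    show "AE x in \<mu>. (\<lambda>k. exp (c * F (k + k0) x)) \<longlonglongrightarrow> exp (c * avg_passage m M v x)"
    proof (rule AE_I2)
      fix x assume x: "x \<in> space \<mu>"
      have "(\<lambda>k. F k x) \<longlonglongrightarrow> avg_passage m M v x"
        unfolding F_def avg_trunc_weight_def avg_passage_def trunc_min_weight_def divide_inverse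
        by (intro tendsto_mult tendsto_sum tendsto_min tendsto_const min_weight_path_family_tendsto[OF x])
      then have "(\<lambda>k. F (k + k0) x) \<longlonglongrightarrow> avg_passage m M v x" by (rule LIMSEQ_ignore_initial_segment)
      then show "(\<lambda>k. exp (c * F (k + k0) x)) \<longlonglongrightarrow> exp (c * avg_passage m M v x)"
        by (intro tendsto_intros)
    qed
    show "AE x in \<mu>. norm (exp (c * F (k + k0) x)) \<le> exp M" for k
    proof (rule AE_I2)
      fix x assume x: "x \<in> space \<mu>"
      show "norm (exp (c * F (k + k0) x)) \<le> exp M"
        using abs_exp_mult_le[OF c Fb[OF x, of "k + k0"]] by simp
    qed
    show "(\<lambda>x. exp (c * F (k + k0) x)) \<in> borel_measurable \<mu>" for k
      using Fm[of "k + k0"] by measurable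
    show "(\<lambda>x. exp (c * avg_passage m M v x)) \<in> borel_measurable \<mu>"
      using measurable_avg_passage[of m M v] by measurable
  qed simp
  have main: "(\<integral>x. exp (\<theta> * F (k + k0) x) \<partial>\<mu>) - (\<integral>x. exp (\<theta> / 2 * F (k + k0) x) \<partial>\<mu>)\<^sup>2
    \<le> 144 * L\<^sup>2 * M * \<theta>\<^sup>2 * (\<integral>x. exp (\<theta> * F (k + k0) x) \<partial>\<mu>) / ln (1 / \<rho>)" for k
  proof (rule exp_variance_path_family[where F = "F (k + k0)"])
    show "simple_paths (k + k0) v \<noteq> {}" by (rule k) simp
    show "F (k + k0) = avg_trunc_weight M ?Z (path_family (k + k0) v)" by (rule F_def)
  qed (fact R(1) R(2) R(3) R(4) \<nu> \<delta>(1) \<delta>(2) \<delta>(3) \<kappa>(1) \<kappa>(2) \<kappa>(3) \<kappa>(4) m M N r \<rho>(1) \<rho>(2) \<theta>)+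
  have ev: "eventually (\<lambda>k. (\<integral>x. exp (\<theta> * F (k + k0) x) \<partial>\<mu>) - (\<integral>x. exp (\<theta> / 2 * F (k + k0) x) \<partial>\<mu>)\<^sup>2
    \<le> 144 * L\<^sup>2 * M * \<theta>\<^sup>2 * (\<integral>x. exp (\<theta> * F (k + k0) x) \<partial>\<mu>) / ln (1 / \<rho>)) sequentially"
    by (intro always_eventually allI main)
  have l1: "(\<lambda>k. \<integral>x. exp (\<theta> * F (k + k0) x) \<partial>\<mu>) \<longlonglongrightarrow> (\<integral>x. exp (\<theta> * avg_passage m M v x) \<partial>\<mu>)"
    by (rule lim[OF \<theta>])
  have l2: "(\<lambda>k. \<integral>x. exp (\<theta> / 2 * F (k + k0) x) \<partial>\<mu>) \<longlonglongrightarrow> (\<integral>x. exp (\<theta> / 2 * avg_passage m M v x) \<partial>\<mu>)"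
    by (rule lim) (use \<theta> in simp)
  have "ln (1 / \<rho>) \<noteq> 0" using \<rho>(2,3) by simp
  then show ?thesis
    by (intro tendsto_le[OF sequentially_bot _ _ ev] tendsto_intros l1 l2)
qed

lemma mean_le_integral: "mean_le f b \<Longrightarrow> integrable \<mu> f \<and> (\<integral>x. f x \<partial>\<mu>) \<le> b"
  unfolding mean_le_def
  by (auto intro!: integrableI_nonneg integral_real_bounded intro: le_less_trans[OF _ ennreal_less_top])

lemma prob_ge_le_mean:
  assumes "mean_le f b" "c > 0"
  shows "prob {x \<in> space \<mu>. f x \<ge> c} \<le> b / c"
proof -
  have "prob {x \<in> space \<mu>. f x \<ge> c} \<le> (\<integral>x. f x \<partial>\<mu>) / c"
    by (rule integral_Markov_inequality_measure[where A = "space \<mu>"])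
      (use assms mean_le_integral in \<open>auto simp: mean_le_def\<close>)
  also have "\<dots> \<le> b / c" using assms mean_le_integral by (intro divide_right_mono) auto
  finally show ?thesis .
qed

lemma prob_short_path_ge:
  assumes \<delta>: "\<delta> > 0" "(\<integral>\<^sup>+t. ennreal (exp (\<delta> * t)) \<partial>\<nu>) \<le> ennreal M0" "M0 \<ge> 1"
    and r: "l1_norm (u - w) \<le> int r"
  shows "prob {x \<in> space \<mu>. list_weight x (short_path u w) \<ge> a} \<le> M0 ^ r * exp (- \<delta> * a)"
proof -
  have "prob {x \<in> space \<mu>. exp (\<delta> * list_weight x (short_path u w)) \<ge> exp (\<delta> * a)} \<le> M0 ^ r / exp (\<delta> * a)"
    by (intro prob_ge_le_mean mean_le_exp_short_path \<delta> r) simp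
  moreover have "exp (\<delta> * list_weight x (short_path u w)) \<ge> exp (\<delta> * a) \<longleftrightarrow> list_weight x (short_path u w) \<ge> a" for x
    using \<delta>(1) by simp
  ultimately show ?thesis by (simp add: exp_minus divide_inverse)
qed

text \<open>Averaging changes the truncated passage time by at most the weight of two detours of length
  of order \<open>m\<close>, one at each end.\<close>

lemma prob_avg_passage_diff:
  fixes v :: "int ^ 'd"
  assumes \<delta>: "\<delta> > 0" "(\<integral>\<^sup>+t. ennreal (exp (\<delta> * t)) \<partial>\<nu>) \<le> ennreal M0" "M0 \<ge> 1"
    and m: "m \<ge> 1" and r: "r = CARD('d) * m"
  shows "prob {x \<in> space \<mu>. \<bar>avg_passage m M v x - min M (passage_time x 0 v)\<bar> \<ge> s}
    \<le> 4 * real (m ^ CARD('d)) * (M0 ^ r * exp (- \<delta> * (s / 2)))"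
proof -
  let ?Z = "lattice_box m :: (int ^ 'd) set"
  have cZ: "real (card ?Z) > 0" by (rule card_lattice_box_pos[OF m])
  have z0: "(0 :: int ^ 'd) \<in> ?Z" using m by (simp add: lattice_box_def)
  define P where "P z = [short_path 0 z, short_path z 0, short_path v (z + v), short_path (z + v) v]" for z :: "int ^ 'd"
  define E where "E z p = {x \<in> space \<mu>. list_weight x p \<ge> s / 2}" for z :: "int ^ 'd" and p :: "(int ^ 'd) list"
  have Em: "E z p \<in> sets \<mu>" if "p \<in> set (P z)" for z p
  proof -
    have "successively lattice_adj p" using that short_path(1) unfolding P_def by (auto simp: lattice_path_def)
    then have [measurable]: "(\<lambda>x. list_weight x p) \<in> borel_measurable \<mu>" by (rule measurable_list_weight)
    show ?thesis unfolding E_def by measurable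
  qed
  have Ep: "prob (E z p) \<le> M0 ^ r * exp (- \<delta> * (s / 2))" if "p \<in> set (P z)" "z \<in> ?Z" for z p
  proof -
    have "l1_norm (z - 0) \<le> int r" "l1_norm (0 - z) \<le> int r"
      using l1_norm_box_diff[OF that(2) z0] l1_norm_box_diff[OF z0 that(2)] by (simp_all add: r)
    then have "\<exists>u w. p = short_path u w \<and> l1_norm (u - w) \<le> int r"
      using that(1) unfolding P_def by fastforce
    then show ?thesis unfolding E_def using prob_short_path_ge[OF \<delta>] by blast
  qed
  have sub: "{x \<in> space \<mu>. \<bar>avg_passage m M v x - min M (passage_time x 0 v)\<bar> \<ge> s} \<subseteq> (\<Union>z\<in>?Z. \<Union>p\<in>set (P z). E z p)"
  proof
    fix x assume "x \<in> {x \<in> space \<mu>. \<bar>avg_passage m M v x - min M (passage_time x 0 v)\<bar> \<ge> s}"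
    then have x: "x \<in> space \<mu>" "\<bar>avg_passage m M v x - min M (passage_time x 0 v)\<bar> \<ge> s" by auto
    show "x \<in> (\<Union>z\<in>?Z. \<Union>p\<in>set (P z). E z p)"
    proof (rule ccontr)
      assume "\<not> ?thesis"
      then have small: "list_weight x p < s / 2" if "z \<in> ?Z" "p \<in> set (P z)" for z p
        using that x(1) unfolding E_def by force
      have d: "\<bar>min M (passage_time x z (z + v)) - min M (passage_time x 0 v)\<bar> < s" if z: "z \<in> ?Z" for z
      proof -
        have "passage_time x 0 v \<le> list_weight x (short_path 0 z) + passage_time x z (z + v) + list_weight x (short_path (z + v) v)"
          by (intro passage_time_detour nonneg x(1) short_path)
        moreover have "passage_time x z (z + v) \<le> list_weight x (short_path z 0) + passage_time x 0 v + list_weight x (short_path v (z + v))"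
          by (intro passage_time_detour nonneg x(1) short_path)
        moreover have "list_weight x (short_path 0 z) < s / 2" "list_weight x (short_path (z + v) v) < s / 2"
          "list_weight x (short_path z 0) < s / 2" "list_weight x (short_path v (z + v)) < s / 2"
          using small[OF z] unfolding P_def by auto
        ultimately show ?thesis by linarith
      qed
      have "avg_passage m M v x - min M (passage_time x 0 v)
          = (\<Sum>z\<in>?Z. min M (passage_time x z (z + v)) - min M (passage_time x 0 v)) / card ?Z"
        unfolding avg_passage_def using cZ by (simp add: sum_subtractf diff_divide_distrib)
      then have "\<bar>avg_passage m M v x - min M (passage_time x 0 v)\<bar>
          = \<bar>\<Sum>z\<in>?Z. min M (passage_time x z (z + v)) - min M (passage_time x 0 v)\<bar> / card ?Z"
        using cZ by simp
      also have "\<dots> \<le> (\<Sum>z\<in>?Z. \<bar>min M (passage_time x z (z + v)) - min M (passage_time x 0 v)\<bar>) / card ?Z"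
        by (intro divide_right_mono sum_abs) simp
      also have "\<dots> < (\<Sum>z\<in>?Z. s) / card ?Z"
      proof (rule divide_strict_right_mono[OF _ cZ])
        show "(\<Sum>z\<in>?Z. \<bar>min M (passage_time x z (z + v)) - min M (passage_time x 0 v)\<bar>) < (\<Sum>z\<in>?Z. s)"
          using z0 d finite_lattice_box[of m] by (intro sum_strict_mono) auto
      qed
      also have "\<dots> = s" using cZ by simp
      finally show False using x(2) by simp
    qed
  qed
  have "prob {x \<in> space \<mu>. \<bar>avg_passage m M v x - min M (passage_time x 0 v)\<bar> \<ge> s} \<le> prob (\<Union>z\<in>?Z. \<Union>p\<in>set (P z). E z p)"
    by (intro finite_measure_mono sub sets.finite_UN finite_lattice_box Em) auto
  also have "\<dots> \<le> (\<Sum>z\<in>?Z. prob (\<Union>p\<in>set (P z). E z p))"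
    by (intro measure_UNION_le finite_lattice_box sets.finite_UN Em) auto
  also have "\<dots> \<le> (\<Sum>z\<in>?Z. \<Sum>p\<in>set (P z). prob (E z p))"
    by (intro sum_mono measure_UNION_le Em) auto
  also have "\<dots> \<le> (\<Sum>z\<in>?Z. \<Sum>p\<in>set (P z). M0 ^ r * exp (- \<delta> * (s / 2)))"
    by (intro sum_mono Ep)
  also have "\<dots> \<le> (\<Sum>z\<in>?Z. 4 * (M0 ^ r * exp (- \<delta> * (s / 2))))"
  proof (rule sum_mono)
    fix z
    have "card (set (P z)) \<le> 4" using card_length[of "P z"] by (simp add: P_def)
    then have "real (card (set (P z))) * (M0 ^ r * exp (- \<delta> * (s / 2))) \<le> 4 * (M0 ^ r * exp (- \<delta> * (s / 2)))"
      using \<delta>(3) by (intro mult_right_mono) auto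
    then show "(\<Sum>p\<in>set (P z). M0 ^ r * exp (- \<delta> * (s / 2))) \<le> 4 * (M0 ^ r * exp (- \<delta> * (s / 2)))" by simp
  qed
  finally show ?thesis by (simp add: card_lattice_box mult.assoc mult.left_commute)
qed

lemma integral_avg_passage:
  assumes m: "m \<ge> 1" and M: "M \<ge> 0"
  shows "(\<integral>x. avg_passage m M v x \<partial>\<mu>) = (\<integral>x. min M (passage_time x 0 v) \<partial>\<mu>)"
proof -
  let ?Z = "lattice_box m :: (int ^ 'd) set"
  have restr: "passage_time (restrict x lattice_edges) 0 v = passage_time x 0 v" for x
    unfolding passage_time_def
    by (intro arg_cong[where f = Inf] image_cong refl sum.cong) (use lattice_path_edges in auto)
  have mm: "(\<lambda>x. min M (passage_time x z (z + v))) \<in> borel_measurable \<mu>" for z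
    by (intro borel_measurable_min borel_measurable_const measurable_passage_time)
  have each: "(\<integral>x. min M (passage_time x z (z + v)) \<partial>\<mu>) = (\<integral>x. min M (passage_time x 0 v) \<partial>\<mu>)" for z
    using integral_shift[of "\<lambda>x. min M (passage_time x 0 v)" z] mm[of 0] restr
    by (simp add: passage_time_shift)
  have int: "integrable \<mu> (\<lambda>x. min M (passage_time x z (z + v)))" for z
  proof (rule integrable_const_bound[where B = M])
    show "AE x in \<mu>. norm (min M (passage_time x z (z + v))) \<le> M"
      using passage_time_nonneg[OF nonneg] M by (intro AE_I2) (auto simp: min_def)
  qed (rule mm)
  have "(\<integral>x. avg_passage m M v x \<partial>\<mu>) = (\<Sum>z\<in>?Z. \<integral>x. min M (passage_time x z (z + v)) \<partial>\<mu>) / card ?Z"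
    unfolding avg_passage_def using int by (simp add: Bochner_Integration.integral_sum)
  then show ?thesis unfolding each using card_lattice_box_pos[OF m] by simp
qed

text \<open>The passage time is at most the weight of one shortest path, whose exponential moment is at
  most \<open>M0 ^ \<bar>v\<bar>\<close>.\<close>

lemma prob_passage_time_gt:
  assumes \<delta>: "\<delta> > 0" "(\<integral>\<^sup>+t. ennreal (exp (\<delta> * t)) \<partial>\<nu>) \<le> ennreal M0" "M0 \<ge> 1"
    and V: "l1_norm v = int V"
  shows "prob {x \<in> space \<mu>. passage_time x 0 v \<ge> M} \<le> M0 ^ V * exp (- \<delta> * M)"
proof -
  have "l1_norm (0 - v) \<le> int V" using V l1_norm_minus[of 0 v] by simp
  note b = prob_short_path_ge[OF \<delta> this, of M]
  have "{x \<in> space \<mu>. passage_time x 0 v \<ge> M} \<subseteq> {x \<in> space \<mu>. list_weight x (short_path 0 v) \<ge> M}"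
    using passage_time_le[OF nonneg short_path(1), of _ 0 v] by force
  moreover have [measurable]: "(\<lambda>x. list_weight x (short_path 0 v)) \<in> borel_measurable \<mu>"
    by (rule measurable_list_weight) (use short_path(1)[of 0 v] in \<open>simp add: lattice_path_def\<close>)
  ultimately have "prob {x \<in> space \<mu>. passage_time x 0 v \<ge> M} \<le> prob {x \<in> space \<mu>. list_weight x (short_path 0 v) \<ge> M}"
    by (intro finite_measure_mono) measurable
  then show ?thesis using b by linarith
qed

lemma integral_passage_time_truncate:
  assumes \<delta>: "\<delta> > 0" "(\<integral>\<^sup>+t. ennreal (exp (\<delta> * t)) \<partial>\<nu>) \<le> ennreal M0" "M0 \<ge> 1"
    and V: "l1_norm v = int V" and M: "M \<ge> 0"
  shows "\<bar>(\<integral>x. passage_time x 0 v \<partial>\<mu>) - (\<integral>x. min M (passage_time x 0 v) \<partial>\<mu>)\<bar> \<le> M0 ^ V * exp (- \<delta> * M) / \<delta>"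
proof -
  define S where "S x = list_weight x (short_path 0 v)" for x
  have "l1_norm (0 - v) \<le> int V" using V l1_norm_minus[of 0 v] by simp
  note me = mean_le_exp_short_path[OF \<delta>(2,3) this]
  have ie: "integrable \<mu> (\<lambda>x. exp (\<delta> * S x))" "(\<integral>x. exp (\<delta> * S x) \<partial>\<mu>) \<le> M0 ^ V"
    using mean_le_integral[OF me] unfolding S_def by auto
  have S: "0 \<le> passage_time x 0 v" "passage_time x 0 v \<le> S x" if "x \<in> space \<mu>" for x
    unfolding S_def using passage_time_nonneg[OF nonneg[OF that]] passage_time_le[OF nonneg[OF that] short_path(1)] by auto
  have m: "(\<lambda>x. passage_time x 0 v) \<in> borel_measurable \<mu>" using measurable_passage_time[of 0 v] by simp
  have le: "u \<le> exp (\<delta> * u) / \<delta>" for u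
  proof -
    have "\<delta> * u \<le> exp (\<delta> * u)" using exp_ge_add_one_self[of "\<delta> * u"] by linarith
    then show ?thesis using \<delta>(1) by (simp add: pos_le_divide_eq mult.commute)
  qed
  have i1: "integrable \<mu> (\<lambda>x. passage_time x 0 v)"
  proof (rule Bochner_Integration.integrable_bound)
    show "integrable \<mu> (\<lambda>x. exp (\<delta> * S x) / \<delta>)" using ie(1) by simp
    show "AE x in \<mu>. norm (passage_time x 0 v) \<le> norm (exp (\<delta> * S x) / \<delta>)"
    proof (rule AE_I2)
      fix x assume x: "x \<in> space \<mu>"
      show "norm (passage_time x 0 v) \<le> norm (exp (\<delta> * S x) / \<delta>)"
        using S[OF x] le[of "S x"] \<delta>(1) by simp
    qed
  qed (rule m)
  have i2: "integrable \<mu> (\<lambda>x. min M (passage_time x 0 v))"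
    by (intro integrable_min integrable_const i1)
  have "(\<integral>x. passage_time x 0 v \<partial>\<mu>) - (\<integral>x. min M (passage_time x 0 v) \<partial>\<mu>)
      = (\<integral>x. passage_time x 0 v - min M (passage_time x 0 v) \<partial>\<mu>)"
    using i1 i2 by simp
  moreover have "\<dots> \<ge> 0" by (intro Bochner_Integration.integral_nonneg) simp
  moreover have "(\<integral>x. passage_time x 0 v - min M (passage_time x 0 v) \<partial>\<mu>)
      \<le> (\<integral>x. exp (- \<delta> * M) / \<delta> * exp (\<delta> * S x) \<partial>\<mu>)"
  proof (rule integral_mono)
    show "integrable \<mu> (\<lambda>x. exp (- \<delta> * M) / \<delta> * exp (\<delta> * S x))" using ie(1) by simp
    fix x assume x: "x \<in> space \<mu>"
    have "passage_time x 0 v - min M (passage_time x 0 v) \<le> exp (\<delta> * (S x - M)) / \<delta>"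
    proof (cases "passage_time x 0 v \<le> M")
      case True
      then show ?thesis using \<delta>(1) by simp
    next
      case False
      then have "passage_time x 0 v - min M (passage_time x 0 v) \<le> S x - M" using S[OF x] by simp
      then show ?thesis using le[of "S x - M"] by linarith
    qed
    also have "\<dots> = exp (- \<delta> * M) / \<delta> * exp (\<delta> * S x)"
      by (simp add: right_diff_distrib exp_diff exp_minus divide_inverse)
    finally show "passage_time x 0 v - min M (passage_time x 0 v) \<le> exp (- \<delta> * M) / \<delta> * exp (\<delta> * S x)" .
  qed (use i1 i2 in simp)
  moreover have "\<dots> \<le> M0 ^ V * exp (- \<delta> * M) / \<delta>"
  proof -
    have "exp (- \<delta> * M) / \<delta> * (\<integral>x. exp (\<delta> * S x) \<partial>\<mu>) \<le> exp (- \<delta> * M) / \<delta> * M0 ^ V"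
      using ie(2) \<delta>(1) by (intro mult_left_mono) auto
    then show ?thesis by (simp add: mult.commute)
  qed
  ultimately show ?thesis by linarith
qed

end

text \<open>For \<open>\<nu>\<close>-almost every \<open>t\<close>, \<open>exp (- \<kappa> * t)\<close> tends to \<open>0\<close> as \<open>\<kappa>\<close> grows. The second term pays for edge times
  that are lowered to a truncation level of at least \<open>1\<close>.\<close>

lemma (in edge_times) laplace_transform_small:
  assumes atom: "emeasure \<nu> {0} = 0" and q: "q > 0"
  obtains \<kappa> where "\<kappa> \<ge> 0" "(\<integral>\<^sup>+t. ennreal (exp (- \<kappa> * t)) \<partial>\<nu>) + ennreal (exp (- \<kappa>)) < ennreal q"
proof -
  have m: "(\<lambda>t. ennreal (exp (- c * t))) \<in> borel_measurable \<nu>" for c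
    by (rule measurable_nu) measurable
  have null: "{0} \<in> null_sets \<nu>"
    using atom by (auto simp: sets_nu sets_restrict_space_iff)
  have "(\<lambda>n. \<integral>\<^sup>+t. ennreal (exp (- real n * t)) \<partial>\<nu>) \<longlonglongrightarrow> (\<integral>\<^sup>+t. 0 \<partial>\<nu>)"
  proof (rule nn_integral_dominated_convergence[where w = "\<lambda>_. 1"])
    show "AE t in \<nu>. ennreal (exp (- real n * t)) \<le> 1" for n
      using AE_space by eventually_elim (auto simp: space_nu)
    have "AE t in \<nu>. t \<notin> {0}" using null by (rule AE_not_in)
    then show "AE t in \<nu>. (\<lambda>n. ennreal (exp (- real n * t))) \<longlonglongrightarrow> 0"
      using AE_space
    proof eventually_elim
      case (elim t)
      then have t: "t > 0" by (auto simp: space_nu)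
      have "(\<lambda>n. exp (- real n * t)) \<longlonglongrightarrow> 0" using t by real_asymp
      then have "(\<lambda>n. ennreal (exp (- real n * t))) \<longlonglongrightarrow> ennreal 0" by (rule tendsto_ennrealI)
      then show ?case by simp
    qed
    show "(\<lambda>t. ennreal (exp (- real n * t))) \<in> borel_measurable \<nu>" for n by (rule m)
    show "(\<integral>\<^sup>+t. 1 \<partial>\<nu>) < \<infinity>" by (simp add: prob_space.emeasure_space_1[OF prob_nu])
  qed auto
  moreover have "(\<lambda>n. ennreal (exp (- real n))) \<longlonglongrightarrow> ennreal 0"
    by (rule tendsto_ennrealI) real_asymp
  ultimately have "(\<lambda>n. (\<integral>\<^sup>+t. ennreal (exp (- real n * t)) \<partial>\<nu>) + ennreal (exp (- real n))) \<longlonglongrightarrow> 0 + 0"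
    by (intro tendsto_add) simp_all
  then have "eventually (\<lambda>n. (\<integral>\<^sup>+t. ennreal (exp (- real n * t)) \<partial>\<nu>) + ennreal (exp (- real n)) < ennreal q) sequentially"
    by (rule order_tendstoD) (use q in simp)
  then obtain n where "(\<integral>\<^sup>+t. ennreal (exp (- real n * t)) \<partial>\<nu>) + ennreal (exp (- real n)) < ennreal q"
    by (auto simp: eventually_sequentially)
  then show ?thesis using that[of "real n"] by simp
qed

text \<open>The deviation \<open>t * S\<close> with \<open>S = sqrt (\<bar>v\<bar> / ln \<bar>v\<bar>)\<close> is divided into four parts: truncation at
  \<open>M = cM * \<bar>v\<bar>\<close>, its effect on the expectation, averaging over the box, and the fluctuations of the
  average.\<close>

lemma (in edge_times) passage_time_concentration_large:
  fixes v :: "int ^ 'd" and R :: "real \<Rightarrow> real" and V :: nat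
  assumes dim: "CARD('d) \<ge> 2"
    and R: "\<And>s. 0 \<le> R s" "mono R" "\<And>s t. s \<le> t \<Longrightarrow> R t - R s \<le> L * (t - s)" "L > 0"
    and \<nu>: "\<nu> = distr std_normal_distribution (restrict_space borel {0..}) (\<lambda>s. (R s)\<^sup>2)"
    and \<delta>: "\<delta> > 0" "(\<integral>\<^sup>+t. ennreal (exp (\<delta> * t)) \<partial>\<nu>) < ennreal M0" "M0 \<ge> 1"
    and \<kappa>: "\<kappa> \<ge> 0" "(\<integral>\<^sup>+t. ennreal (exp (- \<kappa> * t)) \<partial>\<nu>) + ennreal (exp (- \<kappa>)) < ennreal q" "q \<ge> 0"
      "exp 1 * real (lattice_degree TYPE('d)) * q \<le> 1 / 2"
    and c\<rho>: "c\<rho> = 3 + 2 * real CARD('d) + \<kappa> / \<delta> * (2 * real CARD('d) + real CARD('d) * ln M0 + 1)"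
    and cM: "cM = (ln M0 + 1) / \<delta> + 1"
    and cK: "cK = 1152 * L\<^sup>2 * cM + 1"
    and B: "B = 16 * (3 + 2 * real CARD('d) + 2 * real CARD('d) * ln M0) / \<delta>"
    and V: "l1_norm v = int V" "V \<ge> 2" "real V powr (1 / 8) \<ge> c\<rho>"
      "sqrt (real V / ln (real V)) \<ge> B * real V powr (1 / 4)"
    and t: "1 \<le> t" "t \<le> real V"
  shows "prob {x \<in> space \<mu>. \<bar>passage_time x 0 v - (\<integral>y. passage_time y 0 v \<partial>\<mu>)\<bar> > t * sqrt (real V / ln (real V))}
    \<le> 2 * exp 2 * exp (- (t / (4 * sqrt (2 * cK)))) + 2 * exp (- t)"
proof -
  define S where "S = sqrt (real V / ln (real V))"
  define w where "w = real V powr (1 / 4)"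
  define m where "m = nat \<lceil>w\<rceil>"
  define D where "D = real CARD('d)"
  define M where "M = cM * real V"
  define r where "r = CARD('d) * m"
  define N where "N = real (m ^ CARD('d))"
  define \<rho> where "\<rho> = (3 + real r + ln N + \<kappa> / \<delta> * (2 * ln N + real r * ln M0 + 1)) / N"
  define f where "f x = passage_time x 0 v" for x
  define F where "F = avg_passage m M v"
  have \<delta>': "(\<integral>\<^sup>+t. ennreal (exp (\<delta> * t)) \<partial>\<nu>) \<le> ennreal M0" using \<delta>(2) by simp
  have D2: "D \<ge> 2" unfolding D_def using dim by simp
  have V1: "real V \<ge> 2" using V(2) by simp
  have lnV: "ln (real V) > 0" using V1 by simp
  have lnM0: "ln M0 \<ge> 0" using \<delta>(3) by simp
  have w1: "w \<ge> 1" unfolding w_def using V1 by (simp add: ge_one_powr_ge_zero)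
  have mw: "w \<le> real m" "real m \<le> 2 * w" unfolding m_def using w1 by linarith+
  have m1: "m \<ge> 1" using mw w1 by linarith
  have m1': "real m \<ge> 1" using m1 by simp
  have cM1: "cM \<ge> 1" unfolding cM using lnM0 \<delta>(1) by simp
  have MV: "M \<ge> real V" unfolding M_def using cM1 V1 by (simp add: mult_le_cancel_right1)
  have M1: "M \<ge> 1" using MV V1 by linarith
  \<comment> \<open>The small constant \<open>\<rho>\<close>: the box has \<open>m\<^sup>d \<ge> m\<^sup>2\<close> points and a minimal path visits of order \<open>m\<close>
    of them.\<close>
  have N2: "N \<ge> real m * real m"
  proof -
    have "real m ^ 2 \<le> real m ^ CARD('d)" using dim m1' by (intro power_increasing)
    then show ?thesis by (simp add: N_def power2_eq_square)
  qed
  have N1: "N \<ge> 1"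
  proof -
    have "1 * 1 \<le> real m * real m" using m1' by (intro mult_mono) auto
    then show ?thesis using N2 by simp
  qed
  have lnN: "0 \<le> ln N" "ln N \<le> D * real m"
  proof -
    show "0 \<le> ln N" using N1 by simp
    have "ln N = D * ln (real m)" unfolding N_def D_def using m1' by (simp add: ln_realpow)
    also have "ln (real m) \<le> real m" using ln_le_minus_one[of "real m"] m1' by simp
    finally show "ln N \<le> D * real m" using D2 by (simp add: mult_left_mono)
  qed
  have rD: "real r = D * real m" unfolding r_def D_def by simp
  have c\<rho>0: "c\<rho> > 0"
  proof -
    have "0 \<le> \<kappa> / \<delta> * (2 * D + D * ln M0 + 1)" using \<kappa>(1) \<delta>(1) D2 lnM0 by (intro mult_nonneg_nonneg) auto
    then show ?thesis unfolding c\<rho> D_def[symmetric] using D2 by linarith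
  qed
  have \<rho>0: "\<rho> > 0"
  proof -
    have "0 \<le> \<kappa> / \<delta> * (2 * ln N + real r * ln M0 + 1)"
      using \<kappa>(1) \<delta>(1) lnN lnM0 by (intro mult_nonneg_nonneg add_nonneg_nonneg) auto
    then show ?thesis unfolding \<rho>_def using N1 lnN by (intro divide_pos_pos add_pos_nonneg) auto
  qed
  have \<rho>m: "\<rho> \<le> c\<rho> / real m"
  proof -
    have "3 + real r + ln N + \<kappa> / \<delta> * (2 * ln N + real r * ln M0 + 1)
        \<le> 3 * real m + D * real m + D * real m + \<kappa> / \<delta> * (2 * (D * real m) + D * real m * ln M0 + real m)"
      unfolding rD using lnN m1' \<kappa>(1) \<delta>(1) by (intro add_mono mult_left_mono order_refl) auto
    also have "\<dots> = c\<rho> * real m" unfolding c\<rho> D_def[symmetric] by (simp add: algebra_simps add_divide_distrib)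
    finally have "\<rho> \<le> c\<rho> * real m / N" unfolding \<rho>_def using N1 by (intro divide_right_mono) auto
    also have "\<dots> \<le> c\<rho> * real m / (real m * real m)"
      using N2 N1 m1' c\<rho>0 by (intro divide_left_mono mult_pos_pos) (auto intro: mult_nonneg_nonneg)
    also have "\<dots> = c\<rho> / real m" using m1' by simp
    finally show ?thesis .
  qed
  define h where "h = real V powr (1 / 8)"
  have h1: "h > 1" unfolding h_def using V1 by (simp add: gr_one_powr)
  have wh: "w = h * h" unfolding w_def h_def by (simp add: powr_add[symmetric])
  have \<rho>h: "\<rho> \<le> 1 / h"
  proof -
    have "c\<rho> / real m \<le> h / (h * h)" using V(3) mw(1) w1 c\<rho>0 unfolding h_def[symmetric] wh
      by (intro frac_le) auto
    then show ?thesis using \<rho>m h1 by simp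
  qed
  have \<rho>1: "\<rho> < 1" using \<rho>h h1 by (smt (verit) divide_less_eq_1)
  have ln\<rho>: "ln (real V) / 8 \<le> ln (1 / \<rho>)"
  proof -
    have "h \<le> 1 / \<rho>" using \<rho>h \<rho>0 h1 by (simp add: field_simps)
    then have "ln h \<le> ln (1 / \<rho>)" using h1 \<rho>0 by simp
    moreover have "ln h = ln (real V) / 8" unfolding h_def using V1 by (simp add: ln_powr)
    ultimately show ?thesis by simp
  qed
  \<comment> \<open>The variance bound holds with \<open>K\<close>, a constant multiple of \<open>S\<^sup>2\<close>, so \<open>sqrt (2 * K)\<close> is a multiple
    of \<open>S\<close>.\<close>
  have S2: "S\<^sup>2 = real V / ln (real V)" unfolding S_def using lnV by simp
  have VlnV: "real V / ln (real V) \<ge> 1"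
    using ln_le_minus_one[of "real V"] V1 lnV by (simp add: pos_le_divide_eq)
  have S1: "S \<ge> 1" unfolding S_def using VlnV by simp
  define K where "K = cK * S\<^sup>2"
  have cK1: "cK \<ge> 1" unfolding cK using cM1 by simp
  have K1: "K \<ge> 1 / 2"
  proof -
    have "1 * 1 \<le> cK * S\<^sup>2" using cK1 VlnV unfolding S2 by (intro mult_mono) auto
    then show ?thesis by (simp add: K_def)
  qed
  have \<kappa>M: "(\<integral>\<^sup>+t. ennreal (exp (- \<kappa> * t)) \<partial>\<nu>) + ennreal (exp (- \<kappa> * M)) < ennreal q"
  proof -
    have "\<kappa> * 1 \<le> \<kappa> * M" using \<kappa>(1) M1 by (intro mult_left_mono) auto
    then have "ennreal (exp (- \<kappa> * M)) \<le> ennreal (exp (- \<kappa>))" by (intro ennreal_leI) simp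
    then show ?thesis using \<kappa>(2) by (meson add_left_mono le_less_trans)
  qed
  have Mp: "M > 0" using M1 by simp
  have tail1: "prob {x \<in> space \<mu>. \<bar>F x - (\<integral>y. F y \<partial>\<mu>)\<bar> \<ge> t * S / 4} \<le> 2 * exp 2 * exp (- (t / (4 * sqrt (2 * cK))))"
  proof -
    have "prob {x \<in> space \<mu>. \<bar>F x - (\<integral>y. F y \<partial>\<mu>)\<bar> \<ge> t * S / 4} \<le> 2 * exp 2 * exp (- (t * S / 4) / sqrt (2 * K))"
    proof (rule tail_of_exp_variance)
      show "random_variable borel F" unfolding F_def by (rule measurable_avg_passage)
      show "0 \<le> F x \<and> F x \<le> M" if "x \<in> space \<mu>" for x
        unfolding F_def using avg_passage_bounds[OF that _ m1] M1 by auto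
      show "K \<ge> 1 / 2" by (rule K1)
      fix \<theta> :: real assume \<theta>: "\<bar>\<theta>\<bar> \<le> 1"
      define E where "E = (\<integral>x. exp (\<theta> * F x) \<partial>\<mu>)"
      have E0: "0 \<le> E" unfolding E_def by (intro Bochner_Integration.integral_nonneg) simp
      have "E - (\<integral>x. exp (\<theta> / 2 * F x) \<partial>\<mu>)\<^sup>2 \<le> 144 * L\<^sup>2 * M * \<theta>\<^sup>2 * E / ln (1 / \<rho>)"
        unfolding E_def F_def
        by (rule exp_variance_avg_passage)
          (fact R(1) R(2) R(3) R(4) \<nu> \<delta>(1) \<delta>(2) \<delta>(3) \<kappa>(1) \<kappa>M \<kappa>(3) \<kappa>(4) m1 Mp N_def r_def \<rho>_def \<rho>1 \<rho>0 \<theta>)+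
      also have "\<dots> \<le> 144 * L\<^sup>2 * M * \<theta>\<^sup>2 * E / (ln (real V) / 8)"
        using ln\<rho> lnV Mp E0 by (intro divide_left_mono mult_nonneg_nonneg mult_pos_pos) auto
      also have "\<dots> = (1152 * L\<^sup>2 * cM) * S\<^sup>2 * (\<theta>\<^sup>2 * E)" unfolding S2 M_def by simp
      also have "\<dots> \<le> cK * S\<^sup>2 * (\<theta>\<^sup>2 * E)"
        unfolding cK using E0 by (intro mult_right_mono mult_nonneg_nonneg) auto
      finally show "(\<integral>x. exp (\<theta> * F x) \<partial>\<mu>) - (\<integral>x. exp (\<theta> / 2 * F x) \<partial>\<mu>)\<^sup>2 \<le> K * \<theta>\<^sup>2 * (\<integral>x. exp (\<theta> * F x) \<partial>\<mu>)"
        unfolding E_def K_def by (simp add: mult_ac)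
    qed
    also have "(t * S / 4) / sqrt (2 * K) = t / (4 * sqrt (2 * cK))"
    proof -
      have "sqrt (2 * K) = sqrt (2 * cK) * S"
        unfolding K_def using S1 by (simp add: real_sqrt_mult)
      then show ?thesis using S1 by simp
    qed
    then have "- (t * S / 4) / sqrt (2 * K) = - (t / (4 * sqrt (2 * cK)))" by simp
    finally show ?thesis .
  qed
  \<comment> \<open>The \<open>4 * m ^ d\<close> detours have length of order \<open>w\<close>, and \<open>B\<close> is chosen such that \<open>\<delta> * S\<close> dominates
    the union bound over them.\<close>
  have BS: "S \<ge> B * w" using V(4) unfolding S_def w_def .
  define b where "b = 3 + 2 * D + 2 * D * ln M0"
  have Bb: "B = 16 * b / \<delta>" unfolding B b_def D_def ..
  have b3: "b \<ge> 3" unfolding b_def using D2 lnM0 by simp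
  have \<delta>S: "\<delta> * S \<ge> 16 * b * w"
  proof -
    have "\<delta> * (B * w) \<le> \<delta> * S" using BS \<delta>(1) by (intro mult_left_mono) auto
    then show ?thesis unfolding Bb using \<delta>(1) by simp
  qed
  have tail2: "prob {x \<in> space \<mu>. \<bar>F x - min M (f x)\<bar> \<ge> t * S / 4} \<le> exp (- t)"
  proof -
    have "prob {x \<in> space \<mu>. \<bar>F x - min M (f x)\<bar> \<ge> t * S / 4}
        \<le> 4 * real (m ^ CARD('d)) * (M0 ^ r * exp (- \<delta> * (t * S / 4 / 2)))"
      unfolding F_def f_def by (rule prob_avg_passage_diff[OF \<delta>(1) \<delta>' \<delta>(3) m1 r_def])
    also have "\<dots> = 4 * (N * M0 ^ r) * exp (- \<delta> * (t * S / 8))" unfolding N_def by simp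
    also have "\<dots> \<le> exp (2 * w) * (exp (D * real m) * exp (D * real m * ln M0)) * exp (- \<delta> * (t * S / 8))"
    proof (intro mult_right_mono mult_mono)
      have "(2 :: real) \<le> exp 1" using exp_ge_add_one_self[of 1] by simp
      then have "(2 :: real) * 2 \<le> exp 1 * exp 1" by (intro mult_mono) auto
      also have "\<dots> = exp 2" by (simp add: exp_add[symmetric])
      also have "\<dots> \<le> exp (2 * w)" using w1 by simp
      finally show "4 \<le> exp (2 * w)" by simp
      show "N \<le> exp (D * real m)" using lnN(2) N1 by (metis exp_le_cancel_iff exp_ln less_le_trans zero_less_one)
      have "M0 ^ r = exp (real r * ln M0)" using \<delta>(3) by (simp add: exp_of_nat_mult)
      then show "M0 ^ r \<le> exp (D * real m * ln M0)" unfolding rD by simp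
    qed (use N1 \<delta>(3) in auto)
    also have "\<dots> = exp (2 * w + D * real m + D * real m * ln M0 - \<delta> * S * t / 8)"
      unfolding exp_add[symmetric] by (rule arg_cong[where f = exp]) (simp add: algebra_simps)
    also have "\<dots> \<le> exp (- t)"
    proof -
      have "D * real m \<le> D * (2 * w)" using mw D2 by (intro mult_left_mono) auto
      moreover have "D * real m * ln M0 \<le> D * (2 * w) * ln M0"
        using calculation lnM0 by (rule mult_right_mono)
      ultimately have "2 * w + D * real m + D * real m * ln M0 \<le> (b - 1) * w"
        unfolding b_def by (simp add: algebra_simps)
      also have "\<dots> \<le> b * w" using w1 by (simp add: mult_right_mono)
      also have "\<dots> \<le> b * w * t" using mult_left_mono[OF t(1), of "b * w"] b3 w1 by simp
      finally have 1: "2 * w + D * real m + D * real m * ln M0 \<le> b * w * t" .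
      have 2: "16 * b * w * t \<le> \<delta> * S * t" using \<delta>S t(1) by (intro mult_right_mono) auto
      have "1 * 1 \<le> b * w" using b3 w1 by (intro mult_mono) auto
      then have 3: "t \<le> b * w * t" using t(1) by (simp add: mult_le_cancel_right1)
      show ?thesis using 1 2 3 by simp
    qed
    finally show ?thesis .
  qed
  \<comment> \<open>By the choice of \<open>cM\<close>, \<open>\<delta> * M\<close> exceeds \<open>\<bar>v\<bar> * ln M0\<close> by more than \<open>\<bar>v\<bar>\<close>.\<close>
  have trunc: "M0 ^ V * exp (- \<delta> * M) \<le> exp (- real V)"
  proof -
    have "M0 ^ V = exp (real V * ln M0)" using \<delta>(3) by (simp add: exp_of_nat_mult)
    moreover have "\<delta> * M = real V * (ln M0 + 1) + \<delta> * real V"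
      unfolding M_def cM using \<delta>(1) by (simp add: field_simps)
    moreover have "exp (real V * ln M0) * exp (- \<delta> * M) = exp (real V * ln M0 - \<delta> * M)"
      by (simp add: exp_diff exp_minus divide_inverse)
    ultimately have "M0 ^ V * exp (- \<delta> * M) = exp (real V * ln M0 - (real V * (ln M0 + 1) + \<delta> * real V))"
      by simp
    also have "\<dots> \<le> exp (- real V)" using \<delta>(1) V1 by (simp add: algebra_simps)
    finally show ?thesis .
  qed
  have tail3: "prob {x \<in> space \<mu>. f x \<ge> M} \<le> exp (- t)"
  proof -
    have "prob {x \<in> space \<mu>. f x \<ge> M} \<le> M0 ^ V * exp (- \<delta> * M)"
      unfolding f_def by (rule prob_passage_time_gt[OF \<delta>(1) \<delta>' \<delta>(3) V(1)])
    also have "\<dots> \<le> exp (- real V)" by (rule trunc)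
    also have "\<dots> \<le> exp (- t)" using t by simp
    finally show ?thesis .
  qed
  have mean: "\<bar>(\<integral>x. f x \<partial>\<mu>) - (\<integral>x. F x \<partial>\<mu>)\<bar> \<le> t * S / 4"
  proof -
    have M0': "M \<ge> 0" using M1 by simp
    have "\<bar>(\<integral>x. f x \<partial>\<mu>) - (\<integral>x. F x \<partial>\<mu>)\<bar> \<le> M0 ^ V * exp (- \<delta> * M) / \<delta>"
      unfolding F_def integral_avg_passage[OF m1 M0'] f_def
      by (rule integral_passage_time_truncate[OF \<delta>(1) \<delta>' \<delta>(3) V(1) M0'])
    also have "\<dots> \<le> 1 / \<delta>"
    proof (rule divide_right_mono)
      show "M0 ^ V * exp (- \<delta> * M) \<le> 1" by (rule order_trans[OF trunc]) simp
    qed (use \<delta>(1) in simp)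
    also have "\<dots> \<le> t * S / 4"
    proof -
      have "1 * 1 \<le> b * w" using b3 w1 by (intro mult_mono) auto
      then have "16 \<le> \<delta> * S" using \<delta>S by linarith
      also have "\<dots> \<le> \<delta> * S * t" using mult_left_mono[OF t(1), of "\<delta> * S"] S1 \<delta>(1) by simp
      finally show ?thesis using \<delta>(1) by (simp add: divide_le_eq mult_ac)
    qed
    finally show ?thesis .
  qed
  have fm [measurable]: "f \<in> borel_measurable \<mu>"
    unfolding f_def using measurable_passage_time[of 0 v] by simp
  have Fm [measurable]: "F \<in> borel_measurable \<mu>" unfolding F_def by (rule measurable_avg_passage)
  let ?A = "{x \<in> space \<mu>. f x \<ge> M}" and ?B = "{x \<in> space \<mu>. \<bar>F x - min M (f x)\<bar> \<ge> t * S / 4}"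
    and ?C = "{x \<in> space \<mu>. \<bar>F x - (\<integral>y. F y \<partial>\<mu>)\<bar> \<ge> t * S / 4}"
  have "{x \<in> space \<mu>. \<bar>f x - (\<integral>y. f y \<partial>\<mu>)\<bar> > t * S} \<subseteq> ?C \<union> (?B \<union> ?A)"
  proof
    fix x assume "x \<in> {x \<in> space \<mu>. \<bar>f x - (\<integral>y. f y \<partial>\<mu>)\<bar> > t * S}"
    then have x: "x \<in> space \<mu>" "\<bar>f x - (\<integral>y. f y \<partial>\<mu>)\<bar> > t * S" by auto
    have tS: "t * S \<ge> 0" using t(1) S1 by simp
    show "x \<in> ?C \<union> (?B \<union> ?A)"
    proof (rule ccontr)
      assume "x \<notin> ?C \<union> (?B \<union> ?A)"
      then have "f x < M" "\<bar>F x - min M (f x)\<bar> < t * S / 4" "\<bar>F x - (\<integral>y. F y \<partial>\<mu>)\<bar> < t * S / 4"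
        using x(1) by auto
      moreover have "min M (f x) = f x" using calculation(1) by simp
      ultimately show False using x(2) mean tS by (simp only:)
    qed
  qed
  then have "prob {x \<in> space \<mu>. \<bar>f x - (\<integral>y. f y \<partial>\<mu>)\<bar> > t * S} \<le> prob (?C \<union> (?B \<union> ?A))"
    by (intro finite_measure_mono) auto
  also have "\<dots> \<le> prob ?C + prob (?B \<union> ?A)" by (intro measure_Un_le) auto
  also have "\<dots> \<le> prob ?C + (prob ?B + prob ?A)" by (intro add_left_mono measure_Un_le) auto
  also have "\<dots> \<le> 2 * exp 2 * exp (- (t / (4 * sqrt (2 * cK)))) + (exp (- t) + exp (- t))"
    by (intro add_mono tail1 tail2 tail3)
  finally show ?thesis unfolding f_def S_def by simp
qed

theorem theorem5p4:
  fixes \<nu> :: "real measure" and \<mu> :: "((int ^ 'd::finite) set \<Rightarrow> real) measure"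
  assumes "CARD('d) \<ge> 2"
    and "nearly_gamma \<nu>"
    and "\<exists>\<delta>>0. (\<integral>\<^sup>+ x. ennreal (exp (\<delta> * x)) \<partial>\<nu>) < \<infinity>"
    and "\<mu> = PiM lattice_edges (\<lambda>_. \<nu>)"
  shows "\<exists>C1>0. \<exists>C2>0. \<forall>(v :: int ^ 'd) (t :: real).
    l1_norm v \<ge> 2 \<longrightarrow> 0 < t \<longrightarrow> t \<le> real_of_int (l1_norm v) \<longrightarrow>
    measure \<mu> {x \<in> space \<mu>.
        \<bar>passage_time x 0 v - (\<integral>y. passage_time y 0 v \<partial>\<mu>)\<bar>
          > t * sqrt (real_of_int (l1_norm v) / ln (real_of_int (l1_norm v)))}
      \<le> C1 * exp (- C2 * t)"
proof -
  obtain R L where R: "mono R" "\<And>s. 0 \<le> R s" "L > 0" "\<And>s t. s \<le> t \<Longrightarrow> R t - R s \<le> L * (t - s)"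
    and nu: "\<nu> = distr std_normal_distribution (restrict_space borel {0..}) (\<lambda>s. (R s)\<^sup>2)"
    using nearly_gamma_gaussian_image[OF assms(2)] by blast
  have P: "prob_space \<nu>" using assms(2) by (simp add: nearly_gamma_def)
  interpret edge_times \<nu> \<mu>
    by (rule edge_times.intro[OF P _ assms(4)]) (simp add: nu)
  obtain \<delta> where \<delta>: "\<delta> > 0" "(\<integral>\<^sup>+ x. ennreal (exp (\<delta> * x)) \<partial>\<nu>) < \<infinity>" using assms(3) by blast
  define M0 where "M0 = enn2real (\<integral>\<^sup>+ x. ennreal (exp (\<delta> * x)) \<partial>\<nu>) + 1"
  have M0: "M0 \<ge> 1" "(\<integral>\<^sup>+ x. ennreal (exp (\<delta> * x)) \<partial>\<nu>) < ennreal M0"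
  proof -
    show "M0 \<ge> 1" by (simp add: M0_def)
    have "(\<integral>\<^sup>+ x. ennreal (exp (\<delta> * x)) \<partial>\<nu>) = ennreal (M0 - 1)" using \<delta>(2) by (simp add: M0_def)
    also have "\<dots> < ennreal M0" using \<open>M0 \<ge> 1\<close> by (intro ennreal_lessI) auto
    finally show "(\<integral>\<^sup>+ x. ennreal (exp (\<delta> * x)) \<partial>\<nu>) < ennreal M0" .
  qed
  define q where "q = 1 / (2 * exp 1 * (real (lattice_degree TYPE('d)) + 1))"
  have q0: "q > 0" unfolding q_def by (intro divide_pos_pos mult_pos_pos) auto
  have q: "exp 1 * real (lattice_degree TYPE('d)) * q \<le> 1 / 2"
  proof -
    have "exp 1 * real (lattice_degree TYPE('d)) * q
        = real (lattice_degree TYPE('d)) / (2 * (real (lattice_degree TYPE('d)) + 1))"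
      unfolding q_def by simp
    also have "\<dots> \<le> 1 / 2" by (simp add: divide_le_eq)
    finally show ?thesis .
  qed
  obtain \<kappa> where \<kappa>: "\<kappa> \<ge> 0" "(\<integral>\<^sup>+t. ennreal (exp (- \<kappa> * t)) \<partial>\<nu>) + ennreal (exp (- \<kappa>)) < ennreal q"
    using laplace_transform_small[OF nearly_gamma_no_atom[OF assms(2)] q0] by blast
  define c\<rho> where "c\<rho> = 3 + 2 * real CARD('d) + \<kappa> / \<delta> * (2 * real CARD('d) + real CARD('d) * ln M0 + 1)"
  define cM where "cM = (ln M0 + 1) / \<delta> + 1"
  define cK where "cK = 1152 * L\<^sup>2 * cM + 1"
  define B where "B = 16 * (3 + 2 * real CARD('d) + 2 * real CARD('d) * ln M0) / \<delta>"
  have "eventually (\<lambda>V::real. V powr (1 / 8) \<ge> c\<rho>) at_top"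
  proof -
    have "filterlim (\<lambda>V::real. V powr (1 / 8)) at_top at_top" by real_asymp
    then show ?thesis by (simp add: filterlim_at_top)
  qed
  moreover have "eventually (\<lambda>V::real. sqrt (V / ln V) \<ge> B * V powr (1 / 4)) at_top"
  proof -
    have "filterlim (\<lambda>V::real. sqrt (V / ln V) / V powr (1 / 4)) at_top at_top" by real_asymp
    then have "eventually (\<lambda>V::real. sqrt (V / ln V) / V powr (1 / 4) \<ge> B) at_top" by (simp add: filterlim_at_top)
    then show ?thesis using eventually_gt_at_top[of 0]
      by eventually_elim (simp add: pos_le_divide_eq)
  qed
  ultimately have "eventually (\<lambda>V::real. V powr (1 / 8) \<ge> c\<rho> \<and> sqrt (V / ln V) \<ge> B * V powr (1 / 4)) at_top"
    by (rule eventually_conj)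
  then obtain V0 where V0: "\<And>V. V \<ge> V0 \<Longrightarrow> V powr (1 / 8) \<ge> c\<rho> \<and> sqrt (V / ln V) \<ge> B * V powr (1 / 4)"
    by (auto simp: eventually_at_top_linorder)
  define c where "c = 1 / (4 * sqrt (2 * cK))"
  have cK0: "cK > 0"
  proof -
    have "cM \<ge> 0" unfolding cM_def using M0(1) \<delta>(1) by simp
    then show ?thesis unfolding cK_def by (intro add_nonneg_pos) auto
  qed
  have c0: "c > 0" unfolding c_def using cK0 by simp
  define C2 where "C2 = min c 1"
  define T where "T = max 1 V0"
  define C1 where "C1 = 2 * exp 2 + 2 + exp (C2 * T)"
  have C20: "C2 > 0" unfolding C2_def using c0 by simp
  have C10: "C1 > 0" unfolding C1_def by (simp add: add_pos_pos)
  have main: "measure \<mu> {x \<in> space \<mu>. \<bar>passage_time x 0 v - (\<integral>y. passage_time y 0 v \<partial>\<mu>)\<bar>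
          > t * sqrt (real_of_int (l1_norm v) / ln (real_of_int (l1_norm v)))} \<le> C1 * exp (- C2 * t)"
    if v: "l1_norm v \<ge> 2" and t: "0 < t" "t \<le> real_of_int (l1_norm v)" for v :: "int ^ 'd" and t
  proof -
    define V where "V = nat (l1_norm v)"
    have V: "l1_norm v = int V" "V \<ge> 2" using v by (auto simp: V_def)
    have rV: "real_of_int (l1_norm v) = real V" using V(1) by simp
    show ?thesis
    proof (cases "1 \<le> t \<and> V0 \<le> real V")
      case True
      have "prob {x \<in> space \<mu>. \<bar>passage_time x 0 v - (\<integral>y. passage_time y 0 v \<partial>\<mu>)\<bar> > t * sqrt (real V / ln (real V))}
          \<le> 2 * exp 2 * exp (- (t / (4 * sqrt (2 * cK)))) + 2 * exp (- t)"
      proof (rule passage_time_concentration_large[OF assms(1) R(2) R(1) _ R(3) nu \<delta>(1) M0(2,1) \<kappa>(1,2)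
            less_imp_le[OF q0] q c\<rho>_def cM_def cK_def B_def V])
        show "R t - R s \<le> L * (t - s)" if "s \<le> t" for s t using that by (rule R(4))
        show "real V powr (1 / 8) \<ge> c\<rho>" "sqrt (real V / ln (real V)) \<ge> B * real V powr (1 / 4)"
          using V0[of "real V"] True by auto
        show "1 \<le> t" "t \<le> real V" using True t rV by auto
      qed
      also have "\<dots> \<le> 2 * exp 2 * exp (- C2 * t) + 2 * exp (- C2 * t)"
      proof (intro add_mono mult_left_mono)
        have "C2 * t \<le> c * t" "C2 * t \<le> 1 * t" unfolding C2_def using t by (auto intro!: mult_right_mono)
        then show "exp (- (t / (4 * sqrt (2 * cK)))) \<le> exp (- C2 * t)" "exp (- t) \<le> exp (- C2 * t)"
          by (simp_all add: c_def)
      qed auto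
      also have "\<dots> \<le> C1 * exp (- C2 * t)" unfolding C1_def by (simp add: distrib_right)
      finally show ?thesis unfolding rV .
    next
      case False
      then have "t \<le> T" unfolding T_def using t rV by auto
      then have "C2 * t \<le> C2 * T" using C20 by (intro mult_left_mono) auto
      then have "1 \<le> exp (C2 * T) * exp (- C2 * t)" by (simp add: exp_add[symmetric])
      also have "\<dots> \<le> C1 * exp (- C2 * t)" unfolding C1_def by (intro mult_right_mono) auto
      finally show ?thesis by (intro order_trans[OF prob_le_1])
    qed
  qed
  show ?thesis using C10 C20 main by blast
qed

end
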